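(* Let $G=SU(p,q)$ with $p,q\ge1$, $n=p+q$, $\mathfrak{g}=\mathfrak{sl}(n,\mathbb{C})$. Let $\tilde\lambda\in\mathfrak{h}^*$ be a $(p,q)$-dominant weight such that $\langle\tilde\lambda+\rho,\beta^\vee\rangle=0$. Then $\operatorname{GKdim}L(\tilde\lambda+z\zeta)$ (weakly) decreases to $0$ as $z$ increases in $\mathbb{Z}$; that is, the function $z\mapsto\operatorname{GKdim}L(\tilde\lambda+z\zeta)$ on $\mathbb{Z}$ is weakly decreasing and equals $0$ for all sufficiently large $z$. Moreover, $\operatorname{GKdim}L(\tilde\lambda+z\zeta)=pq$ if $z\in\mathbb{R}\setminus\mathbb{Z}$.
   Context: $\mathfrak{h}$ is the Cartan subalgebra of diagonal matrices; $\epsilon_i\in\mathfrak{h}^*$ is the $i$-th diagonal coordinate (so $\sum_i\epsilon_i=0$); positive roots are $\epsilon_i-\epsilon_j$, $i<j$; $\rho$ is the half sum of positive roots; $\beta=\epsilon_1-\epsilon_n$ is the maximal noncompact root; $\zeta=\sum_{i=1}^p\epsilon_i$. Writing $\lambda+\rho=\sum_i\lambda_i\epsilon_i$, $\lambda$ is $(p,q)$-dominant if $\lambda_i-\lambda_j\in\mathbb{Z}_{>0}$ whenever $1\le i<j\le p$ or $p+1\le i<j\le p+q$. $L(\lambda)$ is the simple highest weight $\mathfrak{g}$-module of highest weight $\lambda$. Gelfand-Kirillov dimension: for a $U(\mathfrak{g})$-module $M$ generated by a finite-dimensional subspace $M_0$, and $V$ a finite-dimensional generating subspace of $U(\mathfrak{g})$,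 $\operatorname{GKdim}(M)=\limsup_{k\to\infty}\frac{\log\dim(V^kM_0)}{\log k}$, with $V^k$ the span of products of at most $k$ elements of $V$. *)

theory Defs
  imports
    "HOL-Analysis.Analysis"
    "HOL-Library.Poly_Mapping"
    "HOL-Algebra.Embedded_Algebras"
    "HOL-Algebra.QuotRing"
    "Jordan_Normal_Form.Matrix"
begin

text \<open>Matrix rows, columns and the coordinates of weights are indexed from 0, so that
  \<^term>\<open>i < n\<close> here plays the role of the index \<open>i + 1\<close> in the usual numbering.\<close>

section \<open>The Lie algebra of traceless matrices and its weights\<close>

definition sl :: "nat \<Rightarrow> complex mat set" where
  "sl n = {A \<in> carrier_mat n n. (\<Sum>i<n. A $$ (i, i)) = 0}"

definition lie_bracket :: "complex mat \<Rightarrow> complex mat \<Rightarrow> complex mat" where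
  "lie_bracket A B = A * B - B * A"

definition cartan :: "nat \<Rightarrow> complex mat set" where
  "cartan n = {H \<in> sl n. diagonal_mat H}"

text \<open>The sum of the root spaces of the positive roots: strictly upper triangular matrices.\<close>

definition nilradical :: "nat \<Rightarrow> complex mat set" where
  "nilradical n = {A \<in> carrier_mat n n. \<forall>i<n. \<forall>j\<le>i. A $$ (i, j) = 0}"

text \<open>Weights are functions on matrices of which only the values on \<^term>\<open>cartan n\<close> matter.\<close>

type_synonym weight = "complex mat \<Rightarrow> complex"

definition is_weight :: "nat \<Rightarrow> weight \<Rightarrow> bool" where
  "is_weight n lam \<longleftrightarrow>
     (\<forall>H\<in>cartan n. \<forall>H'\<in>cartan n. lam (H + H') = lam H + lam H') \<and>
     (\<forall>c. \<forall>H\<in>cartan n. lam (c \<cdot>\<^sub>m H) = c * lam H)"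

definition eps :: "nat \<Rightarrow> weight" where
  "eps i H = H $$ (i, i)"

definition rho :: "nat \<Rightarrow> weight" where
  "rho n H = (\<Sum>(i, j)\<in>{(i, j). i < j \<and> j < n}. eps i H - eps j H) / 2"

definition zeta :: "nat \<Rightarrow> weight" where
  "zeta p H = (\<Sum>i<p. eps i H)"

text \<open>The coroot of \<open>\<epsilon>\<^sub>i - \<epsilon>\<^sub>j\<close>, for \<open>i \<noteq> j\<close>, is \<open>E\<^sub>i\<^sub>i - E\<^sub>j\<^sub>j\<close>; the pairing of a weight with it
  is evaluation.\<close>

definition coroot :: "nat \<Rightarrow> nat \<Rightarrow> nat \<Rightarrow> complex mat" where
  "coroot n i j =
     mat n n (\<lambda>(a, b). if a = b then of_bool (a = i) - of_bool (a = j) else 0)"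

definition beta_coroot :: "nat \<Rightarrow> complex mat" where
  "beta_coroot n = coroot n 0 (n - 1)"

text \<open>The coordinates \<open>c\<close> are determined by \<open>lam\<close> only up to a common additive constant, because
  the \<open>\<epsilon>\<^sub>i\<close> sum to zero on \<^term>\<open>cartan n\<close>; the condition involves only their differences.\<close>

definition pq_dominant :: "nat \<Rightarrow> nat \<Rightarrow> weight \<Rightarrow> bool" where
  "pq_dominant p q lam \<longleftrightarrow>
     (\<exists>c :: nat \<Rightarrow> complex.
        (\<forall>H\<in>cartan (p + q). lam H + rho (p + q) H = (\<Sum>i<p + q. c i * eps i H)) \<and>
        (\<forall>i j. i < j \<and> j < p \<longrightarrow> (\<exists>m::nat. m > 0 \<and> c i - c j = of_nat m)) \<and>
        (\<forall>i j. p \<le> i \<and> i < j \<and> j < p + q \<longrightarrow> (\<exists>m::nat. m > 0 \<and> c i - c j = of_nat m)))"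

section \<open>The universal enveloping algebra\<close>

datatype 'a free_mon = FM (letters: "'a list")

instantiation free_mon :: (type) monoid_add
begin
definition zero_free_mon :: "'a free_mon" where "0 = FM []"
definition plus_free_mon :: "'a free_mon \<Rightarrow> 'a free_mon \<Rightarrow> 'a free_mon" where
  "u + v = FM (letters u @ letters v)"
instance
  by standard (simp_all add: zero_free_mon_def plus_free_mon_def)
end

text \<open>The multiplication of \<^typ>\<open>'a free_mon \<Rightarrow>\<^sub>0 complex\<close> is convolution, so this is the free
  associative unital algebra on the type \<^typ>\<open>'a\<close>. The next ring is the free algebra on the
  underlying set of \<^term>\<open>sl n\<close>.\<close>

type_synonym free_alg = "complex mat free_mon \<Rightarrow>\<^sub>0 complex"

definition free_ring :: "nat \<Rightarrow> free_alg ring" where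
  "free_ring n =
     \<lparr>carrier = {f. \<forall>w\<in>Poly_Mapping.keys f. set (letters w) \<subseteq> sl n},
      mult = (*), one = 1, zero = 0, add = (+)\<rparr>"

definition scalar :: "complex \<Rightarrow> free_alg" where
  "scalar c = Poly_Mapping.single 0 c"

definition gen :: "complex mat \<Rightarrow> free_alg" where
  "gen A = Poly_Mapping.single (FM [A]) 1"

text \<open>The first two families of relations turn the free algebra on the set \<^term>\<open>sl n\<close> into the
  tensor algebra of the vector space \<^term>\<open>sl n\<close>, the third one turns that into the
  enveloping algebra.\<close>

definition env_relations :: "nat \<Rightarrow> free_alg set" where
  "env_relations n =
     {gen (A + B) - gen A - gen B | A B. A \<in> sl n \<and> B \<in> sl n} \<union>
     {gen (c \<cdot>\<^sub>m A) - scalar c * gen A | c A. A \<in> sl n} \<union>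
     {gen A * gen B - gen B * gen A - gen (lie_bracket A B) | A B. A \<in> sl n \<and> B \<in> sl n}"

definition env_ideal :: "nat \<Rightarrow> free_alg set" where
  "env_ideal n = Idl\<^bsub>free_ring n\<^esub> (env_relations n)"

definition env_alg :: "nat \<Rightarrow> free_alg set ring" where
  "env_alg n = free_ring n Quot env_ideal n"

text \<open>The complex numbers inside the enveloping algebra.\<close>

definition env_scalars :: "nat \<Rightarrow> free_alg set set" where
  "env_scalars n = (\<lambda>c. env_ideal n +>\<^bsub>free_ring n\<^esub> scalar c) ` UNIV"

text \<open>The library's \<^const>\<open>subalgebra\<close> is a linear subspace, not necessarily closed under
  multiplication.\<close>

definition env_span :: "nat \<Rightarrow> free_alg set set \<Rightarrow> free_alg set set" where
  "env_span n X = \<Inter>{W. subalgebra (env_scalars n) W (env_alg n) \<and> X \<subseteq> W}"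

definition env_pow :: "nat \<Rightarrow> free_alg set set \<Rightarrow> nat \<Rightarrow> free_alg set set" where
  "env_pow n V k =
     env_span n {foldr (\<lambda>x y. x \<otimes>\<^bsub>env_alg n\<^esub> y) us \<one>\<^bsub>env_alg n\<^esub> | us.
                   set us \<subseteq> V \<and> length us \<le> k}"

definition fin_gen_subspace_env :: "nat \<Rightarrow> free_alg set set \<Rightarrow> bool" where
  "fin_gen_subspace_env n V \<longleftrightarrow>
     ring.finite_dimension (env_alg n) (env_scalars n) V \<and>
     (\<forall>S. subring S (env_alg n) \<and> env_scalars n \<subseteq> S \<and> V \<subseteq> S \<longrightarrow> S = carrier (env_alg n))"

section \<open>Modules\<close>

text \<open>The underlying space of a module is a linear subspace \<open>vspace\<close> of a complex vector space with
  scalar multiplication \<open>scal\<close>, whose elements are all elements of the type \<open>'v\<close>. In this way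
  modules of different dimensions can live on the same type.\<close>

record 'v sl_module =
  scal :: "complex \<Rightarrow> 'v \<Rightarrow> 'v"
  vspace :: "'v set"
  act :: "complex mat \<Rightarrow> 'v \<Rightarrow> 'v"

definition is_sl_module :: "nat \<Rightarrow> 'v::ab_group_add sl_module \<Rightarrow> bool" where
  "is_sl_module n M \<longleftrightarrow>
     vector_space (scal M) \<and> module.subspace (scal M) (vspace M) \<and>
     (\<forall>A\<in>sl n. \<forall>v\<in>vspace M. act M A v \<in> vspace M) \<and>
     (\<forall>A\<in>sl n. \<forall>v\<in>vspace M. \<forall>w\<in>vspace M. act M A (v + w) = act M A v + act M A w) \<and>
     (\<forall>A\<in>sl n. \<forall>c. \<forall>v\<in>vspace M. act M A (scal M c v) = scal M c (act M A v)) \<and>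
     (\<forall>A\<in>sl n. \<forall>B\<in>sl n. \<forall>v\<in>vspace M. act M (A + B) v = act M A v + act M B v) \<and>
     (\<forall>A\<in>sl n. \<forall>c. \<forall>v\<in>vspace M. act M (c \<cdot>\<^sub>m A) v = scal M c (act M A v)) \<and>
     (\<forall>A\<in>sl n. \<forall>B\<in>sl n. \<forall>v\<in>vspace M.
        act M (lie_bracket A B) v = act M A (act M B v) - act M B (act M A v))"

definition is_submodule :: "nat \<Rightarrow> 'v::ab_group_add sl_module \<Rightarrow> 'v set \<Rightarrow> bool" where
  "is_submodule n M N \<longleftrightarrow>
     module.subspace (scal M) N \<and> N \<subseteq> vspace M \<and> (\<forall>A\<in>sl n. \<forall>v\<in>N. act M A v \<in> N)"

definition generates_module :: "nat \<Rightarrow> 'v::ab_group_add sl_module \<Rightarrow> 'v set \<Rightarrow> bool" where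
  "generates_module n M X \<longleftrightarrow>
     X \<subseteq> vspace M \<and> (\<forall>N. is_submodule n M N \<and> X \<subseteq> N \<longrightarrow> N = vspace M)"

definition is_simple_module :: "nat \<Rightarrow> 'v::ab_group_add sl_module \<Rightarrow> bool" where
  "is_simple_module n M \<longleftrightarrow>
     is_sl_module n M \<and> vspace M \<noteq> {0} \<and> (\<forall>N. is_submodule n M N \<longrightarrow> N = {0} \<or> N = vspace M)"

definition is_highest_weight_module ::
    "nat \<Rightarrow> weight \<Rightarrow> 'v::ab_group_add sl_module \<Rightarrow> bool" where
  "is_highest_weight_module n lam M \<longleftrightarrow>
     is_sl_module n M \<and>
     (\<exists>v\<in>vspace M. v \<noteq> 0 \<and> generates_module n M {v} \<and>
        (\<forall>A\<in>nilradical n. act M A v = 0) \<and>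
        (\<forall>H\<in>cartan n. act M H v = scal M (lam H) v))"

text \<open>These properties determine the module up to isomorphism.\<close>

definition is_L :: "nat \<Rightarrow> weight \<Rightarrow> 'v::ab_group_add sl_module \<Rightarrow> bool" where
  "is_L n lam M \<longleftrightarrow> is_simple_module n M \<and> is_highest_weight_module n lam M"

section \<open>Gelfand-Kirillov dimension\<close>

definition free_act :: "'v::ab_group_add sl_module \<Rightarrow> free_alg \<Rightarrow> 'v \<Rightarrow> 'v" where
  "free_act M f v =
     (\<Sum>w\<in>Poly_Mapping.keys f. scal M (Poly_Mapping.lookup f w) (foldr (act M) (letters w) v))"

text \<open>An element of the enveloping algebra is a coset; on a module all of its representatives act
  in the same way.\<close>

definition env_act :: "'v::ab_group_add sl_module \<Rightarrow> free_alg set \<Rightarrow> 'v \<Rightarrow> 'v" where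
  "env_act M X v = free_act M (SOME f. f \<in> X) v"

definition fin_gen_subspace_module ::
    "nat \<Rightarrow> 'v::ab_group_add sl_module \<Rightarrow> 'v set \<Rightarrow> bool" where
  "fin_gen_subspace_module n M M0 \<longleftrightarrow>
     (\<exists>F. finite F \<and> F \<subseteq> vspace M \<and> M0 = module.span (scal M) F) \<and> generates_module n M M0"

definition filtration ::
    "nat \<Rightarrow> 'v::ab_group_add sl_module \<Rightarrow> free_alg set set \<Rightarrow> 'v set \<Rightarrow> nat \<Rightarrow> 'v set" where
  "filtration n M V M0 k =
     module.span (scal M) {env_act M x m | x m. x \<in> env_pow n V k \<and> m \<in> M0}"

definition growth_rate ::
    "nat \<Rightarrow> 'v::ab_group_add sl_module \<Rightarrow> free_alg set set \<Rightarrow> 'v set \<Rightarrow> ereal" where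
  "growth_rate n M V M0 =
     limsup (\<lambda>k. ereal (ln (real (vector_space.dim (scal M) (filtration n M V M0 k))) / ln (real k)))"

text \<open>The value common to all choices of generating subspaces. In particular, an equation between
  \<open>GKdim n M\<close> and a number includes the independence of the choices.\<close>

definition GKdim :: "nat \<Rightarrow> 'v::ab_group_add sl_module \<Rightarrow> ereal" where
  "GKdim n M =
     (THE d. \<forall>V M0. fin_gen_subspace_env n V \<and> fin_gen_subspace_module n M M0 \<longrightarrow>
                growth_rate n M V M0 = d)"

end

theory Submission
  imports Defs "HOL-Library.Function_Algebras" "HOL-Real_Asymp.Real_Asymp"
begin

text \<open>
  Write \<open>\<lambda> + \<rho> = \<Sum>\<^sub>i w\<^sub>i \<epsilon>\<^sub>i\<close>. In the tensor product of a highest weight module with \<open>\<complex>\<^sup>n\<close>, the vector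
  \<open>\<Prod>\<^bsub>j < i\<^esub> (E - w\<^sub>j) (v \<otimes> e\<^sub>i)\<close>, with \<open>E\<close> the tensor Casimir operator, is a highest weight vector of weight
  \<open>\<lambda> + \<epsilon>\<^sub>i\<close>, and it is nonzero when \<open>w\<^sub>i + 1\<close> differs from \<open>w\<^sub>j\<close> for all \<open>j < i\<close>. Since \<open>L(\<lambda> + \<epsilon>\<^sub>i)\<close> is a
  quotient of the module generated by this vector, raising \<open>w\<^sub>i\<close> by one does not increase the
  Gelfand-Kirillov dimension. Every part of the theorem follows by raising the coordinates one
  after the other. From \<open>\<lambda> + z\<^sub>1 \<zeta>\<close> one reaches \<open>\<lambda> + z\<^sub>2 \<zeta>\<close> for integers \<open>z\<^sub>1 \<le> z\<^sub>2\<close>, and from a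
  one-dimensional module one reaches \<open>\<lambda> + z \<zeta>\<close> for large \<open>z\<close>. For \<open>z\<close> not an integer, coordinates of the two blocks
  never meet, so there are chains from scalar weights \<open>s \<zeta>\<close> to \<open>\<lambda> + z \<zeta>\<close> and from \<open>\<lambda> + z \<zeta>\<close> to scalar weights
  with \<open>s\<close> very negative. For \<open>s < -q\<close> the scalar module is the space of all
  polynomials in \<open>p q\<close> variables: the relevant degree-preserving operator is negative definite for the Fischer product.
\<close>

section \<open>Words and spans\<close>

text \<open>The numbers compared are \<open>fil_dim\<close>: dimensions of the spans of words of
  length at most k in the matrix units, applied to one highest weight vector. The logarithmic growth
  rate ignores constant factors and affine changes of k, so tensoring with
  \<open>\<complex>\<^sup>n\<close> or changing the generating subspaces costs nothing. Among the
  highest weight modules of a given weight the simple one has the smallest such numbers. Hence it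
  suffices to produce some module of the right weight at each step, and its structure is irrelevant.
  The work is done over gl(n), where the matrix units have simple relations. The identity may act by
  any scalar, which matches the fact that the w_i are only determined up to a common constant. The
  obstacle is the nonvanishing condition: a coordinate that is being raised must never arrive at the
  value of a coordinate in front of it. This dictates the order of raising and the starting points.
  The condition on \<open>\<beta>\<close> makes all the differences of the w_i integers, across the
  two blocks as well. The bound -q arises from normal ordering: it compensates q copies of the Euler
  operator.\<close>

lemma span_linear_into:
  assumes "vector_space s" "vector_space t" "module.subspace t W"
    and add: "\<And>x y. f (x + y) = f x + f y" and scale: "\<And>c x. f (s c x) = t c (f x)"
    and into: "\<And>x. x \<in> S \<Longrightarrow> f x \<in> W" and x: "x \<in> module.span s S"
  shows "f x \<in> W"
proof -
  interpret s: vector_space s by fact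
  interpret t: vector_space t by fact
  have "s.subspace {x. f x \<in> W}"
  proof (rule s.subspaceI)
    have "f 0 = 0" using add[of 0 0] by simp
    then show "0 \<in> {x. f x \<in> W}" using t.subspace_0[OF assms(3)] by simp
  qed (use assms(3) in \<open>auto simp: add scale intro: t.subspace_add t.subspace_scale\<close>)
  moreover have "S \<subseteq> {x. f x \<in> W}" using into by auto
  ultimately show ?thesis using x s.span_minimal by blast
qed

text \<open>An infinite basis has cardinality 0, so \<open>dim\<close> is monotone only below a
  finite spanning set; \<open>F\<close> is that set.\<close>

lemma (in vector_space) dim_le_of_span:
  assumes "S \<subseteq> span T" "T \<subseteq> span F" "finite F"
  shows "dim S \<le> dim T"
proof -
  obtain B where B: "B \<subseteq> T" "independent B" "T \<subseteq> span B" "card B = dim T"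
    using basis_exists by blast
  have "finite B"
    using independent_span_bound[OF assms(3) B(2)] B(1) assms(2) by blast
  moreover have "S \<subseteq> span B"
    using assms(1) B(3) by (meson order_trans span_minimal subspace_span)
  ultimately show ?thesis using dim_le_card[of S B] B(4) by simp
qed

text \<open>The coefficients on the left do not depend on \<open>h\<close>. A relation expressing
  one vector through others can therefore be moved from one family of vectors to another.\<close>

lemma (in vector_space) sum_scale_delta_minus:
  assumes "finite B" "finite I" "\<And>b. b \<in> B \<Longrightarrow> t b \<in> I" "i \<in> I"
  shows "(\<Sum>j\<in>I. scale ((if j = i then 1 else 0) - (\<Sum>b\<in>{b\<in>B. t b = j}. r b)) (h j)) =
    h i - (\<Sum>b\<in>B. scale (r b) (h (t b)))"
proof -
  have "(\<Sum>j\<in>I. scale ((if j = i then 1 else 0) - (\<Sum>b\<in>{b\<in>B. t b = j}. r b)) (h j)) =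
      (\<Sum>j\<in>I. (if j = i then h j else 0) - (\<Sum>b\<in>{b\<in>B. t b = j}. scale (r b) (h (t b))))"
    by (rule sum.cong) (auto simp: scale_left_diff_distrib scale_sum_left)
  also have "\<dots> = (\<Sum>j\<in>I. (if j = i then h j else 0))
       - (\<Sum>j\<in>I. \<Sum>b\<in>{b\<in>B. t b = j}. scale (r b) (h (t b)))"
    by (rule sum_subtractf)
  also have "(\<Sum>j\<in>I. \<Sum>b\<in>{b\<in>B. t b = j}. scale (r b) (h (t b))) = (\<Sum>b\<in>B. scale (r b) (h (t b)))"
    by (rule sum.group) (use assms in auto)
  finally show ?thesis using assms by simp
qed

lemma dim_le_of_relations:
  assumes "vector_space s1" "vector_space s2" and fin: "finite I"
    and rel: "\<And>c. (\<Sum>i\<in>I. s1 (c i) (f i)) = 0 \<Longrightarrow> (\<Sum>i\<in>I. s2 (c i) (g i)) = 0"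
  shows "vector_space.dim s2 (g ` I) \<le> vector_space.dim s1 (f ` I)"
proof -
  interpret s1: vector_space s1 by fact
  interpret s2: vector_space s2 by fact
  obtain B where B: "B \<subseteq> f ` I" "s1.independent B" "f ` I \<subseteq> s1.span B" "card B = s1.dim (f ` I)"
    using s1.basis_exists by blast
  have finB: "finite B" using B(1) fin by (meson finite_imageI finite_subset)
  have "\<forall>b\<in>B. \<exists>i\<in>I. f i = b" using B(1) by blast
  then obtain t where t: "\<And>b. b \<in> B \<Longrightarrow> t b \<in> I" "\<And>b. b \<in> B \<Longrightarrow> f (t b) = b" by metis
  have inj: "inj_on t B" by (metis inj_onI t(2))
  have "g i \<in> s2.span (g ` t ` B)" if i: "i \<in> I" for i
  proof -
    obtain r where r: "f i = (\<Sum>b\<in>B. s1 (r b) b)"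
      using B(3) i s1.span_finite[OF finB] by auto
    define c where "c j = (if j = i then 1 else 0) - (\<Sum>b\<in>{b\<in>B. t b = j}. r b)" for j
    note expand = vector_space.sum_scale_delta_minus[where t = t and r = r, OF _ finB fin t(1) i, folded c_def]
    have "(\<Sum>j\<in>I. s1 (c j) (f j)) = 0"
      using expand[OF assms(1), where h = f] r t(2) by (simp cong: sum.cong)
    then have "(\<Sum>j\<in>I. s2 (c j) (g j)) = 0" by (rule rel)
    then have "g i = (\<Sum>b\<in>B. s2 (r b) (g (t b)))"
      using expand[OF assms(2), where h = g] by simp
    also have "\<dots> \<in> s2.span (g ` t ` B)"
      by (intro s2.span_sum s2.span_scale s2.span_base) auto
    finally show ?thesis .
  qed
  then have "s2.dim (g ` I) \<le> card (g ` t ` B)"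
    using finB by (intro s2.dim_le_card) auto
  also have "\<dots> \<le> card B"
    using finB by (metis card_image_le finite_imageI image_image)
  finally show ?thesis using B(4) by simp
qed

section \<open>Words in the matrix units and the subspaces they generate\<close>

definition word_act :: "(nat \<Rightarrow> nat \<Rightarrow> 'v \<Rightarrow> 'v) \<Rightarrow> (nat \<times> nat) list \<Rightarrow> 'v \<Rightarrow> 'v" where
  "word_act e w x = foldr (\<lambda>(a, b). e a b) w x"

lemma word_act_Nil [simp]: "word_act e [] x = x"
  and word_act_Cons [simp]: "word_act e ((a, b) # w) x = e a b (word_act e w x)"
  and word_act_append: "word_act e (u @ w) x = word_act e u (word_act e w x)"
  by (simp_all add: word_act_def)

definition words :: "nat \<Rightarrow> (nat \<times> nat) list set" where
  "words n = lists ({..<n} \<times> {..<n})"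

definition words_upto :: "nat \<Rightarrow> nat \<Rightarrow> (nat \<times> nat) list set" where
  "words_upto n k = {w \<in> words n. length w \<le> k}"

definition lower_words :: "nat \<Rightarrow> (nat \<times> nat) list set" where
  "lower_words n = lists {(a, b). b < a \<and> a < n}"

lemma words_simps [simp]: "[] \<in> words n" "(a, b) # w \<in> words n \<longleftrightarrow> a < n \<and> b < n \<and> w \<in> words n"
  "u @ w \<in> words n \<longleftrightarrow> u \<in> words n \<and> w \<in> words n"
  by (auto simp: words_def)

lemma lower_words_simps [simp]: "[] \<in> lower_words n"
  "(a, b) # w \<in> lower_words n \<longleftrightarrow> b < a \<and> a < n \<and> w \<in> lower_words n"
  by (auto simp: lower_words_def)

lemma lower_words_subset: "lower_words n \<subseteq> words n"
  unfolding lower_words_def words_def by (rule lists_mono) auto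

lemma finite_words_upto [simp]: "finite (words_upto n k)"
  unfolding words_upto_def words_def lists_eq_set
  by (rule finite_subset[OF _ finite_lists_length_le[of "{..<n} \<times> {..<n}" k]]) auto

lemma words_upto_mono: "k \<le> l \<Longrightarrow> words_upto n k \<subseteq> words_upto n l"
  by (auto simp: words_upto_def)

lemma words_UN: "words n = (\<Union>k. words_upto n k)"
  by (auto simp: words_upto_def)

lemma word_act_linear:
  assumes "\<And>a b x y. e a b (x + y) = e a b x + e a b y"
    and "\<And>a b c x. e a b (s c x) = s c (e a b x)"
  shows "word_act e w (x + y) = word_act e w x + word_act e w y"
    and "word_act e w (s c x) = s c (word_act e w x)"
proof -
  show "word_act e w (x + y) = word_act e w x + word_act e w y"
    by (induction w) (auto simp: assms(1) word_act_def)
  show "word_act e w (s c x) = s c (word_act e w x)"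
    by (induction w) (auto simp: assms(2) word_act_def)
qed

text \<open>The relations are those of the matrix units E_ab of gl(n) and are demanded only for
  indices below \<open>n\<close>. The operators are linear on the whole type, so no carrier set has
  to accompany them.\<close>

locale gl_module = vector_space scale
  for scale :: "complex \<Rightarrow> 'v::ab_group_add \<Rightarrow> 'v" +
  fixes n :: nat and e :: "nat \<Rightarrow> nat \<Rightarrow> 'v \<Rightarrow> 'v"
  assumes e_add: "e a b (x + y) = e a b x + e a b y"
    and e_scale: "e a b (scale r x) = scale r (e a b x)"
    and e_comm: "\<lbrakk>a < n; b < n; c < n; d < n\<rbrakk> \<Longrightarrow>
      e a b (e c d x) = e c d (e a b x) + (if b = c then e a d x else 0)
        - (if d = a then e c b x else 0)"
begin

definition hw :: "(nat \<Rightarrow> complex) \<Rightarrow> 'v \<Rightarrow> bool" where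
  "hw m v \<longleftrightarrow> v \<noteq> 0 \<and> (\<forall>a b. a < b \<and> b < n \<longrightarrow> e a b v = 0) \<and>
     (\<forall>a<n. e a a v = scale (m a) v)"

definition fil :: "nat \<Rightarrow> 'v \<Rightarrow> 'v set" where
  "fil k x = span ((\<lambda>w. word_act e w x) ` words_upto n k)"

definition cyc :: "'v \<Rightarrow> 'v set" where
  "cyc x = span ((\<lambda>w. word_act e w x) ` words n)"

text \<open>For a highest weight vector this is the complement of its line in \<open>cyc x\<close>,
  made up of the strictly lower weights.\<close>

definition low :: "'v \<Rightarrow> 'v set" where
  "low x = span ((\<lambda>w. word_act e w x) ` (lower_words n - {[]}))"

definition simple_at :: "'v \<Rightarrow> bool" where
  "simple_at v \<longleftrightarrow> (\<forall>y\<in>cyc v. y \<noteq> 0 \<longrightarrow> v \<in> cyc y)"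

lemma vector_space_scale: "vector_space scale" ..

lemma e_0 [simp]: "e a b 0 = 0"
  using e_add[of a b 0 0] by simp

lemma e_diff: "e a b (x - y) = e a b x - e a b y"
  using e_add[of a b "x - y" y] by (simp add: algebra_simps)

lemma e_sum: "e a b (\<Sum>i\<in>I. f i) = (\<Sum>i\<in>I. e a b (f i))"
  by (induction I rule: infinite_finite_induct) (simp_all add: e_add)

lemma word_act_add: "word_act e w (x + y) = word_act e w x + word_act e w y"
  and word_act_scale: "word_act e w (scale c x) = scale c (word_act e w x)"
  by (rule word_act_linear[of e scale, OF e_add e_scale])+

lemma word_act_0 [simp]: "word_act e w 0 = 0"
  using word_act_add[of w 0 0] by simp

lemma e_into:
  assumes "subspace W" "\<And>x. x \<in> S \<Longrightarrow> e a b x \<in> W" "x \<in> span S"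
  shows "e a b x \<in> W"
  by (rule span_linear_into[where s = scale and t = scale and S = S and W = W])
     (use assms in \<open>simp_all only: e_add e_scale vector_space_scale\<close>)

lemma word_act_into:
  assumes "subspace W" "\<And>x. x \<in> S \<Longrightarrow> word_act e w x \<in> W" "x \<in> span S"
  shows "word_act e w x \<in> W"
  by (rule span_linear_into[where s = scale and t = scale and S = S and W = W])
     (use assms in \<open>simp_all only: word_act_add word_act_scale vector_space_scale\<close>)

lemma subspace_cyc: "subspace (cyc x)" and subspace_fil: "subspace (fil k x)"
  and subspace_low: "subspace (low x)"
  by (simp_all add: cyc_def fil_def low_def)

lemma word_in_cyc: "w \<in> words n \<Longrightarrow> word_act e w x \<in> cyc x"
  and word_in_fil: "w \<in> words_upto n k \<Longrightarrow> word_act e w x \<in> fil k x"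
  by (auto simp: cyc_def fil_def intro: span_base)

lemma self_in_cyc [simp]: "x \<in> cyc x"
  using word_in_cyc[of "[]" x] by simp

lemma self_in_fil [simp]: "x \<in> fil k x"
  using word_in_fil[of "[]" k x] by (simp add: words_upto_def)

lemma e_cyc: "a < n \<Longrightarrow> b < n \<Longrightarrow> y \<in> cyc x \<Longrightarrow> e a b y \<in> cyc x"
  unfolding cyc_def by (rule e_into, rule subspace_span) (auto intro!: span_base image_eqI[of _ _ "(a, b) # _"])

lemma word_cyc: "w \<in> words n \<Longrightarrow> y \<in> cyc x \<Longrightarrow> word_act e w y \<in> cyc x"
  by (induction w) (auto simp: e_cyc)

lemma cyc_minimal: "y \<in> cyc x \<Longrightarrow> cyc y \<subseteq> cyc x"
  unfolding cyc_def[of y] by (rule span_minimal) (auto simp: subspace_cyc word_cyc)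

lemma fil_mono: "k \<le> l \<Longrightarrow> fil k x \<subseteq> fil l x"
  unfolding fil_def by (intro span_mono image_mono words_upto_mono)

lemma word_fil:
  assumes "u \<in> words_upto n j" "y \<in> fil k x" shows "word_act e u y \<in> fil (j + k) x"
proof (rule word_act_into[OF subspace_fil _ assms(2)[unfolded fil_def]])
  fix z assume "z \<in> (\<lambda>w. word_act e w x) ` words_upto n k"
  then obtain w where w: "w \<in> words_upto n k" "z = word_act e w x" by auto
  have "word_act e (u @ w) x \<in> fil (j + k) x"
    by (rule word_in_fil) (use w assms(1) in \<open>auto simp: words_upto_def\<close>)
  then show "word_act e u z \<in> fil (j + k) x" by (simp add: w word_act_append)
qed

lemma e_fil: "a < n \<Longrightarrow> b < n \<Longrightarrow> y \<in> fil k x \<Longrightarrow> e a b y \<in> fil (Suc k) x"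
  using word_fil[of "[(a, b)]" 1 y k x] by (simp add: words_upto_def)

lemma fil_subset_cyc: "fil k x \<subseteq> cyc x"
  unfolding fil_def cyc_def by (intro span_mono image_mono) (auto simp: words_upto_def)

lemma cyc_in_fil: assumes "y \<in> cyc x" shows "\<exists>k. y \<in> fil k x"
proof -
  have "subspace (\<Union>k. fil k x)"
  proof (rule subspaceI)
    show "0 \<in> (\<Union>k. fil k x)" using subspace_0[OF subspace_fil] by auto
    fix y z assume "y \<in> (\<Union>k. fil k x)" "z \<in> (\<Union>k. fil k x)"
    then obtain k l where "y \<in> fil k x" "z \<in> fil l x" by auto
    then have "y \<in> fil (max k l) x" "z \<in> fil (max k l) x"
      using fil_mono[of k "max k l" x] fil_mono[of l "max k l" x] by auto
    then show "y + z \<in> (\<Union>k. fil k x)" using subspace_add[OF subspace_fil] by blast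
  next
    fix c y assume "y \<in> (\<Union>k. fil k x)"
    then show "scale c y \<in> (\<Union>k. fil k x)" using subspace_scale[OF subspace_fil] by blast
  qed
  moreover have "(\<lambda>w. word_act e w x) ` words n \<subseteq> (\<Union>k. fil k x)"
    using word_in_fil by (auto simp: words_UN)
  ultimately have "cyc x \<subseteq> (\<Union>k. fil k x)" unfolding cyc_def by (rule span_minimal[rotated])
  then show ?thesis using assms by auto
qed

lemma dim_fil: "dim (fil k x) = dim ((\<lambda>w. word_act e w x) ` words_upto n k)"
  by (simp add: fil_def)

subsection \<open>Highest weight vectors\<close>

text \<open>The part of the Poincare-Birkhoff-Witt theorem that is needed: the span of the lower
  triangular words applied to \<open>v\<close> is stable under every \<open>e a b\<close>. This
  follows by induction on the word, commuting \<open>e a b\<close> past the first letter.\<close>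

lemma cyc_eq_lower:
  assumes "hw m v"
  shows "cyc v = span ((\<lambda>w. word_act e w v) ` lower_words n)" (is "_ = ?Y")
proof (rule antisym)
  have low: "e a b x \<in> ?Y" if "b < a" "a < n" "x \<in> ?Y" for a b x
    by (rule e_into[OF subspace_span _ that(3)])
       (use that in \<open>auto intro!: span_base image_eqI[of _ _ "(a, b) # _"]\<close>)
  have base: "e a b (word_act e w v) \<in> ?Y" if "a < n" "b < n" "w \<in> lower_words n" for a b w
    using that
  proof (induction w arbitrary: a b)
    case Nil
    have "v \<in> ?Y" by (rule span_base) (auto intro!: image_eqI[of _ _ "[]"])
    then show ?case using Nil assms low[of b a v]
      by (cases a b rule: linorder_cases) (auto simp: hw_def span_scale span_zero)
  next
    case (Cons l w)
    obtain c d where l: "l = (c, d)" by fastforce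
    with Cons.prems have cd: "d < c" "c < n" "w \<in> lower_words n" by auto
    have IH: "e a b (word_act e w v) \<in> ?Y" if "a < n" "b < n" for a b
      using Cons.IH that cd by auto
    have "e c d (e a b (word_act e w v)) \<in> ?Y"
      by (rule low) (use cd IH Cons.prems in auto)
    then show ?case using cd Cons.prems
      by (auto simp: l e_comm[of a b c d] intro!: span_add span_diff IH span_zero)
  qed
  show "cyc v \<subseteq> ?Y" unfolding cyc_def
  proof (rule span_minimal)
    show "(\<lambda>w. word_act e w v) ` words n \<subseteq> ?Y"
    proof safe
      fix w assume "w \<in> words n"
      then show "word_act e w v \<in> ?Y"
      proof (induction w)
        case Nil
        then show ?case by (auto intro!: span_base image_eqI[of _ _ "[]"])
      next
        case (Cons l w)
        obtain a b where l: "l = (a, b)" by fastforce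
        have "e a b (word_act e w v) \<in> ?Y"
          by (rule e_into[where S = "(\<lambda>w. word_act e w v) ` lower_words n"])
             (use Cons l base in auto)
        then show ?case by (simp add: l)
      qed
    qed
  qed simp
  show "?Y \<subseteq> cyc v"
    unfolding cyc_def by (intro span_mono image_mono lower_words_subset)
qed

lemma cyc_decomp:
  assumes "hw m v" "x \<in> cyc v" shows "\<exists>c. x - scale c v \<in> low v"
proof -
  have "lower_words n = insert [] (lower_words n - {[]})" by auto
  then have "x \<in> span (insert v ((\<lambda>w. word_act e w v) ` (lower_words n - {[]})))"
    using assms cyc_eq_lower[of m v] by (metis image_insert word_act_Nil)
  then show ?thesis unfolding low_def span_insert by auto
qed

lemma e_lower_cyc:
  assumes "hw m v" "b < a" "a < n" "x \<in> cyc v" shows "e a b x \<in> low v"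
  using assms(4) unfolding cyc_eq_lower[OF assms(1)]
  by (rule e_into[OF subspace_low, rotated])
     (use assms(2,3) in \<open>auto simp: low_def intro!: span_base image_eqI[of _ _ "(a, b) # _"]\<close>)

lemma e_diag_low:
  assumes "hw m v" "a < n" "x \<in> low v" shows "e a a x \<in> low v"
proof (rule e_into[OF subspace_low _ assms(3)[unfolded low_def]])
  fix y assume "y \<in> (\<lambda>w. word_act e w v) ` (lower_words n - {[]})"
  then obtain w where w: "w \<in> lower_words n" "w \<noteq> []" "y = word_act e w v" by auto
  obtain c d u where u: "w = (c, d) # u" using w(2) by (metis list.exhaust surj_pair)
  have cd: "d < c" "c < n" "u \<in> lower_words n" using w u by auto
  have "word_act e u v \<in> cyc v" using cd lower_words_subset word_in_cyc by blast
  then show "e a a y \<in> low v"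
    using cd assms(1,2) unfolding w(3) u
    by (auto simp: e_comm[of a a c d] intro!: span_add span_diff e_lower_cyc e_cyc subspace_add[OF subspace_low] subspace_diff[OF subspace_low] subspace_0[OF subspace_low])
qed

text \<open>The element \<open>\<Sum>\<^sub>a a e\<^sub>a\<^sub>a\<close> acts on a nonempty lower triangular word applied to \<open>v\<close> with an eigenvalue
  strictly above the one on \<open>v\<close>.\<close>

lemma hw_notin_low: assumes "hw m v" shows "v \<notin> low v"
proof
  assume v: "v \<in> low v"
  define h where "h x = (\<Sum>a<n. scale (of_nat a) (e a a x))" for x
  define h0 where "h0 = (\<Sum>a<n. of_nat a * m a)"
  have h_add: "h (x + y) = h x + h y" for x y
    by (simp add: h_def e_add scale_right_distrib sum.distrib)
  have h_scale: "h (scale c x) = scale c (h x)" for c x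
    by (simp add: h_def e_scale scale_sum_right ac_simps)
  have h_v: "h v = scale h0 v"
    using assms by (simp add: h_def h0_def hw_def scale_sum_left)
  have h_comm: "h (e a b x) = e a b (h x) + scale (of_nat a - of_nat b) (e a b x)"
    if "a < n" "b < n" for a b x
  proof -
    have "h (e a b x) = (\<Sum>c<n. scale (of_nat c) (e a b (e c c x)) + (if c = a then scale (of_nat c) (e a b x) else 0)
       - (if c = b then scale (of_nat c) (e a b x) else 0))"
      unfolding h_def
    proof (rule sum.cong)
      fix c assume "c \<in> {..<n}"
      then have "e c c (e a b x) = e a b (e c c x) + (if c = a then e c b x else 0) - (if b = c then e a c x else 0)"
        using e_comm[of c c a b x] that by simp
      then show "scale (of_nat c) (e c c (e a b x)) = scale (of_nat c) (e a b (e c c x))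
         + (if c = a then scale (of_nat c) (e a b x) else 0) - (if c = b then scale (of_nat c) (e a b x) else 0)"
        by (auto simp: scale_right_distrib scale_right_diff_distrib)
    qed simp
    also have "\<dots> = e a b (h x) + scale (of_nat a) (e a b x) - scale (of_nat b) (e a b x)"
      using that by (simp add: sum_subtractf sum.distrib h_def e_sum e_scale)
    finally show ?thesis by (simp add: algebra_simps)
  qed
  \<comment> \<open>The eigenvalue of \<open>h\<close> on a word applied to \<open>v\<close> exceeds
    the one on \<open>v\<close> by this amount, which is at least 1 for nonempty lower triangular
    words.\<close>
  define D where "D w = (\<Sum>(a, b)\<leftarrow>w. a - b)" for w :: "(nat \<times> nat) list"
  have h_word: "h (word_act e w v) = scale (h0 + of_nat (D w)) (word_act e w v)"
    if "w \<in> lower_words n" for w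
    using that
  proof (induction w)
    case Nil
    then show ?case by (simp add: h_v D_def)
  next
    case (Cons l w)
    then show ?case
      by (cases l) (auto simp: h_comm e_scale e_add D_def of_nat_diff algebra_simps)
  qed
  have D_pos: "D w \<ge> 1" if "w \<in> lower_words n" "w \<noteq> []" for w
    using that by (cases w) (auto simp: D_def)
  \<comment> \<open>The product of the operators \<open>h - h0 - r\<close> for r from 1 to N. It
    kills every eigenvector whose excess lies in this range and multiplies \<open>v\<close> by a
    nonzero number, up to sign the factorial of N.\<close>
  define pr where "pr N x = foldr (\<lambda>r x. h x - scale (h0 + of_nat r) x) [1..<Suc N] x" for N x
  have pr_eq: "pr N x = scale (\<Prod>r\<leftarrow>[1..<Suc N]. (t - of_nat r)) x" if "h x = scale (h0 + t) x" for N x t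
  proof -
    have "foldr (\<lambda>r x. h x - scale (h0 + of_nat r) x) rs x = scale (\<Prod>r\<leftarrow>rs. (t - of_nat r)) x" for rs
      by (induction rs) (auto simp: h_scale that algebra_simps)
    then show ?thesis by (simp add: pr_def)
  qed
  have foldr_add: "foldr (\<lambda>r x. h x - scale (h0 + of_nat r) x) rs (x + y) =
       foldr (\<lambda>r x. h x - scale (h0 + of_nat r) x) rs x + foldr (\<lambda>r x. h x - scale (h0 + of_nat r) x) rs y"
    for rs x y by (induction rs) (auto simp: h_add algebra_simps)
  have foldr_scale: "foldr (\<lambda>r x. h x - scale (h0 + of_nat r) x) rs (scale c x) =
       scale c (foldr (\<lambda>r x. h x - scale (h0 + of_nat r) x) rs x)"
    for rs c x by (induction rs) (auto simp: h_scale algebra_simps)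
  define K where "K = {x. \<exists>N0. \<forall>N\<ge>N0. pr N x = 0}"
  have "subspace K"
  proof (rule subspaceI)
    show "0 \<in> K" using foldr_add[of _ 0 0] by (simp add: K_def pr_def)
    fix x y assume "x \<in> K" "y \<in> K"
    then obtain N1 N2 where "\<forall>N\<ge>N1. pr N x = 0" "\<forall>N\<ge>N2. pr N y = 0" by (auto simp: K_def)
    then have "\<forall>N\<ge>max N1 N2. pr N (x + y) = 0" by (simp add: pr_def foldr_add)
    then show "x + y \<in> K" unfolding K_def by blast
  next
    fix c x assume "x \<in> K"
    then show "scale c x \<in> K" by (auto simp: K_def pr_def foldr_scale simp del: upt_Suc)
  qed
  moreover have "(\<lambda>w. word_act e w v) ` (lower_words n - {[]}) \<subseteq> K"
  proof (rule image_subsetI)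
    fix w assume "w \<in> lower_words n - {[]}"
    then have w: "w \<in> lower_words n" "w \<noteq> []" by auto
    have "pr N (word_act e w v) = 0" if "N \<ge> D w" for N
      proof -
        have "(0::complex) \<in> set (map (\<lambda>r. of_nat (D w) - of_nat r) [1..<Suc N])"
          using D_pos[OF w] that by (auto simp: image_iff intro!: bexI[of _ "D w"])
        then have "(\<Prod>r\<leftarrow>[1..<Suc N]. (of_nat (D w) - of_nat r :: complex)) = 0"
          by (metis prod_list_zero_iff)
        then show ?thesis using pr_eq[OF h_word[OF w(1)]] by simp
      qed
    then show "word_act e w v \<in> K" by (auto simp: K_def)
  qed
  ultimately have "v \<in> K" using v unfolding low_def by (meson span_minimal subsetD)
  then obtain N where "pr N v = 0" by (auto simp: K_def)
  moreover have "h v = scale (h0 + 0) v" by (simp add: h_v)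
  ultimately have "(\<Prod>r\<leftarrow>[1..<Suc N]. (0 - of_nat r :: complex)) = 0 \<or> v = 0"
    using pr_eq[of v 0 N] by simp
  moreover have "(\<Prod>r\<leftarrow>[1..<Suc N]. (0 - of_nat r :: complex)) \<noteq> 0"
    by (subst prod_list_zero_iff) auto
  ultimately show False using assms by (simp add: hw_def)
qed

end

text \<open>Composing with a linear projection onto \<open>V\<close> makes the operators total and the relations
  hold everywhere.\<close>

lemma gl_module_extend:
  assumes "vector_space s" and V: "module.subspace s V"
    and closed: "\<And>a b x. \<lbrakk>a < n; b < n; x \<in> V\<rbrakk> \<Longrightarrow> e a b x \<in> V"
    and add: "\<And>a b x y. \<lbrakk>a < n; b < n; x \<in> V; y \<in> V\<rbrakk> \<Longrightarrow> e a b (x + y) = e a b x + e a b y"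
    and scale: "\<And>a b c x. \<lbrakk>a < n; b < n; x \<in> V\<rbrakk> \<Longrightarrow> e a b (s c x) = s c (e a b x)"
    and comm: "\<And>a b c d x. \<lbrakk>a < n; b < n; c < n; d < n; x \<in> V\<rbrakk> \<Longrightarrow>
      e a b (e c d x) = e c d (e a b x) + (if b = c then e a d x else 0)
        - (if d = a then e c b x else 0)"
  obtains e' where "gl_module s n e'"
    "\<And>a b x. \<lbrakk>a < n; b < n; x \<in> V\<rbrakk> \<Longrightarrow> e' a b x = e a b x"
proof -
  interpret vector_space s by fact
  interpret vector_space_pair s s ..
  have "Vector_Spaces.linear s s id" by (rule linear_id)
  then obtain g where g: "range g \<subseteq> V" "Vector_Spaces.linear s s g" "\<forall>v\<in>V. g (id v) = v"
    using linear_exists_left_inverse_on[OF _ V, of id] by auto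
  have g_add: "g (x + y) = g x + g y" and g_scale: "g (s c x) = s c (g x)" for x y c
    using g(2) by (simp_all add: Vector_Spaces.linear_iff)
  have gV: "g x \<in> V" for x using g(1) by auto
  have g_id: "g x = x" if "x \<in> V" for x using g(3) that by simp
  define e' where "e' a b x = (if a < n \<and> b < n then e a b (g x) else 0)" for a b x
  show thesis
  proof
    show "gl_module s n e'"
    proof unfold_locales
      show "e' a b (e' c d x) = e' c d (e' a b x) + (if b = c then e' a d x else 0) - (if d = a then e' c b x else 0)"
        if "a < n" "b < n" "c < n" "d < n" for a b c d x
        using that comm[OF that gV] by (simp add: e'_def g_id closed gV)
    qed (auto simp: e'_def g_add g_scale gV add scale)
    show "e' a b x = e a b x" if "a < n" "b < n" "x \<in> V" for a b x
      using that by (simp add: e'_def g_id)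
  qed
qed

abbreviation fil_dim :: "(complex \<Rightarrow> 'v::ab_group_add \<Rightarrow> 'v) \<Rightarrow> nat \<Rightarrow> (nat \<Rightarrow> nat \<Rightarrow> 'v \<Rightarrow> 'v) \<Rightarrow> 'v \<Rightarrow> nat \<Rightarrow> nat" where
  "fil_dim s n e v k \<equiv> vector_space.dim s (gl_module.fil s n e k v)"

subsection \<open>Comparison with a simple module\<close>

text \<open>In the submodule of the product generated by \<open>(v, u)\<close> the weight space of \<open>(v, u)\<close> is a line,
  so the submodule cannot contain \<open>(0, u)\<close>. By simplicity it contains no \<open>(0, y)\<close> with \<open>y \<noteq> 0\<close>
  either: a linear relation among words applied to \<open>v\<close> also holds for \<open>u\<close>.\<close>

lemma dim_fil_simple_le:
  assumes "gl_module s n e" "gl_module t n f"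
    and hwv: "gl_module.hw s n e m v" and hwu: "gl_module.hw t n f m u"
    and simple: "gl_module.simple_at t n f u"
  shows "fil_dim t n f u k \<le> fil_dim s n e v k"
proof -
  interpret A: gl_module s n e by fact
  interpret B: gl_module t n f by fact
  define sp where "sp c z = (s c (fst z), t c (snd z))" for c z
  define ep where "ep a b z = (e a b (fst z), f a b (snd z))" for a b z
  interpret P: gl_module sp n ep
  proof unfold_locales
    show "ep a b (ep c d x) = ep c d (ep a b x) + (if b = c then ep a d x else 0) - (if d = a then ep c b x else 0)"
      if "a < n" "b < n" "c < n" "d < n" for a b c d x
      using A.e_comm[OF that] B.e_comm[OF that] by (simp add: ep_def prod_eq_iff)
  qed (auto simp: sp_def ep_def prod_eq_iff A.scale_right_distrib A.scale_left_distrib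
        B.scale_right_distrib B.scale_left_distrib A.e_add B.e_add A.e_scale B.e_scale)
  have word: "word_act ep w z = (word_act e w (fst z), word_act f w (snd z))" for w z
    by (induction w) (auto simp: ep_def)
  have hw: "P.hw m (v, u)"
    using hwv hwu unfolding A.hw_def B.hw_def P.hw_def
    by (auto simp: ep_def sp_def prod_eq_iff)
  have fst_low: "fst z \<in> A.low v" if "z \<in> P.low (v, u)" for z
    using that unfolding P.low_def
    by (rule span_linear_into[OF P.vector_space_scale A.vector_space_scale A.subspace_low, rotated -1])
       (auto simp: sp_def word A.low_def intro: A.span_base)
  have snd_low: "snd z \<in> B.low u" if "z \<in> P.low (v, u)" for z
    using that unfolding P.low_def
    by (rule span_linear_into[OF P.vector_space_scale B.vector_space_scale B.subspace_low, rotated -1])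
       (auto simp: sp_def word B.low_def intro: B.span_base)
  have snd_cyc: "snd z \<in> B.cyc u" if "z \<in> P.cyc (v, u)" for z
    using that unfolding P.cyc_def
    by (rule span_linear_into[OF P.vector_space_scale B.vector_space_scale B.subspace_cyc, rotated -1])
       (auto simp: sp_def word B.word_in_cyc)
  have no_top: "(0, u) \<notin> P.cyc (v, u)"
  proof
    assume "(0, u) \<in> P.cyc (v, u)"
    then obtain c where c: "(0, u) - sp c (v, u) \<in> P.low (v, u)"
      using P.cyc_decomp[OF hw] by blast
    have "c = 0"
    proof (rule ccontr)
      assume "c \<noteq> 0"
      moreover have "- s c v \<in> A.low v" using fst_low[OF c] by (simp add: sp_def)
      then have "s (- inverse c) (- s c v) \<in> A.low v" by (rule A.subspace_scale[OF A.subspace_low])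
      ultimately show False using A.hw_notin_low[OF hwv] by simp
    qed
    then have "u \<in> B.low u" using snd_low[OF c] by (simp add: sp_def)
    then show False using B.hw_notin_low[OF hwu] by simp
  qed
  have no_zero: "y = 0" if y: "(0, y) \<in> P.cyc (v, u)" for y
  proof (rule ccontr)
    assume "y \<noteq> 0"
    have "y \<in> B.cyc u" using snd_cyc[OF y] by simp
    then have "u \<in> B.cyc y" using simple \<open>y \<noteq> 0\<close> by (simp add: B.simple_at_def)
    then have "(0, u) \<in> P.cyc (v, u)" unfolding B.cyc_def
    proof (rule span_linear_into[OF B.vector_space_scale P.vector_space_scale P.subspace_cyc, rotated -1])
      fix x assume "x \<in> (\<lambda>w. word_act f w y) ` words n"
      then obtain w where w: "w \<in> words n" "x = word_act f w y" by auto
      have "word_act ep w (0, y) \<in> P.cyc (v, u)" by (rule P.word_cyc[OF w(1) y])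
      then show "(0, x) \<in> P.cyc (v, u)" by (simp add: word w)
    qed (auto simp: sp_def)
    then show False using no_top by simp
  qed
  show ?thesis unfolding A.dim_fil B.dim_fil
  proof (rule dim_le_of_relations)
    fix c assume rel: "(\<Sum>w\<in>words_upto n k. s (c w) (word_act e w v)) = 0"
    have "(\<Sum>w\<in>words_upto n k. sp (c w) (word_act ep w (v, u))) \<in> P.cyc (v, u)"
      by (intro P.subspace_sum[OF P.subspace_cyc] P.subspace_scale[OF P.subspace_cyc] P.word_in_cyc)
         (auto simp: words_upto_def)
    also have "(\<Sum>w\<in>words_upto n k. sp (c w) (word_act ep w (v, u))) =
        (0, \<Sum>w\<in>words_upto n k. t (c w) (word_act f w u))"
      by (simp add: word sp_def prod_eq_iff fst_sum snd_sum rel)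
    finally show "(\<Sum>w\<in>words_upto n k. t (c w) (word_act f w u)) = 0" by (rule no_zero)
  qed (auto simp: A.vector_space_scale B.vector_space_scale)
qed

subsection \<open>Matrix coefficients\<close>

definition pointwise :: "(complex \<Rightarrow> 'v \<Rightarrow> 'v) \<Rightarrow> complex \<Rightarrow> ('i \<Rightarrow> 'v) \<Rightarrow> 'i \<Rightarrow> 'v" where
  "pointwise s c f = (\<lambda>i. s c (f i))"

lemma vector_space_pointwise:
  fixes s :: "complex \<Rightarrow> 'v::ab_group_add \<Rightarrow> 'v"
  assumes "vector_space s" shows "vector_space (pointwise s :: _ \<Rightarrow> ('i \<Rightarrow> 'v) \<Rightarrow> _)"
proof -
  interpret vector_space s by fact
  show ?thesis
    by unfold_locales (auto simp: pointwise_def fun_eq_iff scale_right_distrib scale_left_distrib)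
qed

lemma vector_space_complex_mult: "vector_space ((*) :: complex \<Rightarrow> complex \<Rightarrow> complex)"
  by unfold_locales (auto simp: algebra_simps)

text \<open>All highest weight modules are transported to the type of functions on words, so that
  chains of constructions which enlarge the type can be iterated.\<close>

lemma hw_module_on_words:
  assumes "gl_module s n e" and hwv: "gl_module.hw s n e m v"
  obtains e' :: "nat \<Rightarrow> nat \<Rightarrow> ((nat \<times> nat) list \<Rightarrow> complex) \<Rightarrow> (nat \<times> nat) list \<Rightarrow> complex" and v'
  where "gl_module (pointwise (*)) n e'" "gl_module.hw (pointwise (*)) n e' m v'"
    "\<And>k. vector_space.dim (pointwise (*)) (gl_module.fil (pointwise (*)) n e' k v')
       \<le> fil_dim s n e v k"
proof -
  interpret A: gl_module s n e by fact
  interpret C: vector_space "(*) :: complex \<Rightarrow> complex \<Rightarrow> complex" by (rule vector_space_complex_mult)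
  interpret AC: vector_space_pair s "(*) :: complex \<Rightarrow> complex \<Rightarrow> complex" ..
  let ?p = "pointwise (*) :: complex \<Rightarrow> ((nat \<times> nat) list \<Rightarrow> complex) \<Rightarrow> _"
  interpret F: vector_space ?p
    by (rule vector_space_pointwise[OF vector_space_complex_mult])
  have "A.independent {v}" using hwv by (simp add: A.hw_def)
  then obtain \<phi> where \<phi>: "Vector_Spaces.linear s (*) \<phi>" "\<phi> v = 1"
    using AC.linear_independent_extend[of "{v}" "\<lambda>_. 1"] by auto
  have \<phi>_add: "\<phi> (x + y) = \<phi> x + \<phi> y" and \<phi>_scale: "\<phi> (s c x) = c * \<phi> x" for x y c
    using \<phi>(1) by (simp_all add: Vector_Spaces.linear_iff)
  \<comment> \<open>The matrix coefficients of \<open>x\<close> along all words. The map may have a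
    kernel, so dimensions can drop, but \<open>\<phi> v = 1\<close> keeps the image of
    \<open>v\<close> nonzero.\<close>
  define \<Phi> where "\<Phi> x = (\<lambda>w. \<phi> (word_act e w x))" for x
  have \<Phi>_add: "\<Phi> (x + y) = \<Phi> x + \<Phi> y" and \<Phi>_scale: "\<Phi> (s c x) = ?p c (\<Phi> x)" for x y c
    by (simp_all add: \<Phi>_def fun_eq_iff pointwise_def A.word_act_add A.word_act_scale \<phi>_add \<phi>_scale)
  have \<Phi>_0: "\<Phi> 0 = 0" using \<Phi>_add[of 0 0] by simp
  have \<Phi>_diff: "\<Phi> (x - y) = \<Phi> x - \<Phi> y" for x y
    using \<Phi>_add[of "x - y" y] by (simp add: algebra_simps)
  have \<Phi>_sum: "\<Phi> (\<Sum>i\<in>I. g i) = (\<Sum>i\<in>I. \<Phi> (g i))" for g and I :: "'z set"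
    by (induction I rule: infinite_finite_induct) (simp_all add: \<Phi>_0 \<Phi>_add)
  \<comment> \<open>Appending a letter on the right of the word realises the action of
    \<open>e a b\<close>. The relations hold only on the image \<open>V\<close> of
    \<open>\<Phi>\<close>, which is why \<open>gl_module_extend\<close> is invoked.\<close>
  define R where "R a b G = (\<lambda>w. G (w @ [(a, b)]))" for a b and G :: "(nat \<times> nat) list \<Rightarrow> complex"
  have R: "R a b (\<Phi> x) = \<Phi> (e a b x)" for a b x
    by (simp add: R_def \<Phi>_def word_act_append)
  have R_linear: "R a b (G + H) = R a b G + R a b H" "R a b (?p c G) = ?p c (R a b G)" for a b c G H
    by (simp_all add: R_def fun_eq_iff pointwise_def)
  define V where "V = \<Phi> ` A.cyc v"
  obtain e' where e': "gl_module ?p n e'"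
    "\<And>a b G. \<lbrakk>a < n; b < n; G \<in> V\<rbrakk> \<Longrightarrow> e' a b G = R a b G"
  proof (rule gl_module_extend[where s = ?p and V = V and e = R and n = n])
    show "F.subspace V"
    proof (rule F.subspaceI)
      show "0 \<in> V" using A.subspace_0[OF A.subspace_cyc] \<Phi>_0 by (force simp: V_def)
      show "x + y \<in> V" if "x \<in> V" "y \<in> V" for x y
        using that A.subspace_add[OF A.subspace_cyc] by (force simp: V_def \<Phi>_add[symmetric])
      show "?p c x \<in> V" if "x \<in> V" for c x
        using that A.subspace_scale[OF A.subspace_cyc] by (force simp: V_def \<Phi>_scale[symmetric])
    qed
    show "R a b (R c d G) = R c d (R a b G) + (if b = c then R a d G else 0) - (if d = a then R c b G else 0)"
      if abcd: "a < n" "b < n" "c < n" "d < n" and G: "G \<in> V" for a b c d G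
    proof -
      obtain x where x: "G = \<Phi> x" using G by (auto simp: V_def)
      show ?thesis unfolding x R A.e_comm[OF abcd] \<Phi>_add \<Phi>_diff by (simp add: \<Phi>_0)
    qed
  qed (auto simp: V_def R R_linear A.e_cyc F.vector_space_axioms)
  interpret E: gl_module ?p n e' by fact
  have e'\<Phi>: "e' a b (\<Phi> x) = \<Phi> (e a b x)" if "a < n" "b < n" "x \<in> A.cyc v" for a b x
    using that e'(2) by (simp add: V_def R)
  have word: "word_act e' w (\<Phi> v) = \<Phi> (word_act e w v)" if "w \<in> words n" for w
    using that by (induction w) (auto simp: e'\<Phi> A.word_in_cyc)
  have hw: "E.hw m (\<Phi> v)"
  proof -
    have "\<Phi> v [] = 1" by (simp add: \<Phi>_def \<phi>(2))
    then have "\<Phi> v \<noteq> 0" by (metis zero_fun_apply zero_neq_one)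
    then show ?thesis
      using hwv by (auto simp: E.hw_def A.hw_def e'\<Phi> \<Phi>_0 \<Phi>_scale)
  qed
  have "F.dim (E.fil k (\<Phi> v)) \<le> A.dim (A.fil k v)" for k
    unfolding A.dim_fil E.dim_fil
  proof (rule dim_le_of_relations[OF A.vector_space_scale E.vector_space_scale])
    fix c assume rel: "(\<Sum>w\<in>words_upto n k. s (c w) (word_act e w v)) = 0"
    have "(\<Sum>w\<in>words_upto n k. ?p (c w) (word_act e' w (\<Phi> v)))
        = (\<Sum>w\<in>words_upto n k. \<Phi> (s (c w) (word_act e w v)))"
      by (rule sum.cong) (auto simp: word words_upto_def \<Phi>_scale)
    then show "(\<Sum>w\<in>words_upto n k. ?p (c w) (word_act e' w (\<Phi> v))) = 0"
      by (simp add: \<Phi>_sum[symmetric] rel \<Phi>_0)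
  qed simp
  then show thesis using that e'(1) hw by blast
qed

subsection \<open>Tensoring with the natural representation\<close>

lemma foldr_append_commute:
  assumes comm: "\<And>x y F. P x (P y F) = P y (P x F)"
  shows "foldr P (us @ vs) F = foldr P (vs @ us) F"
proof -
  have "foldr P us (P y F) = P y (foldr P us F)" for us y F
    by (induction us) (simp_all add: comm)
  note c = this
  show ?thesis by (induction vs) (simp_all add: c)
qed

lemma sum_fun_apply: "(\<Sum>j\<in>J. g j) b = (\<Sum>j\<in>J. g j b)"
  by (induction J rule: infinite_finite_induct) simp_all

text \<open>The coefficient of \<open>v \<otimes> e\<^sub>i\<close> in \<open>\<Prod>\<^sub>x (E - x) (v \<otimes> e\<^sub>i)\<close>, where \<open>E\<close> is the tensor Casimir operator
  and \<open>y = w\<^sub>i\<close>.\<close>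

fun tcoeff :: "(nat \<Rightarrow> complex) \<Rightarrow> nat \<Rightarrow> complex \<Rightarrow> complex list \<Rightarrow> complex" where
  "tcoeff w i y [] = 1"
| "tcoeff w i y (x # xs) = (y - x) * tcoeff w i y xs + (\<Sum>a<i. tcoeff w a (w a) xs)"

text \<open>Reflects that the operators E - x commute; with it a factor can be moved to any place in
  the list.\<close>

lemma tcoeff_swap: "tcoeff w i y (x # z # xs) = tcoeff w i y (z # x # xs)"
  by (simp add: sum.distrib sum_distrib_left[symmetric] left_diff_distrib sum_subtractf algebra_simps)

lemma tcoeff_rotate: "tcoeff w i y (xs @ [x]) = tcoeff w i y (x # xs)"
proof (induction xs arbitrary: i y)
  case (Cons z xs)
  have "tcoeff w i y ((z # xs) @ [x]) = tcoeff w i y (z # x # xs)"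
    using Cons by simp
  then show ?case using tcoeff_swap by metis
qed simp

text \<open>In the sum over a < i + 1 the term a = i loses its own coefficient, because its factor
  is \<open>w i - w i\<close>. What it leaves behind adds one to the factor \<open>w a - w i\<close>
  of each term with a < i, that is, replaces \<open>w i\<close> by \<open>w i - 1\<close>.\<close>

lemma tcoeff_drop: "tcoeff w (Suc i) y (xs @ [w i]) = tcoeff w i y ((w i - 1) # xs)"
proof -
  have "tcoeff w (Suc i) y (w i # xs) = tcoeff w i y ((w i - 1) # xs)"
  proof (induction xs)
    case Nil
    then show ?case by simp
  next
    case (Cons x xs)
    have "tcoeff w (Suc i) y (w i # x # xs) = tcoeff w (Suc i) y (x # w i # xs)"
      by (rule tcoeff_swap)
    also have "\<dots> = (y - x) * tcoeff w i y ((w i - 1) # xs) + (\<Sum>a<Suc i. tcoeff w a (w a) (w i # xs))"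
      using Cons by simp
    also have "(\<Sum>a<Suc i. tcoeff w a (w a) (w i # xs)) = (\<Sum>a<i. tcoeff w a (w a) ((w i - 1) # xs))"
      by (simp add: sum.distrib[symmetric] algebra_simps)
    also have "(y - x) * tcoeff w i y ((w i - 1) # xs) + (\<Sum>a<i. tcoeff w a (w a) ((w i - 1) # xs))
        = tcoeff w i y (x # (w i - 1) # xs)" by simp
    also have "\<dots> = tcoeff w i y ((w i - 1) # x # xs)" by (rule tcoeff_swap)
    finally show ?case .
  qed
  then show ?thesis by (simp only: tcoeff_rotate)
qed

text \<open>Stripping off the last factor with \<open>tcoeff_drop\<close> turns each
  \<open>w j\<close> into \<open>w j - 1\<close>; the list \<open>zs\<close> collects these values.
  For i = 0 the recursion is a plain product.\<close>

lemma tcoeff_prod: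
  "tcoeff w i y (zs @ map w [0..<i]) = (\<Prod>j<i. y - w j + 1) * (\<Prod>z\<leftarrow>zs. y - z)"
proof (induction i arbitrary: zs)
  case 0
  show ?case by (induction zs) simp_all
next
  case (Suc i)
  have "tcoeff w (Suc i) y (zs @ map w [0..<Suc i]) = tcoeff w i y (((w i - 1) # zs) @ map w [0..<i])"
    using tcoeff_drop[of w i y "zs @ map w [0..<i]"] by simp
  also have "\<dots> = (\<Prod>j<i. y - w j + 1) * (\<Prod>z\<leftarrow>(w i - 1) # zs. y - z)" by (rule Suc)
  finally show ?case by (simp add: algebra_simps)
qed

section \<open>The tensor Casimir operator and the highest weight vectors it produces\<close>

context gl_module
begin

text \<open>A function \<open>F\<close> stands for the sum of the tensors of \<open>F c\<close> with
  the basis vectors e_c. Indices c at or beyond \<open>n\<close> are permitted by the type and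
  behave like a trivial representation.\<close>

definition ten :: "nat \<Rightarrow> nat \<Rightarrow> (nat \<Rightarrow> 'v) \<Rightarrow> nat \<Rightarrow> 'v" where
  "ten a b F = (\<lambda>c. e a b (F c) + (if c = a then F b else 0))"

text \<open>The invariant operator given by the sum over a and b of E_ab tensor E_ba, with
  components beyond \<open>n\<close> cut off.\<close>

definition cas :: "(nat \<Rightarrow> 'v) \<Rightarrow> nat \<Rightarrow> 'v" where
  "cas F = (\<lambda>b. if b < n then \<Sum>a<n. e a b (F a) else 0)"

definition cas_shift :: "complex \<Rightarrow> (nat \<Rightarrow> 'v) \<Rightarrow> nat \<Rightarrow> 'v" where
  "cas_shift x F = cas F - pointwise scale x F"

definition pure :: "'v \<Rightarrow> nat \<Rightarrow> nat \<Rightarrow> 'v" where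
  "pure v i = (\<lambda>c. if c = i then v else 0)"

definition shifted :: "'v \<Rightarrow> complex list \<Rightarrow> nat \<Rightarrow> nat \<Rightarrow> 'v" where
  "shifted v xs i = foldr cas_shift xs (pure v i)"

lemma shifted_simps [simp]: "shifted v [] i = pure v i"
  "shifted v (x # xs) i = cas_shift x (shifted v xs i)"
  by (simp_all add: shifted_def)

lemma ten_gl_module: "gl_module (pointwise scale) n ten"
proof -
  interpret F: vector_space "pointwise scale :: _ \<Rightarrow> (nat \<Rightarrow> 'v) \<Rightarrow> _"
    by (rule vector_space_pointwise[OF vector_space_scale])
  show ?thesis
  proof unfold_locales
    show "ten a b (ten c d x) = ten c d (ten a b x) + (if b = c then ten a d x else 0) - (if d = a then ten c b x else 0)"
      if "a < n" "b < n" "c < n" "d < n" for a b c d x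
    proof
      fix k show "ten a b (ten c d x) k = (ten c d (ten a b x) + (if b = c then ten a d x else 0) - (if d = a then ten c b x else 0)) k"
        unfolding ten_def using e_comm[OF that, of "x k"] by (auto simp: e_add)
    qed
  qed (auto simp: ten_def pointwise_def fun_eq_iff e_add e_scale scale_right_distrib)
qed

interpretation ten: gl_module "pointwise scale" n ten by (rule ten_gl_module)

lemma cas_add: "cas (F + G) = cas F + cas G"
  and cas_pointwise: "cas (pointwise scale c F) = pointwise scale c (cas F)"
  by (auto simp: cas_def fun_eq_iff e_add sum.distrib pointwise_def e_scale scale_sum_right)

lemma cas_ten:
  assumes "a < n" "b < n" shows "cas (ten a b F) = ten a b (cas F)"
proof
  fix k show "cas (ten a b F) k = ten a b (cas F) k"
  proof (cases "k < n")
    case True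
    have "(\<Sum>d<n. e d k (e a b (F d))) = (\<Sum>d<n. e a b (e d k (F d)) + (if k = a then e d b (F d) else 0)
         - (if b = d then e a k (F d) else 0))"
      by (rule sum.cong) (use assms True in \<open>auto simp: e_comm[of _ k a b]\<close>)
    also have "\<dots> = (\<Sum>d<n. e a b (e d k (F d))) + (if k = a then \<Sum>d<n. e d b (F d) else 0) - e a k (F b)"
      using assms by (simp add: sum_subtractf sum.distrib)
    finally show ?thesis using assms True
      by (simp add: cas_def ten_def e_add sum.distrib e_sum if_distrib[of "e _ _"] sum.delta' cong: if_cong)
  qed (use assms in \<open>auto simp: cas_def ten_def\<close>)
qed

lemma cas_shift_ten:
  assumes "a < n" "b < n" shows "ten a b (cas_shift x F) = cas_shift x (ten a b F)"
  using assms by (simp add: cas_shift_def cas_ten ten.e_diff ten.e_scale)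

lemma cas_shift_commute: "cas_shift x (cas_shift y F) = cas_shift y (cas_shift x F)"
proof -
  have diff: "cas (F - G) = cas F - cas G" for F G
    using cas_add[of "F - G" G] by (simp add: algebra_simps)
  show ?thesis
    by (simp add: cas_shift_def diff cas_pointwise ten.scale_right_diff_distrib algebra_simps mult.commute)
qed

lemma cas_shift_scale: "cas_shift x (pointwise scale c F) = pointwise scale c (cas_shift x F)"
  by (simp add: cas_shift_def cas_pointwise ten.scale_right_diff_distrib mult.commute)

lemma cas_shift_0 [simp]: "cas_shift x 0 = 0"
  by (simp add: cas_shift_def cas_def fun_eq_iff pointwise_def)

lemma cas_shift_add: "cas_shift x (F + G) = cas_shift x F + cas_shift x G"
  by (simp add: cas_shift_def cas_add ten.scale_right_distrib)

lemma foldr_cas_shift_0 [simp]: "foldr cas_shift xs 0 = 0"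
  by (induction xs) (auto simp del: zero_fun_apply)

lemma foldr_cas_shift_sum:
  "foldr cas_shift xs (\<Sum>i\<in>I. f i) = (\<Sum>i\<in>I. foldr cas_shift xs (f i))"
proof -
  have "foldr cas_shift xs (F + G) = foldr cas_shift xs F + foldr cas_shift xs G" for F G
    by (induction xs) (auto simp: cas_shift_add simp del: plus_fun_apply)
  then show ?thesis by (induction I rule: infinite_finite_induct) auto
qed

lemma foldr_cas_shift_ten:
  assumes "a < n" "b < n" shows "foldr cas_shift xs (ten a b F) = ten a b (foldr cas_shift xs F)"
  by (induction xs) (auto simp: cas_shift_ten assms)

lemma shifted_append_commute: "shifted v (us @ vs) i = shifted v (vs @ us) i"
  unfolding shifted_def by (rule foldr_append_commute) (rule cas_shift_commute)

context
  fixes m v w assumes hwv: "hw m v" and w_def: "w = (\<lambda>i. m i - of_nat i)"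
begin

lemma ten_pure:
  assumes "a < b" "b < n" shows "ten a b (pure v i) = (if i = b then pure v a else 0)"
  using assms hwv by (auto simp: fun_eq_iff ten_def pure_def hw_def)

lemma ten_pure_diag:
  assumes "a < n" "i < n"
  shows "ten a a (pure v i) = pointwise scale ((m(i := m i + 1)) a) (pure v i)"
  using assms hwv by (auto simp: fun_eq_iff ten_def pure_def hw_def pointwise_def scale_left_distrib)

text \<open>E applied to the tensor of v and e_i has the terms \<open>e i b v\<close> in position b
  < i and \<open>m i\<close> times v in position i. In the sum on the right each of the i summands
  contributes one copy of v in position i; this is the shift from \<open>m i\<close> to
  \<open>w i\<close>.\<close>

lemma cas_shift_pure:
  assumes "i < n" shows "cas_shift (w i) (pure v i) = (\<Sum>j<i. ten i j (pure v j))"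
proof
  fix b
  have R: "(\<Sum>j<i. ten i j (pure v j) b) = (if b < i then e i b v else 0) + (if b = i then scale (of_nat i) v else 0)"
  proof -
    have "(\<Sum>j<i. ten i j (pure v j) b) = (\<Sum>j<i. (if j = b then e i j v else 0) + (if b = i then v else 0))"
      by (rule sum.cong) (auto simp: ten_def pure_def)
    also have "\<dots> = (if b < i then e i b v else 0) + (if b = i then scale (of_nat i) v else 0)"
      by (simp add: sum.distrib sum_constant_scale)
    finally show ?thesis .
  qed
  have "cas (pure v i) b = (if b < n then e i b v else 0)"
    using assms by (simp add: cas_def pure_def if_distrib[of "e _ _"] cong: if_cong)
  also have "\<dots> = (if b < i then e i b v else 0) + (if b = i then scale (m i) v else 0)"
    using hwv assms by (auto simp: hw_def)
  finally show "cas_shift (w i) (pure v i) b = (\<Sum>j<i. ten i j (pure v j)) b"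
    unfolding sum_fun_apply R
    by (auto simp: cas_shift_def pointwise_def w_def pure_def scale_left_diff_distrib)
qed

text \<open>By \<open>cas_shift_pure\<close> the factor for \<open>w j\<close> pushes the tensor of
  v and e_j into the submodule generated by those with l < j, which the remaining factors kill by
  induction. The further factors \<open>us\<close> enter the induction because the factors in use
  get permuted.\<close>

lemma shifted_kill:
  assumes "j < i" "i < n" shows "shifted v (map w [0..<i]) j = 0"
proof -
  have *: "shifted v (us @ map w [0..<Suc j]) j = 0" if "j < n" for us j
    using that
  proof (induction j arbitrary: us rule: less_induct)
    case (less j)
    have "shifted v (us @ map w [0..<Suc j]) j = foldr cas_shift (us @ map w [0..<j]) (cas_shift (w j) (pure v j))"
      by (simp add: shifted_def)
    also have "\<dots> = (\<Sum>l<j. ten j l (shifted v (us @ map w [0..<j]) l))"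
      using less.prems by (simp add: cas_shift_pure foldr_cas_shift_sum foldr_cas_shift_ten shifted_def del: foldr_append)
    also have "\<dots> = 0"
    proof (rule sum.neutral, rule ballI)
      fix l assume "l \<in> {..<j}"
      then have l: "l < j" by simp
      then have "[0..<j] = [0..<Suc l] @ [Suc l..<j]"
        by (metis Suc_leI le0 upt_add_eq_append le_add_diff_inverse)
      then have "shifted v (us @ map w [0..<j]) l = shifted v ((us @ map w [0..<Suc l]) @ map w [Suc l..<j]) l"
        by simp
      also have "\<dots> = shifted v ((map w [Suc l..<j] @ us) @ map w [0..<Suc l]) l"
        by (subst shifted_append_commute) simp
      also have "\<dots> = 0" using less.IH[OF l, of "map w [Suc l..<j] @ us"] l less.prems by (simp del: zero_fun_apply)
      finally show "ten j l (shifted v (us @ map w [0..<j]) l) = 0" by simp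
    qed
    finally show ?case .
  qed
  have "[0..<i] = [0..<Suc j] @ [Suc j..<i]"
    using assms by (metis Suc_leI le0 upt_add_eq_append le_add_diff_inverse)
  then have "shifted v (map w [0..<i]) j = shifted v (map w [Suc j..<i] @ map w [0..<Suc j]) j"
    using shifted_append_commute by (metis map_append)
  then show ?thesis using *[of j] assms by simp
qed

lemma shifted_ten:
  assumes "a < b" "b < n" shows "ten a b (shifted v xs i) = (if i = b then shifted v xs a else 0)"
  using assms by (simp add: shifted_def foldr_cas_shift_ten[symmetric] ten_pure)

lemma shifted_fil: "(\<forall>c. shifted v xs i c \<in> fil (length xs) v) \<and> (\<forall>c\<ge>n. i < n \<longrightarrow> shifted v xs i c = 0)"
proof (induction xs)
  case Nil
  then show ?case using subspace_0[OF subspace_fil] by (auto simp: pure_def)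
next
  case (Cons x xs)
  have "cas_shift x (shifted v xs i) c \<in> fil (Suc (length xs)) v" for c
    unfolding cas_shift_def cas_def pointwise_def
    using Cons fil_mono[of "length xs" "Suc (length xs)" v]
    by (auto intro!: subspace_diff[OF subspace_fil] subspace_neg[OF subspace_fil] subspace_sum[OF subspace_fil] e_fil
        subspace_scale[OF subspace_fil] subspace_0[OF subspace_fil])
  then show ?case using Cons by (auto simp: cas_shift_def cas_def pointwise_def)
qed

text \<open>Component i of E F is the sum of \<open>e a i (F a)\<close> over a. For a > i these lie
  in \<open>low v\<close>. For a = i the weight \<open>m i\<close> appears. For a < i the value is
  read off from the action of the raising operator \<open>ten a i\<close>, which turns the vector
  for i into the one for a. This is the recursion of \<open>tcoeff\<close>.\<close>

lemma shifted_coeff: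
  assumes "i < n" shows "shifted v xs i i - scale (tcoeff w i (w i) xs) v \<in> low v"
  using assms
proof (induction xs arbitrary: i)
  case Nil
  then show ?case using subspace_0[OF subspace_low] by (simp add: pure_def)
next
  case (Cons x xs)
  let ?F = "shifted v xs i" and ?K = "\<lambda>a. tcoeff w a (w a) xs"
  have F_cyc: "?F c \<in> cyc v" for c using shifted_fil[of xs i] fil_subset_cyc by blast
  define r where "r a = shifted v xs a a - scale (?K a) v" for a
  have r: "r a \<in> low v" if "a < n" for a using Cons.IH[OF that] by (simp add: r_def)
  have F: "shifted v xs a a = scale (?K a) v + r a" for a by (simp add: r_def)
  have below: "e a i (?F a) = scale (?K a - ?K i) v + (r a - r i)" if "a < i" for a
  proof -
    have "ten a i ?F a = shifted v xs a a"
      using shifted_ten[of a i xs i] that Cons.prems by simp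
    then have "e a i (?F a) = shifted v xs a a - ?F i" by (simp add: ten_def algebra_simps)
    then show ?thesis by (simp add: F scale_left_diff_distrib algebra_simps)
  qed
  have diag: "e i i (?F i) = scale (m i * ?K i) v + e i i (r i)"
    using hwv Cons.prems by (simp add: F e_add e_scale hw_def mult.commute)
  have split: "(\<Sum>a<n. e a i (?F a)) = (\<Sum>a<i. e a i (?F a)) + e i i (?F i) + (\<Sum>a\<in>{i<..<n}. e a i (?F a))"
  proof -
    have "sum f {..<n} = sum f {..<i} + f i + sum f {i<..<n}" for f :: "nat \<Rightarrow> 'v"
      using sum.atLeastLessThan_concat[of 0 i n f] sum.atLeast_Suc_lessThan[of i n f] Cons.prems
      by (simp add: lessThan_atLeast0 atLeastSucLessThan_greaterThanLessThan add.assoc)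
    then show ?thesis .
  qed
  define A B where "A = (\<Sum>a<i. ?K a - ?K i)" and "B = m i * ?K i"
  have coeff: "tcoeff w i (w i) (x # xs) = A + B - x * ?K i"
    by (simp add: A_def B_def sum_subtractf w_def algebra_simps)
  have sum_below: "(\<Sum>a<i. e a i (?F a)) = scale A v + (\<Sum>a<i. r a - r i)"
    unfolding A_def scale_sum_left sum.distrib[symmetric] using below by (intro sum.cong) auto
  have "shifted v (x # xs) i i = (\<Sum>a<n. e a i (?F a)) - scale x (?F i)"
    using Cons.prems by (simp add: cas_shift_def cas_def pointwise_def)
  then have "shifted v (x # xs) i i - scale (tcoeff w i (w i) (x # xs)) v =
      (\<Sum>a<i. r a - r i) + e i i (r i) + (\<Sum>a\<in>{i<..<n}. e a i (?F a)) - scale x (r i)"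
    unfolding split sum_below diag coeff B_def[symmetric]
    by (simp add: F[of i] scale_left_diff_distrib scale_left_distrib scale_right_distrib algebra_simps)
  also have "\<dots> \<in> low v"
    using r Cons.prems F_cyc
    by (intro subspace_diff[OF subspace_low] subspace_add[OF subspace_low] subspace_sum[OF subspace_low]
        subspace_scale[OF subspace_low] e_diag_low[OF hwv] e_lower_cyc[OF hwv]) auto
  finally show ?case .
qed

text \<open>Raising operators either annihilate the vector or turn it into its analogue for some a <
  i, which is zero by \<open>shifted_kill\<close>. It is nonzero because, modulo
  \<open>low v\<close>, its component i is the product from \<open>tcoeff_prod\<close> times
  v.\<close>

lemma ten_hw:
  assumes "i < n" "\<And>j. j < i \<Longrightarrow> w i + 1 \<noteq> w j"
  shows "ten.hw (m(i := m i + 1)) (shifted v (map w [0..<i]) i)" (is "ten.hw _ ?u")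
  unfolding ten.hw_def
proof (intro conjI allI impI)
  have "tcoeff w i (w i) (map w [0..<i]) = (\<Prod>j<i. w i - w j + 1)"
    using tcoeff_prod[of w i "w i" "[]"] by simp
  moreover have "\<dots> \<noteq> 0" using assms(2) by (auto simp: algebra_simps)
  ultimately have K: "tcoeff w i (w i) (map w [0..<i]) \<noteq> 0" (is "?k \<noteq> 0") by simp
  show "?u \<noteq> 0"
  proof
    assume "?u = 0"
    then have "- scale ?k v \<in> low v" using shifted_coeff[OF assms(1), of "map w [0..<i]"] by simp
    then have "scale (- inverse ?k) (- scale ?k v) \<in> low v" by (rule subspace_scale[OF subspace_low])
    then show False using K hw_notin_low[OF hwv] by simp
  qed
next
  fix a b assume ab: "a < b \<and> b < n"
  then show "ten a b ?u = 0" using shifted_kill[of a i] assms(1) by (auto simp: shifted_ten)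
next
  fix a assume "a < n"
  have "foldr cas_shift xs (pointwise scale c F) = pointwise scale c (foldr cas_shift xs F)" for xs c F
    by (induction xs) (auto simp: cas_shift_scale)
  with \<open>a < n\<close> show "ten a a ?u = pointwise scale ((m(i := m i + 1)) a) ?u"
    using assms(1) unfolding shifted_def foldr_cas_shift_ten[OF \<open>a < n\<close> \<open>a < n\<close>, symmetric] by (simp add: ten_pure_diag del: fun_upd_apply)
qed

text \<open>The vector is made with i Casimir factors and so has components in
  \<open>fil i v\<close>; every further letter raises the filtration degree by at most one.
  Components beyond \<open>n\<close> vanish, which leaves n copies.\<close>

lemma dim_ten_fil:
  assumes "i < n" "i \<le> l"
  shows "ten.dim (ten.fil k (shifted v (map w [0..<i]) i)) \<le> n * dim (fil (k + l) v)" (is "ten.dim (ten.fil k ?u) \<le> _")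
proof -
  have u: "?u c \<in> fil i v" "c \<ge> n \<Longrightarrow> ?u c = 0" for c
    using shifted_fil[of "map w [0..<i]" i] assms by auto
  have word: "(\<forall>c. word_act ten ws ?u c \<in> fil (length ws + i) v) \<and> (\<forall>c\<ge>n. word_act ten ws ?u c = 0)"
    if "ws \<in> words n" for ws using that
  proof (induction ws)
    case (Cons l ws)
    obtain a b where l: "l = (a, b)" by fastforce
    have "ten a b F c \<in> fil (Suc k) v" if "\<forall>c. F c \<in> fil k v" "a < n" "b < n" for F k c
      using that fil_mono[of k "Suc k" v] unfolding ten_def
      by (auto intro!: subspace_add[OF subspace_fil] e_fil)
    then show ?case using Cons by (auto simp: l) (auto simp: ten_def)
  qed (use u in auto)
  obtain B where B: "B \<subseteq> fil (k + l) v" "independent B" "fil (k + l) v \<subseteq> span B" "card B = dim (fil (k + l) v)"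
    using basis_exists by blast
  have finB: "finite B"
    using independent_span_bound[OF _ B(2), of "(\<lambda>w. word_act e w v) ` words_upto n (k + l)"] B(1)
    by (simp add: fil_def)
  let ?G = "(\<lambda>(c, b). pure b c) ` ({..<n} \<times> B)"
  have in_span: "F \<in> ten.span ?G" if F: "\<forall>c. F c \<in> fil (k + l) v" "\<forall>c\<ge>n. F c = 0" for F
  proof -
    have "F = (\<Sum>c<n. pure (F c) c)"
    proof
      fix d have "(\<Sum>c<n. pure (F c) c) d = (\<Sum>c<n. pure (F c) c d)" by (rule sum_fun_apply)
      also have "\<dots> = F d" using F(2) by (auto simp: pure_def)
      finally show "F d = (\<Sum>c<n. pure (F c) c) d" ..
    qed
    moreover have "pure x c \<in> ten.span ?G" if "c < n" "x \<in> span B" for c x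
      by (rule span_linear_into[where f = "\<lambda>x. pure x c", OF vector_space_scale ten.vector_space_scale ten.subspace_span _ _ _ that(2)])
         (use that(1) in \<open>auto simp: pure_def fun_eq_iff pointwise_def intro!: ten.span_base\<close>)
    then have "pure (F c) c \<in> ten.span ?G" if "c < n" for c
      using F(1) B(3) that by blast
    then have "(\<Sum>c<n. pure (F c) c) \<in> ten.span ?G" by (intro ten.span_sum) auto
    ultimately show ?thesis by simp
  qed
  have "ten.fil k ?u \<subseteq> ten.span ?G" unfolding ten.fil_def
  proof (rule ten.span_minimal)
    show "(\<lambda>ws. word_act ten ws ?u) ` words_upto n k \<subseteq> ten.span ?G"
    proof (rule image_subsetI)
      fix ws assume ws: "ws \<in> words_upto n k"
      then have "length ws + i \<le> k + l" using assms by (auto simp: words_upto_def)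
      then show "word_act ten ws ?u \<in> ten.span ?G"
        using word[of ws] ws fil_mono[of "length ws + i" "k + l" v] by (intro in_span) (auto simp: words_upto_def)
    qed
  qed simp
  then have "ten.dim (ten.fil k ?u) \<le> card ?G" using finB by (intro ten.dim_le_card) auto
  also have "\<dots> \<le> card ({..<n} \<times> B)" using finB by (intro card_image_le) auto
  finally show ?thesis using B(4) by (simp add: card_cartesian_product)
qed

end
end

subsection \<open>Moving the highest weight\<close>

abbreviation wscale :: "complex \<Rightarrow> ((nat \<times> nat) list \<Rightarrow> complex) \<Rightarrow> (nat \<times> nat) list \<Rightarrow> complex" where
  "wscale \<equiv> pointwise (*)"

text \<open>Up to an additive constant, \<open>w\<close> are the coordinates of the highest weight shifted by \<open>\<rho>\<close>.\<close>

definition growth_at_most :: "nat \<Rightarrow> (nat \<Rightarrow> complex) \<Rightarrow> (nat \<Rightarrow> nat) \<Rightarrow> bool" where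
  "growth_at_most n w g \<longleftrightarrow> (\<exists>e v. gl_module wscale n e \<and>
     gl_module.hw wscale n e (\<lambda>i. w i + of_nat i) v \<and>
     (\<forall>k. fil_dim wscale n e v k \<le> g k))"

lemma growth_at_mostI:
  assumes "gl_module s n e" "gl_module.hw s n e (\<lambda>i. w i + of_nat i) v"
    and "\<And>k. fil_dim s n e v k \<le> g k"
  shows "growth_at_most n w g"
proof -
  obtain e' v' where "gl_module wscale n e'" "gl_module.hw wscale n e' (\<lambda>i. w i + of_nat i) v'"
    "\<And>k. fil_dim wscale n e' v' k \<le> fil_dim s n e v k"
    using hw_module_on_words[OF assms(1,2)] by blast
  then show ?thesis unfolding growth_at_most_def using assms(3) order_trans by blast
qed

lemma hw_cong:
  assumes "gl_module s n e" "\<And>i. i < n \<Longrightarrow> m i = m' i"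
  shows "gl_module.hw s n e m v \<longleftrightarrow> gl_module.hw s n e m' v"
  using assms(2) unfolding gl_module.hw_def[OF assms(1)] by auto

lemma growth_at_most_simple:
  assumes "growth_at_most n w g" "gl_module s n e" "gl_module.hw s n e (\<lambda>i. w i + of_nat i) v"
    and "gl_module.simple_at s n e v"
  shows "fil_dim s n e v k \<le> g k"
  using assms dim_fil_simple_le[OF _ assms(2) _ assms(3,4)] order_trans
  unfolding growth_at_most_def by blast

text \<open>The shift of k by n bounds the number i of Casimir factors uniformly.\<close>

lemma growth_at_most_step:
  assumes "growth_at_most n w g" "i < n" "\<And>j. j < i \<Longrightarrow> w i + 1 \<noteq> w j"
  shows "growth_at_most n (w(i := w i + 1)) (\<lambda>k. n * g (k + n))"
proof -
  obtain e v where e: "gl_module wscale n e" "gl_module.hw wscale n e (\<lambda>i. w i + of_nat i) v"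
    "\<And>k. fil_dim wscale n e v k \<le> g k"
    using assms(1) unfolding growth_at_most_def by blast
  interpret gl_module wscale n e by fact
  let ?u = "shifted v (map (\<lambda>i. w i + of_nat i - of_nat i) [0..<i]) i"
  let ?m = "\<lambda>i. w i + of_nat i"
  have m: "?m(i := ?m i + 1) = (\<lambda>j. (w(i := w i + 1)) j + of_nat j)" by auto
  show ?thesis
  proof (rule growth_at_mostI[OF ten_gl_module])
    show "gl_module.hw (pointwise wscale) n ten (\<lambda>j. (w(i := w i + 1)) j + of_nat j) ?u"
      using ten_hw[OF e(2) refl assms(2)] assms(3) unfolding m by simp
    show "vector_space.dim (pointwise wscale) (gl_module.fil (pointwise wscale) n ten k ?u) \<le> n * g (k + n)" for k
    proof -
      have "vector_space.dim (pointwise wscale) (gl_module.fil (pointwise wscale) n ten k ?u) \<le> n * dim (fil (k + n) v)"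
        using dim_ten_fil[OF e(2) refl assms(2), of n k] assms(2) by simp
      also have "\<dots> \<le> n * g (k + n)" using e(3) by simp
      finally show ?thesis .
    qed
  qed
qed

lemma growth_at_most_cong:
  assumes "growth_at_most n w g" "\<And>i. i < n \<Longrightarrow> w i = w' i" "\<And>k. g k = g' k"
  shows "growth_at_most n w' g'"
proof -
  obtain e v where e: "gl_module wscale n e" "gl_module.hw wscale n e (\<lambda>i. w i + of_nat i) v"
    "\<And>k. fil_dim wscale n e v k \<le> g k"
    using assms(1) unfolding growth_at_most_def by blast
  then show ?thesis
    unfolding growth_at_most_def
    using hw_cong[OF e(1), of "\<lambda>i. w i + of_nat i" "\<lambda>i. w' i + of_nat i" v] assms(2,3) by auto
qed

lemma growth_at_most_raise:
  assumes "growth_at_most n w g" "i < n" "\<And>j t. \<lbrakk>j < i; 1 \<le> t; t \<le> r\<rbrakk> \<Longrightarrow> w i + of_nat t \<noteq> w j"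
  shows "growth_at_most n (w(i := w i + of_nat r)) (\<lambda>k. n ^ r * g (k + r * n))"
  using assms(3)
proof (induction r)
  case 0
  then show ?case using assms(1) by simp
next
  case (Suc r)
  have "growth_at_most n (w(i := w i + of_nat r)) (\<lambda>k. n ^ r * g (k + r * n))"
    by (rule Suc.IH) (use Suc.prems in auto)
  then have "growth_at_most n ((w(i := w i + of_nat r))(i := (w(i := w i + of_nat r)) i + 1))
      (\<lambda>k. n * (n ^ r * g (k + n + r * n)))"
    by (rule growth_at_most_step[OF _ assms(2)])
       (use Suc.prems[of _ "Suc r"] in \<open>auto simp: algebra_simps\<close>)
  then show ?case by (rule growth_at_most_cong) (auto simp: algebra_simps)
qed

text \<open>The coordinates are raised one after the other, starting with the first one.\<close>

lemma growth_at_most_reach: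
  fixes r :: "nat \<Rightarrow> nat"
  assumes "growth_at_most n w g"
    and "\<And>i. i < n \<Longrightarrow> w' i = w i + of_nat (r i)"
    and ok: "\<And>i j t. \<lbrakk>j < i; i < n; 1 \<le> t; t \<le> r i\<rbrakk> \<Longrightarrow> w i + of_nat t \<noteq> w' j"
  obtains C d where "C \<ge> 1" "growth_at_most n w' (\<lambda>k. C * g (k + d))"
proof -
  \<comment> \<open>When coordinate i starts to move, those in front of it are already at their
    targets; therefore \<open>ok\<close> compares with \<open>w' j\<close> and not with
    \<open>w j\<close>.\<close>
  have "\<exists>C d. C \<ge> 1 \<and> growth_at_most n (\<lambda>j. if j < i then w' j else w j) (\<lambda>k. C * g (k + d))"
    if "i \<le> n" for i using that
  proof (induction i)
    case 0
    have "growth_at_most n (\<lambda>j. if j < 0 then w' j else w j) (\<lambda>k. 1 * g (k + 0))"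
      by (rule growth_at_most_cong[OF assms(1)]) auto
    then show ?case by blast
  next
    case (Suc i)
    then obtain C d where IH: "C \<ge> 1" "growth_at_most n (\<lambda>j. if j < i then w' j else w j) (\<lambda>k. C * g (k + d))"
      by auto
    have "growth_at_most n ((\<lambda>j. if j < i then w' j else w j)(i := (if i < i then w' i else w i) + of_nat (r i)))
       (\<lambda>k. n ^ r i * (C * g (k + r i * n + d)))"
      by (rule growth_at_most_raise[OF IH(2)]) (use Suc.prems ok in auto)
    then have "growth_at_most n (\<lambda>j. if j < Suc i then w' j else w j) (\<lambda>k. (n ^ r i * C) * g (k + (r i * n + d)))"
      by (rule growth_at_most_cong) (use assms(2) Suc.prems in \<open>auto simp: less_Suc_eq algebra_simps\<close>)
    moreover have "n ^ r i * C \<ge> 1" using IH(1) Suc.prems by simp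
    ultimately show ?case by blast
  qed
  then obtain C d where C: "C \<ge> 1" "growth_at_most n (\<lambda>j. if j < n then w' j else w j) (\<lambda>k. C * g (k + d))"
    by blast
  have "growth_at_most n w' (\<lambda>k. C * g (k + d))"
    by (rule growth_at_most_cong[OF C(2)]) auto
  with C(1) show thesis by (rule that)
qed

text \<open>The one-dimensional module on which all E_aa act by \<kappa> and all other matrix units
  by 0.\<close>

lemma growth_at_most_trivial: "growth_at_most n (\<lambda>i. \<kappa> - of_nat i) (\<lambda>_. 1)"
proof -
  interpret C: vector_space "(*) :: complex \<Rightarrow> complex \<Rightarrow> complex" by (rule vector_space_complex_mult)
  interpret G: gl_module "(*) :: complex \<Rightarrow> complex \<Rightarrow> complex" n "\<lambda>a b x. if a = b then \<kappa> * x else 0"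
    by unfold_locales (auto simp: algebra_simps)
  show ?thesis
  proof (rule growth_at_mostI[OF G.gl_module_axioms, where v = 1])
    show "G.hw (\<lambda>i. \<kappa> - of_nat i + of_nat i) 1" by (auto simp: G.hw_def)
    show "vector_space_over_itself.dim (G.fil k 1) \<le> 1" for k
      using vector_space_over_itself.dim_le_card[of "G.fil k 1" "{1}"]
      by (auto simp: vector_space_over_itself.span_singleton)
  qed
qed

section \<open>Scalar highest weight modules\<close>

type_synonym expo = "nat \<times> nat \<Rightarrow> nat"

abbreviation pscale :: "complex \<Rightarrow> (expo \<Rightarrow> complex) \<Rightarrow> expo \<Rightarrow> complex" where
  "pscale \<equiv> pointwise (*)"

text \<open>Formal power series in the variables \<open>t\<^sub>x\<close>, given by their coefficients, with the operators
  \<open>\<partial>/\<partial>t\<^sub>x\<close> and multiplication by \<open>t\<^sub>x\<close>.\<close>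

definition dd :: "nat \<times> nat \<Rightarrow> (expo \<Rightarrow> complex) \<Rightarrow> expo \<Rightarrow> complex" where
  "dd x F = (\<lambda>\<alpha>. of_nat (Suc (\<alpha> x)) * F (\<alpha>(x := Suc (\<alpha> x))))"

definition tt :: "nat \<times> nat \<Rightarrow> (expo \<Rightarrow> complex) \<Rightarrow> expo \<Rightarrow> complex" where
  "tt x F = (\<lambda>\<alpha>. if \<alpha> x = 0 then 0 else F (\<alpha>(x := \<alpha> x - 1)))"

lemma tt_add: "tt x (F + G) = tt x F + tt x G" and tt_scale: "tt x (pscale c F) = pscale c (tt x F)"
  and dd_add: "dd x (F + G) = dd x F + dd x G" and dd_scale: "dd x (pscale c F) = pscale c (dd x F)"
  by (auto simp: tt_def dd_def fun_eq_iff pointwise_def algebra_simps)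

lemma tt_0 [simp]: "tt x 0 = 0" and dd_0 [simp]: "dd x 0 = 0"
  using tt_add[of x 0 0] dd_add[of x 0 0] by (simp_all del: zero_fun_apply plus_fun_apply)

lemma tt_diff: "tt x (F - G) = tt x F - tt x G" and dd_diff: "dd x (F - G) = dd x F - dd x G"
  using tt_add[of x "F - G" G] dd_add[of x "F - G" G] by (simp_all del: plus_fun_apply add: algebra_simps)

lemma tt_sum: "tt x (\<Sum>i\<in>I. f i) = (\<Sum>i\<in>I. tt x (f i))"
  by (induction I rule: infinite_finite_induct) (simp_all add: tt_add del: plus_fun_apply zero_fun_apply)

lemma dd_sum: "dd x (\<Sum>i\<in>I. f i) = (\<Sum>i\<in>I. dd x (f i))"
  by (induction I rule: infinite_finite_induct) (simp_all add: dd_add del: plus_fun_apply zero_fun_apply)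

lemma tt_commute: "tt x (tt y F) = tt y (tt x F)"
  by (cases "x = y") (auto simp: tt_def fun_eq_iff fun_upd_twist)

lemma dd_commute: "dd x (dd y F) = dd y (dd x F)"
  by (cases "x = y") (auto simp: dd_def fun_eq_iff fun_upd_twist)

lemma dd_tt: "dd x (tt y F) = tt y (dd x F) + (if x = y then F else 0)"
proof (cases "x = y")
  case True
  then show ?thesis
    by (auto simp: dd_def tt_def fun_eq_iff algebra_simps of_nat_diff)
next
  case False
  then show ?thesis by (auto simp: dd_def tt_def fun_eq_iff fun_upd_twist)
qed

text \<open>The Lie algebra acts on functions \<open>f (X) = det (A)\<^sup>s F (B A\<^sup>-\<^sup>1)\<close> of \<open>n \<times> p\<close> matrices \<open>X\<close> with upper
  block \<open>A\<close> and lower block \<open>B\<close> by \<open>E\<^sub>a\<^sub>b = \<Sum>\<^sub>k x\<^sub>a\<^sub>k \<partial>/\<partial>x\<^sub>b\<^sub>k\<close>; restricting to \<open>A = 1\<close>, the operators \<open>XX a k\<close> and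
  \<open>DD b k\<close> are what \<open>x\<^sub>a\<^sub>k\<close> and \<open>\<partial>/\<partial>x\<^sub>b\<^sub>k\<close> become.\<close>

locale scalar_module =
  fixes p q :: nat and s :: complex
begin

definition XX :: "nat \<Rightarrow> nat \<Rightarrow> (expo \<Rightarrow> complex) \<Rightarrow> expo \<Rightarrow> complex" where
  "XX a k F = (if a < p then if a = k then F else 0 else tt (a, k) F)"

text \<open>For b < p this is the derivative of
  \<open>det (A)\<^sup>s F (B A\<^sup>-\<^sup>1)\<close> at A = 1 in direction E_bk: the determinant
  contributes s if b = k, and the argument of F moves by -B E_bk.\<close>

definition DD :: "nat \<Rightarrow> nat \<Rightarrow> (expo \<Rightarrow> complex) \<Rightarrow> expo \<Rightarrow> complex" where
  "DD b k F = (if b < p then (if b = k then pscale s F else 0) - (\<Sum>j\<in>{p..<p+q}. tt (j, b) (dd (j, k) F))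
     else dd (b, k) F)"

definition EE :: "nat \<Rightarrow> nat \<Rightarrow> (expo \<Rightarrow> complex) \<Rightarrow> expo \<Rightarrow> complex" where
  "EE a b F = (\<Sum>k<p. XX a k (DD b k F))"

definition one :: "expo \<Rightarrow> complex" where
  "one \<alpha> = (if \<alpha> = (\<lambda>_. 0) then 1 else 0)"

interpretation F: vector_space pscale
  by (rule vector_space_pointwise[OF vector_space_complex_mult])

lemma XX_add: "XX a k (F + G) = XX a k F + XX a k G" and XX_scale: "XX a k (pscale c F) = pscale c (XX a k F)"
  by (auto simp: XX_def tt_add tt_scale simp del: plus_fun_apply zero_fun_apply)

lemma XX_0 [simp]: "XX a k 0 = 0"
  by (auto simp: XX_def)

lemma XX_diff: "XX a k (F - G) = XX a k F - XX a k G"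
  by (auto simp: XX_def tt_diff)

lemma XX_sum: "XX a k (\<Sum>i\<in>I. f i) = (\<Sum>i\<in>I. XX a k (f i))"
  by (induction I rule: infinite_finite_induct) (simp_all add: XX_add del: plus_fun_apply zero_fun_apply)

lemma XX_commute: "XX a k (XX b l F) = XX b l (XX a k F)"
  by (auto simp: XX_def tt_commute)

lemma DD_add: "DD b k (F + G) = DD b k F + DD b k G"
  by (auto simp: DD_def dd_add tt_add sum.distrib F.scale_right_distrib simp del: plus_fun_apply zero_fun_apply)

lemma DD_scale: "DD b k (pscale c F) = pscale c (DD b k F)"
  by (auto simp: DD_def dd_scale tt_scale F.scale_sum_right F.scale_right_diff_distrib mult.commute simp del: zero_fun_apply)

lemma DD_0 [simp]: "DD b k 0 = 0"
  by (simp add: DD_def del: zero_fun_apply)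

lemma DD_sum: "DD b k (\<Sum>i\<in>I. f i) = (\<Sum>i\<in>I. DD b k (f i))"
  by (induction I rule: infinite_finite_induct) (simp_all add: DD_add del: plus_fun_apply zero_fun_apply)

lemma EE_add: "EE a b (F + G) = EE a b F + EE a b G"
  by (simp add: EE_def DD_add XX_add sum.distrib del: plus_fun_apply)

lemma EE_scale: "EE a b (pscale c F) = pscale c (EE a b F)"
  by (simp add: EE_def DD_scale XX_scale F.scale_sum_right)

text \<open>The Weyl relation with a correction: the elimination of the derivatives with b < p uses
  the equivariance of f under GL(p), which multiplication by a coordinate does not preserve.\<close>

lemma DD_XX:
  assumes "b < p + q" "c < p + q" "k < p" "l < p"
  shows "DD b k (XX c l F) = XX c l (DD b k F) +
    (if k = l then (if b = c then F else 0) - (if b < p then XX c b F else 0) else 0)"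
proof -
  have *: "(\<Sum>j\<in>{p..<p+q}. tt (j, b) (dd (j, k) (tt (c, l) F))) =
      tt (c, l) (\<Sum>j\<in>{p..<p+q}. tt (j, b) (dd (j, k) F)) + (if k = l then tt (c, b) F else 0)" if "c \<ge> p"
  proof -
    have "(\<Sum>j\<in>{p..<p+q}. tt (j, b) (dd (j, k) (tt (c, l) F))) =
      (\<Sum>j\<in>{p..<p+q}. tt (c, l) (tt (j, b) (dd (j, k) F)) + (if j = c then if k = l then tt (c, b) F else 0 else 0))"
      by (rule sum.cong) (auto simp: dd_tt tt_add tt_commute[of _ "(c, l)"])
    then show ?thesis using that assms(2) by (simp add: sum.distrib tt_sum del: plus_fun_apply)
  qed
  show ?thesis
  proof (cases "c < p")
    case True
    then show ?thesis by (auto simp: XX_def)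
  next
    case False
    show ?thesis
    proof (cases "b < p")
      case True
      then show ?thesis using False * by (auto simp: XX_def DD_def tt_diff tt_scale)
    next
      case b: False
      then show ?thesis using False by (auto simp: XX_def DD_def dd_tt)
    qed
  qed
qed

lemma DD_DD:
  assumes "b < p + q" "d < p + q" "k < p" "l < p"
  shows "DD b k (DD d l F) = DD d l (DD b k F) + (if b = l then DD d k F else 0) - (if k = d then DD b l F else 0)"
proof -
  let ?J = "{p..<p+q}"
  \<comment> \<open>These are the operators of gl(p) acting on the columns; \<open>S_comm\<close> is
    their commutation relation. For b < p, \<open>DD b k\<close> is a scalar minus
    \<open>S b k\<close>.\<close>
  define S where "S b k F = (\<Sum>j\<in>?J. tt (j, b) (dd (j, k) F))" for b k F
  have S_dd: "dd (d, l) (S b k F) = S b k (dd (d, l) F) + (if b = l then dd (d, k) F else 0)"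
    if "d \<in> ?J" for b k d l F
  proof -
    have "dd (d, l) (S b k F) = (\<Sum>j\<in>?J. tt (j, b) (dd (j, k) (dd (d, l) F)) + (if d = j then if b = l then dd (d, k) F else 0 else 0))"
      unfolding S_def dd_sum by (rule sum.cong) (auto simp: dd_tt dd_commute[of "(d, l)"])
    then show ?thesis using that by (simp add: sum.distrib S_def del: plus_fun_apply)
  qed
  have S_S: "S b k (S d l F) = (\<Sum>i\<in>?J. \<Sum>j\<in>?J. tt (i, b) (tt (j, d) (dd (i, k) (dd (j, l) F)))) + (if k = d then S b l F else 0)"
    for b k d l F
  proof -
    have "S b k (S d l F) = (\<Sum>i\<in>?J. tt (i, b) (S d l (dd (i, k) F)) + tt (i, b) (if k = d then dd (i, l) F else 0))"
      unfolding S_def[of b k] by (rule sum.cong) (auto simp: S_dd tt_add)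
    also have "\<dots> = (\<Sum>i\<in>?J. tt (i, b) (S d l (dd (i, k) F))) + (if k = d then S b l F else 0)"
      by (simp add: sum.distrib S_def del: plus_fun_apply)
    also have "(\<Sum>i\<in>?J. tt (i, b) (S d l (dd (i, k) F))) = (\<Sum>i\<in>?J. \<Sum>j\<in>?J. tt (i, b) (tt (j, d) (dd (i, k) (dd (j, l) F))))"
      by (simp add: S_def tt_sum dd_commute)
    finally show ?thesis .
  qed
  have S_comm: "S b k (S d l F) = S d l (S b k F) + (if k = d then S b l F else 0) - (if b = l then S d k F else 0)"
    for b k d l F
  proof -
    have "(\<Sum>i\<in>?J. \<Sum>j\<in>?J. tt (i, b) (tt (j, d) (dd (i, k) (dd (j, l) F)))) =
        (\<Sum>i\<in>?J. \<Sum>j\<in>?J. tt (i, d) (tt (j, b) (dd (i, l) (dd (j, k) F))))"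
      by (subst sum.swap) (simp add: tt_commute dd_commute)
    then show ?thesis unfolding S_S[of b k d l F] S_S[of d l b k F] by (simp add: algebra_simps)
  qed
  have S_lin: "S b k (F - G) = S b k F - S b k G" "S b k (pscale c F) = pscale c (S b k F)" "S b k 0 = 0" for b k F G c
    by (simp_all add: S_def dd_diff tt_diff sum_subtractf dd_scale tt_scale F.scale_sum_right del: zero_fun_apply)
  have DD: "DD b k F = (if b < p then (if b = k then pscale s F else 0) - S b k F else dd (b, k) F)" for b k F
    by (simp add: DD_def S_def)
  consider "b < p" "d < p" | "b < p" "d \<ge> p" | "b \<ge> p" "d < p" | "b \<ge> p" "d \<ge> p" by linarith
  then show ?thesis
  proof cases
    case 1
    then show ?thesis
      using S_comm[of b k d l F] by (auto simp: DD S_lin F.scale_right_diff_distrib algebra_simps simp del: zero_fun_apply)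
  next
    case 2
    then have "d \<in> ?J" using assms by auto
    from S_dd[OF this, of l b k F] show ?thesis
      using 2 assms by (auto simp: DD dd_diff dd_scale algebra_simps simp del: zero_fun_apply)
  next
    case 3
    then have "b \<in> ?J" using assms by auto
    from S_dd[OF this, of k d l F] show ?thesis
      using 3 assms by (auto simp: DD dd_diff dd_scale algebra_simps simp del: zero_fun_apply)
  next
    case 4
    then show ?thesis using assms by (auto simp: DD dd_commute)
  qed
qed

definition XL :: "nat \<Rightarrow> nat \<Rightarrow> (expo \<Rightarrow> complex) \<Rightarrow> expo \<Rightarrow> complex" where
  "XL c b F = (if b < p then XX c b F else 0)"

text \<open>Normal ordering: all \<open>XX\<close> are moved to the left of all \<open>DD\<close>.
  The correction of \<open>DD_XX\<close> survives as the term with \<open>XL\<close>.\<close>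

lemma EE_EE:
  assumes "a < p + q" "b < p + q" "c < p + q" "d < p + q"
  shows "EE a b (EE c d F) = (\<Sum>k<p. \<Sum>l<p. XX a k (XX c l (DD b k (DD d l F)))) +
    (if b = c then EE a d F else 0) - XL c b (EE a d F)"
proof -
  have inner: "DD b k (EE c d F) = (\<Sum>l<p. XX c l (DD b k (DD d l F))) + ((if b = c then DD d k F else 0) - XL c b (DD d k F))"
    if "k < p" for k
  proof -
    have "DD b k (EE c d F) = (\<Sum>l<p. XX c l (DD b k (DD d l F)) + (if k = l then (if b = c then DD d k F else 0) - XL c b (DD d k F) else 0))"
      unfolding EE_def DD_sum
      by (rule sum.cong) (use assms that in \<open>auto simp: DD_XX XL_def\<close>)
    then show ?thesis using that by (simp add: sum.distrib del: plus_fun_apply)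
  qed
  have "EE a b (EE c d F) = (\<Sum>k<p. XX a k (DD b k (EE c d F)))"
    by (simp add: EE_def)
  also have "\<dots> = (\<Sum>k<p. (\<Sum>l<p. XX a k (XX c l (DD b k (DD d l F)))) +
     ((if b = c then XX a k (DD d k F) else 0) - XL c b (XX a k (DD d k F))))"
    by (rule sum.cong) (auto simp: inner XX_add XX_sum XX_diff XL_def XX_commute simp del: plus_fun_apply zero_fun_apply)
  also have "\<dots> = (\<Sum>k<p. \<Sum>l<p. XX a k (XX c l (DD b k (DD d l F)))) + ((if b = c then EE a d F else 0) - XL c b (EE a d F))"
    by (simp add: sum.distrib sum_subtractf EE_def XL_def XX_sum del: plus_fun_apply)
  finally show ?thesis by (simp add: algebra_simps)
qed

text \<open>Exchanging the two \<open>DD\<close> in the normally ordered term produces two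
  \<open>XL\<close> terms, and these cancel the ones from \<open>EE_EE\<close> in the
  commutator.\<close>

lemma EE_gl_module: "gl_module pscale (p + q) EE"
proof unfold_locales
  fix a b c d F assume abcd: "a < p + q" "b < p + q" "c < p + q" "d < p + q"
  have "(\<Sum>k<p. \<Sum>l<p. XX a k (XX c l (DD b k (DD d l F)))) =
     (\<Sum>k<p. \<Sum>l<p. XX a k (XX c l (DD d l (DD b k F))) + (if l = b then XX a k (XX c l (DD d k F)) else 0)
        - (if k = d then XX a k (XX c l (DD b l F)) else 0))"
    by (intro sum.cong refl, subst DD_DD)
       (use abcd in \<open>auto simp: XX_add XX_diff simp del: plus_fun_apply zero_fun_apply\<close>)
  also have "\<dots> = (\<Sum>k<p. \<Sum>l<p. XX a k (XX c l (DD d l (DD b k F))))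
      + (\<Sum>k<p. \<Sum>l<p. if l = b then XX a k (XX c l (DD d k F)) else 0)
      - (\<Sum>k<p. \<Sum>l<p. if k = d then XX a k (XX c l (DD b l F)) else 0)"
    by (simp add: sum.distrib sum_subtractf del: plus_fun_apply)
  also have "(\<Sum>k<p. \<Sum>l<p. if l = b then XX a k (XX c l (DD d k F)) else 0) = XL c b (EE a d F)"
    by (auto simp: XL_def EE_def XX_sum XX_commute[of _ _ c b])
  also have "(\<Sum>k<p. \<Sum>l<p. if k = d then XX a k (XX c l (DD b l F)) else 0) = XL a d (EE c b F)"
    by (subst sum.swap) (auto simp: XL_def EE_def XX_sum)
  also have "(\<Sum>k<p. \<Sum>l<p. XX a k (XX c l (DD d l (DD b k F)))) = (\<Sum>l<p. \<Sum>k<p. XX c l (XX a k (DD d l (DD b k F))))"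
    by (subst sum.swap) (simp add: XX_commute)
  finally show "EE a b (EE c d F) = EE c d (EE a b F) + (if b = c then EE a d F else 0) - (if d = a then EE c b F else 0)"
    unfolding EE_EE[OF abcd] EE_EE[OF abcd(3,4,1,2)] by (simp add: algebra_simps del: plus_fun_apply minus_apply zero_fun_apply)
qed (simp_all only: EE_add EE_scale)

sublocale gl_module pscale "p + q" EE by (rule EE_gl_module)

lemma dd_one [simp]: "dd x one = 0"
proof
  fix \<alpha> :: expo
  have "\<alpha>(x := Suc (\<alpha> x)) \<noteq> (\<lambda>_. 0)" by (metis fun_upd_same nat.simps(3))
  then show "dd x one \<alpha> = 0 \<alpha>" by (simp add: dd_def one_def)
qed

lemma hw_one: "hw (\<lambda>i. if i < p then s else 0) one"
proof -
  have DD_one: "DD b k one = (if b < p \<and> b = k then pscale s one else 0)" for b k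
    by (auto simp: DD_def simp del: zero_fun_apply)
  have EE_one: "EE a b one = (if a = b \<and> b < p then pscale s one else 0)" if "a \<le> b" for a b
  proof -
    have "EE a b one = (\<Sum>k<p. if k = b then if a = b then pscale s one else 0 else 0)"
      unfolding EE_def DD_one using that by (intro sum.cong) (auto simp: XX_def simp del: zero_fun_apply)
    then show ?thesis by (auto simp del: zero_fun_apply)
  qed
  have "one \<noteq> 0" by (metis one_def zero_fun_apply zero_neq_one)
  then show ?thesis by (auto simp: hw_def EE_one simp del: zero_fun_apply)
qed

end

section \<open>Polynomials, their degree, and simplicity of the module generated by 1\<close>

context scalar_module
begin

definition vars :: "(nat \<times> nat) set" where "vars = {p..<p+q} \<times> {..<p}"

definition deg :: "expo \<Rightarrow> nat" where "deg \<alpha> = (\<Sum>x\<in>vars. \<alpha> x)"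

text \<open>Exponents live on all pairs of naturals; this confines them to the p q actual
  variables.\<close>

definition expos :: "expo set" where "expos = {\<alpha>. \<forall>x. x \<notin> vars \<longrightarrow> \<alpha> x = 0}"

definition polys :: "nat \<Rightarrow> (expo \<Rightarrow> complex) set" where
  "polys k = {F. \<forall>\<alpha>. F \<alpha> \<noteq> 0 \<longrightarrow> \<alpha> \<in> expos \<and> deg \<alpha> \<le> k}"

definition homog :: "nat \<Rightarrow> (expo \<Rightarrow> complex) set" where
  "homog k = {F. \<forall>\<alpha>. F \<alpha> \<noteq> 0 \<longrightarrow> \<alpha> \<in> expos \<and> deg \<alpha> = k}"

lemma finite_vars [simp]: "finite vars" and card_vars: "card vars = p * q"
  by (simp_all add: vars_def card_cartesian_product)

lemma deg_upd: "x \<in> vars \<Longrightarrow> deg (\<alpha>(x := c)) + \<alpha> x = deg \<alpha> + c"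
proof -
  assume x: "x \<in> vars"
  have "sum (\<alpha>(x := c)) (vars - {x}) = sum \<alpha> (vars - {x})" by (rule sum.cong) auto
  then show ?thesis
    unfolding deg_def sum.remove[OF finite_vars x, of \<alpha>] sum.remove[OF finite_vars x, of "\<alpha>(x := c)"]
    by simp
qed

lemma deg_Suc: "x \<in> vars \<Longrightarrow> deg (\<alpha>(x := Suc (\<alpha> x))) = Suc (deg \<alpha>)"
  using deg_upd[of x \<alpha> "Suc (\<alpha> x)"] by simp

lemma deg_pred: "x \<in> vars \<Longrightarrow> \<alpha> x \<noteq> 0 \<Longrightarrow> Suc (deg (\<alpha>(x := \<alpha> x - 1))) = deg \<alpha>"
  using deg_upd[of x \<alpha> "\<alpha> x - 1"] by simp

lemma expos_upd [simp]: "x \<in> vars \<Longrightarrow> \<alpha>(x := c) \<in> expos \<longleftrightarrow> \<alpha> \<in> expos"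
  by (auto simp: expos_def)

lemma expos_zero: "\<alpha> \<in> expos \<Longrightarrow> x \<notin> vars \<Longrightarrow> \<alpha> x = 0"
  unfolding expos_def by blast

lemma deg_le: "x \<in> vars \<Longrightarrow> \<alpha> x \<le> deg \<alpha>"
  unfolding deg_def by (rule member_le_sum) auto

lemma deg_eq_0: "\<alpha> \<in> expos \<Longrightarrow> deg \<alpha> = 0 \<longleftrightarrow> \<alpha> = (\<lambda>_. 0)"
proof -
  assume *: "\<alpha> \<in> expos"
  have "\<alpha> x = 0" if "deg \<alpha> = 0" for x
    using that * deg_le[of x \<alpha>] by (cases "x \<in> vars") (auto simp: expos_zero)
  then show ?thesis by (auto simp: deg_def)
qed

lemma subspace_polys: "subspace (polys k)"
proof (rule subspaceI)
  fix F G assume FG: "F \<in> polys k" "G \<in> polys k"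
  have "F \<alpha> \<noteq> 0 \<or> G \<alpha> \<noteq> 0" if "(F + G) \<alpha> \<noteq> 0" for \<alpha> using that by auto
  with FG show "F + G \<in> polys k" unfolding polys_def by blast
qed (auto simp: polys_def pointwise_def)

lemma subspace_homog: "subspace (homog k)"
proof (rule subspaceI)
  fix F G assume FG: "F \<in> homog k" "G \<in> homog k"
  have "F \<alpha> \<noteq> 0 \<or> G \<alpha> \<noteq> 0" if "(F + G) \<alpha> \<noteq> 0" for \<alpha> using that by auto
  with FG show "F + G \<in> homog k" unfolding homog_def by blast
qed (auto simp: homog_def pointwise_def)

lemma tt_support:
  assumes "x \<in> vars" "tt x F \<alpha> \<noteq> 0"
  obtains \<beta> where "F \<beta> \<noteq> 0" "deg \<alpha> = Suc (deg \<beta>)" "\<beta> \<in> expos \<longleftrightarrow> \<alpha> \<in> expos"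
  using that[of "\<alpha>(x := \<alpha> x - 1)"] assms deg_pred[of x \<alpha>] by (auto simp: tt_def split: if_splits)

lemma dd_support:
  assumes "x \<in> vars" "dd x F \<alpha> \<noteq> 0"
  obtains \<beta> where "F \<beta> \<noteq> 0" "deg \<beta> = Suc (deg \<alpha>)" "\<beta> \<in> expos \<longleftrightarrow> \<alpha> \<in> expos"
  using that[of "\<alpha>(x := Suc (\<alpha> x))"] assms deg_Suc[of x \<alpha>] by (auto simp: dd_def)

lemma tt_polys: assumes "x \<in> vars" "F \<in> polys k" shows "tt x F \<in> polys (Suc k)"
proof -
  have "\<alpha> \<in> expos \<and> deg \<alpha> \<le> Suc k" if \<alpha>: "tt x F \<alpha> \<noteq> 0" for \<alpha>
  proof -
    obtain \<beta> where "F \<beta> \<noteq> 0" "deg \<alpha> = Suc (deg \<beta>)" "\<beta> \<in> expos \<longleftrightarrow> \<alpha> \<in> expos"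
      using tt_support[OF assms(1) \<alpha>] .
    then show ?thesis using assms(2) unfolding polys_def by fastforce
  qed
  then show ?thesis unfolding polys_def by simp
qed

lemma dd_polys: assumes "x \<in> vars" "F \<in> polys k" shows "dd x F \<in> polys (k - 1)"
proof -
  have "\<alpha> \<in> expos \<and> deg \<alpha> \<le> k - 1" if \<alpha>: "dd x F \<alpha> \<noteq> 0" for \<alpha>
  proof -
    obtain \<beta> where "F \<beta> \<noteq> 0" "deg \<beta> = Suc (deg \<alpha>)" "\<beta> \<in> expos \<longleftrightarrow> \<alpha> \<in> expos"
      using dd_support[OF assms(1) \<alpha>] .
    then show ?thesis using assms(2) unfolding polys_def by fastforce
  qed
  then show ?thesis unfolding polys_def by simp
qed

lemma dd_polys_0: assumes "x \<in> vars" "F \<in> polys 0" shows "dd x F = 0"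
proof (rule ccontr)
  assume "dd x F \<noteq> 0"
  then obtain \<alpha> where "dd x F \<alpha> \<noteq> 0" by (metis ext zero_fun_apply)
  then obtain \<beta> where "F \<beta> \<noteq> 0" "deg \<beta> = Suc (deg \<alpha>)"
    by (rule dd_support[OF assms(1)])
  then show False using assms(2) unfolding polys_def by fastforce
qed

lemma polys_mono: "k \<le> l \<Longrightarrow> polys k \<subseteq> polys l"
  by (fastforce simp: polys_def)

lemma tt_dd_polys: assumes "x \<in> vars" "y \<in> vars" "F \<in> polys k" shows "tt x (dd y F) \<in> polys k"
proof (cases k)
  case 0
  then show ?thesis using dd_polys_0[of y F] assms subspace_0[OF subspace_polys] by simp
next
  case (Suc l)
  then have "dd y F \<in> polys l" using dd_polys[OF assms(2,3)] by simp
  then show ?thesis using tt_polys[OF assms(1)] Suc by simp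
qed

lemma tt_homog: assumes "x \<in> vars" "F \<in> homog k" shows "tt x F \<in> homog (Suc k)"
proof -
  have "\<alpha> \<in> expos \<and> deg \<alpha> = Suc k" if \<alpha>: "tt x F \<alpha> \<noteq> 0" for \<alpha>
  proof -
    obtain \<beta> where "F \<beta> \<noteq> 0" "deg \<alpha> = Suc (deg \<beta>)" "\<beta> \<in> expos \<longleftrightarrow> \<alpha> \<in> expos"
      using tt_support[OF assms(1) \<alpha>] .
    then show ?thesis using assms(2) unfolding homog_def by fastforce
  qed
  then show ?thesis unfolding homog_def by simp
qed

lemma dd_homog: assumes "x \<in> vars" "F \<in> homog (Suc k)" shows "dd x F \<in> homog k"
proof -
  have "\<alpha> \<in> expos \<and> deg \<alpha> = k" if \<alpha>: "dd x F \<alpha> \<noteq> 0" for \<alpha>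
  proof -
    obtain \<beta> where "F \<beta> \<noteq> 0" "deg \<beta> = Suc (deg \<alpha>)" "\<beta> \<in> expos \<longleftrightarrow> \<alpha> \<in> expos"
      using dd_support[OF assms(1) \<alpha>] .
    then show ?thesis using assms(2) unfolding homog_def by fastforce
  qed
  then show ?thesis unfolding homog_def by simp
qed

lemma homog_subset_polys: "homog k \<subseteq> polys k"
  by (auto simp: homog_def polys_def)

lemma EE_polys:
  assumes "a < p + q" "b < p + q" "F \<in> polys k" shows "EE a b F \<in> polys (Suc k)"
proof -
  have "DD b l F \<in> polys k" if "l < p" for l
    using assms that polys_mono[of "k - 1" k] dd_polys[of "(b, l)" F k] unfolding DD_def
    by (auto simp: vars_def intro!: subspace_diff[OF subspace_polys] subspace_neg[OF subspace_polys]
        subspace_scale[OF subspace_polys] subspace_sum[OF subspace_polys] tt_dd_polys subspace_0[OF subspace_polys] simp del: zero_fun_apply)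
  then have "XX a l (DD b l F) \<in> polys (Suc k)" if "l < p" for l
    using assms(1) that polys_mono[of k "Suc k"] unfolding XX_def
    by (auto intro!: tt_polys subspace_0[OF subspace_polys] simp: vars_def simp del: zero_fun_apply)
  then show ?thesis unfolding EE_def by (intro subspace_sum[OF subspace_polys]) auto
qed

lemma one_polys: "one \<in> polys k"
  by (auto simp: polys_def one_def expos_def deg_def)

lemma fil_one_subset: "fil k one \<subseteq> polys k"
  unfolding fil_def
proof (rule span_minimal)
  have "w \<in> words (p + q) \<Longrightarrow> word_act EE w one \<in> polys (length w)" for w
    by (induction w) (auto simp: one_polys EE_polys)
  then show "(\<lambda>w. word_act EE w one) ` words_upto (p + q) k \<subseteq> polys k"
    using polys_mono by (fastforce simp: words_upto_def)
qed (rule subspace_polys)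

lemma EE_raise: "a < p \<Longrightarrow> b \<ge> p \<Longrightarrow> EE a b F = dd (b, a) F"
  by (simp add: EE_def XX_def DD_def del: zero_fun_apply)

text \<open>The partial derivatives are raising operators of the module (\<open>EE_raise\<close>),
  so differentiating a nonzero polynomial until only a nonzero constant is left stays inside the
  submodule it generates.\<close>

lemma one_in_cyc:
  assumes "F \<in> polys k" "F \<noteq> 0" shows "one \<in> cyc F"
  using assms
proof (induction k arbitrary: F rule: less_induct)
  case (less k)
  show ?case
  proof (cases "\<exists>x\<in>vars. dd x F \<noteq> 0")
    case True
    then obtain b a where x: "(b, a) \<in> vars" "dd (b, a) F \<noteq> 0" by auto
    then have "k \<noteq> 0" using dd_polys_0[OF x(1)] less.prems(1) by auto
    then have "one \<in> cyc (dd (b, a) F)"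
      by (intro less.IH[OF _ dd_polys[OF x(1) less.prems(1)] x(2)]) simp
    moreover have "dd (b, a) F \<in> cyc F"
      using x(1) EE_raise[of a b F] e_cyc[of a b F F] by (simp add: vars_def)
    ultimately show ?thesis using cyc_minimal by blast
  next
    case False
    have F0: "F \<alpha> = 0" if "\<alpha> \<noteq> (\<lambda>_. 0)" for \<alpha>
    proof (rule ccontr)
      assume "F \<alpha> \<noteq> 0"
      then have "\<alpha> \<in> expos" using less.prems(1) by (auto simp: polys_def)
      have "\<exists>x. \<alpha> x \<noteq> 0"
      proof (rule ccontr)
        assume "\<nexists>x. \<alpha> x \<noteq> 0"
        then have "\<alpha> = (\<lambda>_. 0)" by (intro ext) blast
        then show False using that by simp
      qed
      then obtain x where "\<alpha> x \<noteq> 0" ..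
      then have x: "x \<in> vars" "\<alpha> x \<noteq> 0" using expos_zero[OF \<open>\<alpha> \<in> expos\<close>, of x] by auto
      then have "dd x F (\<alpha>(x := \<alpha> x - 1)) = of_nat (\<alpha> x) * F \<alpha>" by (simp add: dd_def)
      then show False using False x \<open>F \<alpha> \<noteq> 0\<close> by simp
    qed
    define c where "c = F (\<lambda>_. 0)"
    have F: "F = pscale c one"
    proof
      show "F \<alpha> = pscale c one \<alpha>" for \<alpha>
        using F0[of \<alpha>] by (cases "\<alpha> = (\<lambda>_. 0)") (simp_all add: one_def pointwise_def c_def)
    qed
    have "c \<noteq> 0" using F less.prems(2) by auto
    then have "one = pscale (inverse c) F" unfolding F by simp
    then show ?thesis using subspace_scale[OF subspace_cyc self_in_cyc] by metis
  qed
qed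

text \<open>Covers also those s for which the constants generate a proper subspace of the
  polynomials: whatever is generated consists of polynomials, and \<open>one_in_cyc\<close>
  applies.\<close>

lemma simple_at_one: "simple_at one"
  unfolding simple_at_def
proof (intro ballI impI)
  fix y assume "y \<in> cyc one" "y \<noteq> 0"
  then obtain k where "y \<in> fil k one" using cyc_in_fil by blast
  then show "one \<in> cyc y" using fil_one_subset one_in_cyc \<open>y \<noteq> 0\<close> by blast
qed

subsection \<open>The Fischer product\<close>

definition hexpos :: "nat \<Rightarrow> expo set" where "hexpos k = {\<alpha>\<in>expos. deg \<alpha> = k}"

definition efact :: "expo \<Rightarrow> complex" where "efact \<alpha> = (\<Prod>x\<in>vars. of_nat (fact (\<alpha> x)))"

text \<open>The weight \<open>efact\<close> makes multiplication by a variable adjoint to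
  differentiation by it. Only the coefficients of degree k are seen, so that the product is a finite
  sum even for power series.\<close>

definition fischer :: "nat \<Rightarrow> (expo \<Rightarrow> complex) \<Rightarrow> (expo \<Rightarrow> complex) \<Rightarrow> complex" where
  "fischer k F G = (\<Sum>\<alpha>\<in>hexpos k. efact \<alpha> * F \<alpha> * cnj (G \<alpha>))"

lemma expos_le_eq: "{\<alpha>\<in>expos. \<forall>x. \<alpha> x \<le> k} = (\<lambda>g x. if x \<in> vars then g x else 0) ` (vars \<rightarrow>\<^sub>E {..k})"
proof (intro equalityI subsetI)
  fix \<alpha> assume "\<alpha> \<in> {\<alpha>\<in>expos. \<forall>x. \<alpha> x \<le> k}"
  then show "\<alpha> \<in> (\<lambda>g x. if x \<in> vars then g x else 0) ` (vars \<rightarrow>\<^sub>E {..k})"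
    by (intro image_eqI[of _ _ "restrict \<alpha> vars"]) (auto simp: expos_def fun_eq_iff)
qed (auto simp: expos_def PiE_def Pi_def)

lemma finite_expos_le: "finite {\<alpha>\<in>expos. \<forall>x. \<alpha> x \<le> k}"
  unfolding expos_le_eq by (intro finite_imageI finite_PiE) auto

text \<open>Cubes of exponents have an exact power as cardinality. Degree at most k lies between the
  cubes with bounds k div (p q) and k, and the ratio of the two sides does not affect the growth
  rate.\<close>

lemma card_expos_le: "card {\<alpha>\<in>expos. \<forall>x. \<alpha> x \<le> k} = Suc k ^ (p * q)"
proof -
  have "inj_on (\<lambda>g x. if x \<in> vars then g x else 0) (vars \<rightarrow>\<^sub>E {..k})"
  proof (rule inj_onI)
    fix g h :: expo
    assume g: "g \<in> vars \<rightarrow>\<^sub>E {..k}" and h: "h \<in> vars \<rightarrow>\<^sub>E {..k}"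
      and eq: "(\<lambda>x. if x \<in> vars then g x else 0) = (\<lambda>x. if x \<in> vars then h x else 0)"
    show "g = h"
    proof (rule PiE_ext[OF g h])
      show "g x = h x" if "x \<in> vars" for x using fun_cong[OF eq, of x] that by simp
    qed
  qed
  then show ?thesis unfolding expos_le_eq by (simp add: card_image card_PiE card_vars)
qed

lemma expos_deg_subset: "{\<alpha>\<in>expos. deg \<alpha> \<le> k} \<subseteq> {\<alpha>\<in>expos. \<forall>x. \<alpha> x \<le> k}"
proof safe
  fix \<alpha> a b assume "\<alpha> \<in> expos" "deg \<alpha> \<le> k"
  then show "\<alpha> (a, b) \<le> k" using deg_le[of "(a, b)" \<alpha>] by (cases "(a, b) \<in> vars") (auto simp: expos_def)
qed

lemma finite_deg_le: "finite {\<alpha>\<in>expos. deg \<alpha> \<le> k}"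
  using finite_subset[OF expos_deg_subset finite_expos_le] .

lemma finite_hexpos [simp]: "finite (hexpos k)"
  by (rule finite_subset[OF _ finite_deg_le[of k]]) (auto simp: hexpos_def)

lemma efact_Suc: "x \<in> vars \<Longrightarrow> efact (\<alpha>(x := Suc (\<alpha> x))) = of_nat (Suc (\<alpha> x)) * efact \<alpha>"
proof -
  assume x: "x \<in> vars"
  let ?f = "\<lambda>\<alpha> y. of_nat (fact (\<alpha> y)) :: complex"
  have "prod (?f (\<alpha>(x := Suc (\<alpha> x)))) (vars - {x}) = prod (?f \<alpha>) (vars - {x})"
    by (rule prod.cong) auto
  then show ?thesis
    unfolding efact_def prod.remove[OF finite_vars x, of "?f \<alpha>"]
      prod.remove[OF finite_vars x, of "?f (\<alpha>(x := Suc (\<alpha> x)))"]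
    by (simp add: algebra_simps)
qed

lemma fischer_tt:
  assumes "x \<in> vars" shows "fischer (Suc k) (tt x F) G = fischer k F (dd x G)"
proof -
  let ?up = "\<lambda>\<alpha>. \<alpha>(x := Suc (\<alpha> x))"
  have "fischer (Suc k) (tt x F) G = (\<Sum>\<alpha>\<in>{\<alpha>\<in>hexpos (Suc k). \<alpha> x \<noteq> 0}. efact \<alpha> * tt x F \<alpha> * cnj (G \<alpha>))"
    unfolding fischer_def by (rule sum.mono_neutral_right) (auto simp: tt_def)
  also have "\<dots> = (\<Sum>\<alpha>\<in>hexpos k. efact (?up \<alpha>) * tt x F (?up \<alpha>) * cnj (G (?up \<alpha>)))"
  proof (rule sum.reindex_bij_witness[where i = ?up and j = "\<lambda>\<alpha>. \<alpha>(x := \<alpha> x - 1)"])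
    fix \<alpha> assume "\<alpha> \<in> {\<alpha> \<in> hexpos (Suc k). \<alpha> x \<noteq> 0}"
    then show "\<alpha>(x := \<alpha> x - 1) \<in> hexpos k" using deg_pred[of x \<alpha>] assms by (auto simp: hexpos_def)
  qed (use assms in \<open>auto simp: hexpos_def deg_Suc\<close>)
  also have "\<dots> = fischer k F (dd x G)"
    unfolding fischer_def by (rule sum.cong) (use assms in \<open>auto simp: efact_Suc tt_def dd_def\<close>)
  finally show ?thesis .
qed

lemma fischer_cnj: "fischer k G F = cnj (fischer k F G)"
  by (simp add: fischer_def efact_def ac_simps)

lemma fischer_dd: "x \<in> vars \<Longrightarrow> fischer k (dd x F) G = fischer (Suc k) F (tt x G)"
  using fischer_tt[of x k G F] unfolding fischer_cnj[of k "dd x F"] fischer_cnj[of "Suc k" F] by simp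

lemma fischer_sum: "fischer k (\<Sum>i\<in>I. f i) G = (\<Sum>i\<in>I. fischer k (f i) G)"
  "fischer k G (\<Sum>i\<in>I. f i) = (\<Sum>i\<in>I. fischer k G (f i))"
proof -
  have add: "fischer k (F + H) G = fischer k F G + fischer k H G" for F H G
    by (simp add: fischer_def algebra_simps sum.distrib)
  have zero: "fischer k 0 G = 0" for G by (simp add: fischer_def)
  show *: "fischer k (\<Sum>i\<in>I. f i) G = (\<Sum>i\<in>I. fischer k (f i) G)" for G
    by (induction I rule: infinite_finite_induct) (simp_all add: add zero del: plus_fun_apply zero_fun_apply)
  show "fischer k G (\<Sum>i\<in>I. f i) = (\<Sum>i\<in>I. fischer k G (f i))"
    unfolding fischer_cnj[of k G "sum f I"] * cnj_sum fischer_cnj[of k "f _" G] by simp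
qed

lemma fischer_scale: "fischer k (pscale c F) G = c * fischer k F G"
  by (simp add: fischer_def pointwise_def sum_distrib_left ac_simps)

lemma fischer_diff: "fischer k (F - H) G = fischer k F G - fischer k H G"
  by (simp add: fischer_def algebra_simps sum_subtractf)

definition sqnorm :: "nat \<Rightarrow> (expo \<Rightarrow> complex) \<Rightarrow> real" where
  "sqnorm k F = (\<Sum>\<alpha>\<in>hexpos k. (\<Prod>x\<in>vars. fact (\<alpha> x)) * (cmod (F \<alpha>))\<^sup>2)"

lemma fischer_self: "fischer k F F = of_real (sqnorm k F)"
  unfolding fischer_def sqnorm_def efact_def
  by (simp add: complex_norm_square[symmetric] mult.assoc del: of_real_power)

lemma sqnorm_nonneg: "sqnorm k F \<ge> 0"
  unfolding sqnorm_def by (intro sum_nonneg mult_nonneg_nonneg prod_nonneg) auto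

lemma sqnorm_eq_0: assumes "F \<in> homog k" "sqnorm k F = 0" shows "F = 0"
proof
  fix \<alpha>
  show "F \<alpha> = 0 \<alpha>"
  proof (cases "\<alpha> \<in> hexpos k")
    case True
    have "(\<Prod>x\<in>vars. fact (\<alpha> x)) * (cmod (F \<alpha>))\<^sup>2 \<le> sqnorm k F"
      unfolding sqnorm_def
      by (rule member_le_sum[OF True]) (auto intro!: mult_nonneg_nonneg prod_nonneg)
    moreover have "(\<Prod>x\<in>vars. fact (\<alpha> x) :: real) > 0" by (intro prod_pos) auto
    ultimately show ?thesis using assms(2) by (simp add: mult_le_0_iff)
  next
    case False
    then show ?thesis using assms(1) by (auto simp: homog_def hexpos_def)
  qed
qed

end

lemma (in vector_space) linear_inj_on_surj:
  assumes V: "subspace V" "V \<subseteq> span F" "finite F"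
    and add: "\<And>x y. f (x + y) = f x + f y" and scale: "\<And>c x. f (scale c x) = scale c (f x)"
    and into: "\<And>x. x \<in> V \<Longrightarrow> f x \<in> V" and inj: "\<And>x. x \<in> V \<Longrightarrow> f x = 0 \<Longrightarrow> x = 0"
  shows "f ` V = V"
proof (rule antisym)
  interpret vector_space_pair scale scale ..
  have lin: "Vector_Spaces.linear scale scale f"
    by (simp add: Vector_Spaces.linear_iff add scale vector_space_axioms)
  obtain B where B: "B \<subseteq> V" "independent B" "V \<subseteq> span B" "card B = dim V"
    by (rule basis_exists)
  have finB: "finite B" using independent_span_bound[OF V(3) B(2) order_trans[OF B(1) V(2)]] by simp
  have spB: "span B = V" using span_minimal[OF B(1) V(1)] B(3) by (rule subset_antisym)
  have injV: "inj_on f V"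
  proof (rule inj_onI)
    fix x y assume xy: "x \<in> V" "y \<in> V" "f x = f y"
    have "f (x - y) + f y = f y" using add[of "x - y" y] xy(3) by (simp only: diff_add_cancel)
    then have "f (x - y) = 0" by simp
    then show "x = y" using inj[of "x - y"] subspace_diff[OF V(1) xy(1,2)] by simp
  qed
  have ind: "independent (f ` B)"
    by (rule linear_independent_injective_image[OF lin B(2)]) (use injV spB in simp)
  have card: "card (f ` B) = card B" by (rule card_image[OF inj_on_subset[OF injV B(1)]])
  show "V \<subseteq> f ` V"
  proof
    fix v assume v: "v \<in> V"
    have "v \<in> span (f ` B)"
    proof (rule ccontr)
      assume nv: "v \<notin> span (f ` B)"
      then have "independent (insert v (f ` B))" using ind by (simp add: independent_insert)
      moreover have "insert v (f ` B) \<subseteq> span B" using v into B(1) unfolding spB by blast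
      ultimately have "card (insert v (f ` B)) \<le> card B" using independent_span_bound[OF finB] by blast
      moreover have "v \<notin> f ` B" using nv span_base[of v "f ` B"] by auto
      ultimately show False using card finB by (simp add: card_insert_if)
    qed
    also have "span (f ` B) = f ` span B"
      by (rule linear_span_image[OF lin])
    finally show "v \<in> f ` V" using spB by simp
  qed
qed (use into in auto)

section \<open>The constants generate all polynomials when s is real and below -q\<close>

context scalar_module
begin

definition monom :: "expo \<Rightarrow> expo \<Rightarrow> complex" where
  "monom \<alpha> = (\<lambda>\<beta>. if \<beta> = \<alpha> then 1 else 0)"

lemma sum_monom:
  assumes "finite A" "\<And>\<alpha>. F \<alpha> \<noteq> 0 \<Longrightarrow> \<alpha> \<in> A"
  shows "F = (\<Sum>\<alpha>\<in>A. pscale (F \<alpha>) (monom \<alpha>))"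
proof
  fix \<beta>
  have "(\<Sum>\<alpha>\<in>A. pscale (F \<alpha>) (monom \<alpha>)) \<beta> = (\<Sum>\<alpha>\<in>A. if \<alpha> = \<beta> then F \<beta> else 0)"
    unfolding sum_fun_apply by (rule sum.cong) (auto simp: pointwise_def monom_def)
  also have "\<dots> = F \<beta>" using assms by auto
  finally show "F \<beta> = (\<Sum>\<alpha>\<in>A. pscale (F \<alpha>) (monom \<alpha>)) \<beta>" ..
qed

lemma in_span_monom:
  assumes "finite A" "\<And>\<alpha>. F \<alpha> \<noteq> 0 \<Longrightarrow> \<alpha> \<in> A" shows "F \<in> span (monom ` A)"
proof -
  have "(\<Sum>\<alpha>\<in>A. pscale (F \<alpha>) (monom \<alpha>)) \<in> span (monom ` A)"
    by (intro span_sum span_scale span_base) auto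
  then show ?thesis using sum_monom[of A F, OF assms] by simp
qed

lemma inj_monom: "inj_on monom A"
  by (rule inj_onI) (metis monom_def zero_neq_one)

lemma independent_monom: assumes "finite A" shows "independent (monom ` A)"
proof (rule independent_if_scalars_zero)
  fix f x assume 0: "(\<Sum>x\<in>monom ` A. pscale (f x) x) = 0" and "x \<in> monom ` A"
  then obtain \<alpha> where \<alpha>: "\<alpha> \<in> A" "x = monom \<alpha>" by auto
  have "0 = (\<Sum>\<beta>\<in>A. pscale (f (monom \<beta>)) (monom \<beta>)) \<alpha>"
    using 0 by (simp add: sum.reindex[OF inj_monom])
  also have "\<dots> = (\<Sum>\<beta>\<in>A. if \<beta> = \<alpha> then f (monom \<alpha>) else 0)"
    unfolding sum_fun_apply by (rule sum.cong) (auto simp: pointwise_def monom_def)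
  finally show "f x = 0" using \<alpha> assms by simp
qed (use assms in simp)

lemma homog_finite: "homog k \<subseteq> span (monom ` hexpos k)"
  using in_span_monom[OF finite_hexpos[of k]] by (auto simp: homog_def hexpos_def)

definition euler :: "(expo \<Rightarrow> complex) \<Rightarrow> expo \<Rightarrow> complex" where
  "euler F = (\<Sum>x\<in>vars. tt x (dd x F))"

lemma euler_homog: assumes "F \<in> homog k" shows "euler F = pscale (of_nat k) F"
proof
  fix \<alpha>
  have "tt x (dd x F) \<alpha> = of_nat (\<alpha> x) * F \<alpha>" for x
    by (auto simp: tt_def dd_def of_nat_diff)
  then have "euler F \<alpha> = of_nat (deg \<alpha>) * F \<alpha>"
    by (simp add: euler_def sum_fun_apply deg_def sum_distrib_right)
  then show "euler F \<alpha> = pscale (of_nat k) F \<alpha>"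
    using assms by (auto simp: pointwise_def homog_def)
qed

text \<open>A raising operator followed by the opposite lowering operator, summed over the
  variables. It preserves the degree, and its values are obtained from polynomials of one degree
  less by a single letter. Surjectivity in each degree is thus an induction step for generating all
  polynomials.\<close>

definition theta :: "(expo \<Rightarrow> complex) \<Rightarrow> expo \<Rightarrow> complex" where
  "theta F = (\<Sum>(a, b)\<in>vars. EE a b (dd (a, b) F))"

definition row :: "nat \<Rightarrow> nat \<Rightarrow> (expo \<Rightarrow> complex) \<Rightarrow> expo \<Rightarrow> complex" where
  "row j a F = (\<Sum>b<p. tt (j, b) (dd (a, b) F))"

lemma EE_lower:
  assumes "a \<ge> p" "b < p"
  shows "EE a b F = pscale s (tt (a, b) F) - (\<Sum>k<p. \<Sum>j\<in>{p..<p+q}. tt (a, k) (tt (j, b) (dd (j, k) F)))"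
proof -
  have "EE a b F = (\<Sum>k<p. (if k = b then pscale s (tt (a, b) F) else 0) - (\<Sum>j\<in>{p..<p+q}. tt (a, k) (tt (j, b) (dd (j, k) F))))"
    unfolding EE_def
    by (rule sum.cong) (use assms in \<open>auto simp: XX_def DD_def tt_diff tt_sum tt_scale simp del: zero_fun_apply minus_apply\<close>)
  then show ?thesis using assms by (simp add: sum_subtractf del: minus_apply zero_fun_apply)
qed

text \<open>The second-order part of \<open>theta\<close> becomes a sum of operators
  \<open>row a j\<close> after \<open>row j a\<close>, which are adjoint to each other. Reordering
  one multiplication and one derivative for each of the q values of j yields q copies of the Euler
  operator.\<close>

lemma theta_eq:
  "theta F = pscale s (euler F) + pscale (of_nat q) (euler F)
    - (\<Sum>a\<in>{p..<p+q}. \<Sum>j\<in>{p..<p+q}. row a j (row j a F))"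
proof -
  let ?J = "{p..<p+q}"
  have row_row: "row a j (row j a F) = (\<Sum>k<p. \<Sum>b<p. tt (a, k) (tt (j, b) (dd (j, k) (dd (a, b) F))))
      + (\<Sum>k<p. tt (a, k) (dd (a, k) F))" for a j
  proof -
    have "row a j (row j a F) = (\<Sum>k<p. \<Sum>b<p. tt (a, k) (tt (j, b) (dd (j, k) (dd (a, b) F)))
       + (if k = b then tt (a, k) (dd (a, k) F) else 0))"
      unfolding row_def dd_sum tt_sum
      by (intro sum.cong) (auto simp: dd_tt tt_add simp del: plus_fun_apply zero_fun_apply)
    then show ?thesis by (simp add: sum.distrib del: plus_fun_apply zero_fun_apply)
  qed
  have vars_sum: "(\<Sum>(a, b)\<in>vars. f a b) = (\<Sum>a\<in>?J. \<Sum>b<p. f a b)" for f :: "nat \<Rightarrow> nat \<Rightarrow> expo \<Rightarrow> complex"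
    by (simp add: vars_def sum.cartesian_product)
  have eul: "euler F = (\<Sum>a\<in>?J. \<Sum>b<p. tt (a, b) (dd (a, b) F))"
    using vars_sum[of "\<lambda>a b. tt (a, b) (dd (a, b) F)"] by (simp add: euler_def case_prod_unfold)
  have "theta F = (\<Sum>a\<in>?J. \<Sum>b<p. pscale s (tt (a, b) (dd (a, b) F))
     - (\<Sum>k<p. \<Sum>j\<in>?J. tt (a, k) (tt (j, b) (dd (j, k) (dd (a, b) F)))))"
    unfolding theta_def vars_sum by (intro sum.cong refl EE_lower) auto
  also have "\<dots> = pscale s (euler F) - (\<Sum>a\<in>?J. \<Sum>b<p. \<Sum>k<p. \<Sum>j\<in>?J. tt (a, k) (tt (j, b) (dd (j, k) (dd (a, b) F))))"
    by (simp add: eul sum_subtractf scale_sum_right del: minus_apply)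
  also have "(\<Sum>a\<in>?J. \<Sum>b<p. \<Sum>k<p. \<Sum>j\<in>?J. tt (a, k) (tt (j, b) (dd (j, k) (dd (a, b) F))))
      = (\<Sum>a\<in>?J. \<Sum>j\<in>?J. row a j (row j a F) - (\<Sum>k<p. tt (a, k) (dd (a, k) F)))"
  proof (rule sum.cong[OF refl])
    fix a
    have "(\<Sum>b<p. \<Sum>k<p. \<Sum>j\<in>?J. tt (a, k) (tt (j, b) (dd (j, k) (dd (a, b) F))))
        = (\<Sum>b<p. \<Sum>j\<in>?J. \<Sum>k<p. tt (a, k) (tt (j, b) (dd (j, k) (dd (a, b) F))))"
      by (rule sum.cong[OF refl], rule sum.swap)
    also have "\<dots> = (\<Sum>j\<in>?J. \<Sum>b<p. \<Sum>k<p. tt (a, k) (tt (j, b) (dd (j, k) (dd (a, b) F))))"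
      by (rule sum.swap)
    also have "\<dots> = (\<Sum>j\<in>?J. \<Sum>k<p. \<Sum>b<p. tt (a, k) (tt (j, b) (dd (j, k) (dd (a, b) F))))"
      by (rule sum.cong[OF refl], rule sum.swap)
    finally show "(\<Sum>b<p. \<Sum>k<p. \<Sum>j\<in>?J. tt (a, k) (tt (j, b) (dd (j, k) (dd (a, b) F))))
        = (\<Sum>j\<in>?J. row a j (row j a F) - (\<Sum>k<p. tt (a, k) (dd (a, k) F)))"
      by (simp add: row_row del: minus_apply plus_fun_apply)
  qed
  also have "\<dots> = (\<Sum>a\<in>?J. \<Sum>j\<in>?J. row a j (row j a F)) - (\<Sum>a\<in>?J. pscale (of_nat q) (\<Sum>k<p. tt (a, k) (dd (a, k) F)))"
    by (simp add: sum_subtractf sum_constant_scale del: minus_apply sum_constant)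
  also have "(\<Sum>a\<in>?J. pscale (of_nat q) (\<Sum>k<p. tt (a, k) (dd (a, k) F))) = pscale (of_nat q) (euler F)"
    by (simp add: eul scale_sum_right)
  finally show ?thesis by (simp add: algebra_simps del: minus_apply plus_fun_apply)
qed

lemma fischer_row:
  assumes "a \<in> {p..<p+q}" "j \<in> {p..<p+q}"
  shows "fischer (Suc k) (row a j G) F = fischer (Suc k) G (row j a F)"
proof -
  have "fischer (Suc k) (tt (a, b) (dd (j, b) G)) F = fischer (Suc k) G (tt (j, b) (dd (a, b) F))" if "b < p" for b
    using fischer_tt[of "(a, b)" k "dd (j, b) G" F] fischer_dd[of "(j, b)" k G "dd (a, b) F"] assms that
    by (simp add: vars_def)
  then show ?thesis unfolding row_def fischer_sum by (intro sum.cong) auto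
qed

text \<open>Pairing \<open>theta F\<close> with \<open>F\<close> gives (s + q)(k + 1) times the
  square norm of F, minus a sum of square norms. The first factor is negative, so the total vanishes
  only for F = 0.\<close>

lemma theta_inj:
  assumes "s \<in> \<real>" "Re s < - real q" "F \<in> homog (Suc k)" "theta F = 0"
  shows "F = 0"
proof -
  let ?J = "{p..<p+q}"
  have "0 = fischer (Suc k) (theta F) F" by (simp add: assms(4) fischer_def)
  also have "\<dots> = (s + of_nat q) * of_nat (Suc k) * fischer (Suc k) F F
      - (\<Sum>a\<in>?J. \<Sum>j\<in>?J. fischer (Suc k) (row j a F) (row j a F))"
    unfolding theta_eq euler_homog[OF assms(3)] scale_scale
      scale_left_distrib[symmetric] fischer_diff fischer_scale fischer_sum
    by (simp add: fischer_row algebra_simps)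
  also have "\<dots> = of_real ((Re s + real q) * real (Suc k) * sqnorm (Suc k) F
      - (\<Sum>a\<in>?J. \<Sum>j\<in>?J. sqnorm (Suc k) (row j a F)))"
    using assms(1) by (simp add: fischer_self complex_is_Real_iff complex_eq_iff)
  finally have "(Re s + real q) * real (Suc k) * sqnorm (Suc k) F
      - (\<Sum>a\<in>?J. \<Sum>j\<in>?J. sqnorm (Suc k) (row j a F)) = 0"
    by (subst of_real_eq_0_iff[symmetric, where 'a = complex], rule sym)
  then have "(Re s + real q) * real (Suc k) * sqnorm (Suc k) F
      = (\<Sum>a\<in>?J. \<Sum>j\<in>?J. sqnorm (Suc k) (row j a F))" by simp
  moreover have "\<dots> \<ge> 0" by (intro sum_nonneg sqnorm_nonneg)
  moreover have "(Re s + real q) * real (Suc k) < 0" using assms(2) by (simp add: mult_less_0_iff)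
  ultimately have "sqnorm (Suc k) F \<le> 0" by (metis leD leI mult_neg_pos)
  then show ?thesis using sqnorm_nonneg[of "Suc k" F] sqnorm_eq_0[OF assms(3)] by simp
qed

lemma EE_lower_homog:
  assumes "(a, b) \<in> vars" "F \<in> homog k" shows "EE a b F \<in> homog (Suc k)"
proof -
  have tdd: "tt x (dd y F) \<in> homog k" if "x \<in> vars" "y \<in> vars" for x y
  proof (cases k)
    case 0
    have "F \<in> polys 0" using assms(2) 0 homog_subset_polys by auto
    then show ?thesis using dd_polys_0[OF that(2)] subspace_0[OF subspace_homog] by simp
  next
    case (Suc l)
    then show ?thesis using tt_homog[OF that(1), of _ l] dd_homog[OF that(2), of F l] assms(2) by simp
  qed
  have "tt (a, b) F \<in> homog (Suc k)" by (rule tt_homog[OF assms])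
  moreover have "tt (a, l) (tt (j, b) (dd (j, l) F)) \<in> homog (Suc k)" if "l < p" "j \<in> {p..<p+q}" for l j
    by (rule tt_homog[OF _ tdd]) (use assms(1) that in \<open>auto simp: vars_def\<close>)
  ultimately show ?thesis
    using assms(1) EE_lower[of a b F]
    by (auto simp: vars_def intro!: subspace_diff[OF subspace_homog] subspace_scale[OF subspace_homog] subspace_sum[OF subspace_homog])
qed

text \<open>\<open>theta\<close> is injective, hence surjective, on the finite-dimensional space of
  each positive degree. Its values need one letter more than the derivatives, so degree k is reached
  with words of length at most k.\<close>

lemma homog_subset_fil:
  assumes "s \<in> \<real>" "Re s < - real q" shows "homog k \<subseteq> fil k one"
proof (induction k)
  case 0
  show ?case
  proof
    fix F assume F: "F \<in> homog 0"
    have "F = pscale (F (\<lambda>_. 0)) one"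
    proof
      fix \<alpha>
      show "F \<alpha> = pscale (F (\<lambda>_. 0)) one \<alpha>"
        using F deg_eq_0[of \<alpha>] unfolding homog_def
        by (cases "\<alpha> = (\<lambda>_. 0)") (auto simp: pointwise_def one_def)
    qed
    then show "F \<in> fil 0 one" using subspace_scale[OF subspace_fil self_in_fil] by metis
  qed
next
  case (Suc k)
  have add: "theta (F + G) = theta F + theta G" for F G
    by (simp add: theta_def dd_add EE_add sum.distrib case_prod_unfold del: plus_fun_apply)
  have scale: "theta (pscale c F) = pscale c (theta F)" for c F
    by (simp add: theta_def dd_scale EE_scale scale_sum_right case_prod_unfold)
  have th: "theta F \<in> homog (Suc k) \<inter> fil (Suc k) one" if F: "F \<in> homog (Suc k)" for F
  proof -
    have "EE a b (dd (a, b) F) \<in> homog (Suc k) \<inter> fil (Suc k) one" if "(a, b) \<in> vars" for a b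
      using EE_lower_homog[OF that dd_homog[OF that F]] dd_homog[OF that F] Suc that e_fil[of a b "dd (a, b) F" k one]
      by (auto simp: vars_def)
    then show ?thesis unfolding theta_def
      by (intro subspace_sum subspace_inter subspace_homog subspace_fil) auto
  qed
  have surj: "theta ` homog (Suc k) = homog (Suc k)"
    by (rule linear_inj_on_surj[OF subspace_homog homog_finite])
       (use th theta_inj[OF assms] in \<open>auto simp: add scale\<close>)
  have "theta ` homog (Suc k) \<subseteq> fil (Suc k) one"
    by (rule image_subsetI) (use th in simp)
  then show ?case unfolding surj .
qed

lemma polys_subset_fil:
  assumes "s \<in> \<real>" "Re s < - real q" shows "polys k \<subseteq> fil k one"
proof
  fix F assume F: "F \<in> polys k"
  define G where "G m = (\<lambda>\<alpha>. if deg \<alpha> = m then F \<alpha> else 0)" for m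
  have "F = (\<Sum>m\<le>k. G m)"
  proof
    fix \<alpha>
    have "(\<Sum>m\<le>k. G m \<alpha>) = (if deg \<alpha> \<le> k then F \<alpha> else 0)"
      unfolding G_def by simp
    also have "\<dots> = F \<alpha>" using F unfolding polys_def by auto
    finally show "F \<alpha> = (\<Sum>m\<le>k. G m) \<alpha>" by (simp add: sum_fun_apply)
  qed
  moreover have "G m \<in> fil k one" if "m \<le> k" for m
  proof -
    have "G m \<in> homog m" using F unfolding G_def homog_def polys_def by auto
    then show ?thesis using homog_subset_fil[OF assms, of m] fil_mono[OF that, of one] by blast
  qed
  ultimately show "F \<in> fil k one" by (auto intro!: subspace_sum[OF subspace_fil])
qed

lemma dim_fil_one_upper: "dim (fil k one) \<le> Suc k ^ (p * q)"
proof -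
  let ?A = "{\<alpha>\<in>expos. \<forall>x. \<alpha> x \<le> k}"
  have "fil k one \<subseteq> span (monom ` ?A)"
  proof
    fix F assume "F \<in> fil k one"
    then have "F \<in> polys k" using fil_one_subset by blast
    then show "F \<in> span (monom ` ?A)"
      using expos_deg_subset[of k] by (intro in_span_monom finite_expos_le) (auto simp: polys_def)
  qed
  then have "dim (fil k one) \<le> card (monom ` ?A)" using finite_expos_le by (intro dim_le_card) auto
  also have "\<dots> = Suc k ^ (p * q)" by (simp only: card_image[OF inj_monom] card_expos_le)
  finally show ?thesis .
qed

lemma dim_fil_one_lower:
  assumes "s \<in> \<real>" "Re s < - real q" shows "Suc (k div (p * q)) ^ (p * q) \<le> dim (fil k one)"
proof -
  let ?A = "{\<alpha>\<in>expos. \<forall>x. \<alpha> x \<le> k div (p * q)}"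
  have "deg \<alpha> \<le> k" if "\<alpha> \<in> ?A" for \<alpha>
  proof -
    have "sum \<alpha> vars \<le> of_nat (card vars) * (k div (p * q))"
      by (rule sum_bounded_above) (use that in blast)
    also have "\<dots> \<le> k" by (simp add: card_vars)
    finally show ?thesis by (simp add: deg_def)
  qed
  then have "monom ` ?A \<subseteq> polys k" by (auto simp: polys_def monom_def split: if_splits)
  then have sub: "monom ` ?A \<subseteq> fil k one" using polys_subset_fil[OF assms] by blast
  have "Suc (k div (p * q)) ^ (p * q) = dim (monom ` ?A)"
    using dim_eq_card_independent[OF independent_monom[OF finite_expos_le]]
    by (simp only: card_image[OF inj_monom] card_expos_le)
  also have "\<dots> \<le> dim (fil k one)"
    by (rule dim_le_of_span[where F = "(\<lambda>w. word_act EE w one) ` words_upto (p + q) k"])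
       (use sub in \<open>auto simp: fil_def span_base intro: span_base span_superset[THEN subsetD]\<close>)
  finally show ?thesis .
qed

end

section \<open>Modules over traceless matrices\<close>

text \<open>The traceless part of a matrix unit; off the diagonal it is the matrix unit
  itself.\<close>

definition slE :: "nat \<Rightarrow> nat \<Rightarrow> nat \<Rightarrow> complex mat" where
  "slE n a b = mat n n (\<lambda>(i, j). of_bool (i = a \<and> j = b) - of_bool (a = b) / of_nat n * of_bool (i = j))"

lemma sl_carrier: "A \<in> sl n \<Longrightarrow> A \<in> carrier_mat n n"
  by (simp add: sl_def)

lemma mat_mult_index:
  assumes "A \<in> carrier_mat n n" "B \<in> carrier_mat n n" "i < n" "j < n"
  shows "(A * B) $$ (i, j) = (\<Sum>k<n. A $$ (i, k) * B $$ (k, j))"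
  using assms by (auto simp: scalar_prod_def lessThan_atLeast0 intro!: sum.cong)

lemma lie_bracket_sl: assumes "A \<in> sl n" "B \<in> sl n" shows "lie_bracket A B \<in> sl n"
proof -
  note AB = sl_carrier[OF assms(1)] sl_carrier[OF assms(2)]
  have "(\<Sum>i<n. lie_bracket A B $$ (i, i)) = (\<Sum>i<n. (A * B) $$ (i, i)) - (\<Sum>i<n. (B * A) $$ (i, i))"
    unfolding sum_subtractf[symmetric] lie_bracket_def by (rule sum.cong) (use AB in auto)
  also have "(\<Sum>i<n. (B * A) $$ (i, i)) = (\<Sum>i<n. \<Sum>k<n. B $$ (i, k) * A $$ (k, i))"
    by (rule sum.cong) (use AB in \<open>auto simp: mat_mult_index simp del: index_mult_mat\<close>)
  also have "\<dots> = (\<Sum>k<n. \<Sum>i<n. A $$ (k, i) * B $$ (i, k))"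
    by (subst sum.swap) (simp add: mult.commute)
  also have "\<dots> = (\<Sum>i<n. (A * B) $$ (i, i))"
    by (rule sum.cong) (use AB in \<open>auto simp: mat_mult_index simp del: index_mult_mat\<close>)
  finally have "(\<Sum>i<n. lie_bracket A B $$ (i, i)) = 0" by simp
  moreover have "lie_bracket A B \<in> carrier_mat n n"
    unfolding lie_bracket_def using AB by (intro minus_carrier_mat mult_carrier_mat)
  ultimately show ?thesis by (simp add: sl_def)
qed

lemma add_sl: assumes "A \<in> sl n" "B \<in> sl n" shows "A + B \<in> sl n"
proof -
  have "(\<Sum>i<n. (A + B) $$ (i, i)) = (\<Sum>i<n. A $$ (i, i) + B $$ (i, i))"
    by (rule sum.cong) (use assms in \<open>auto simp: sl_def\<close>)
  then show ?thesis using assms by (simp add: sl_def sum.distrib)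
qed

lemma smult_sl: assumes "A \<in> sl n" shows "c \<cdot>\<^sub>m A \<in> sl n"
proof -
  have "(\<Sum>i<n. (c \<cdot>\<^sub>m A) $$ (i, i)) = (\<Sum>i<n. c * A $$ (i, i))"
    by (rule sum.cong) (use assms in \<open>auto simp: sl_def\<close>)
  then show ?thesis using assms by (simp add: sl_def sum_distrib_left[symmetric])
qed

lemma zero_sl: "0\<^sub>m n n \<in> sl n"
  by (simp add: sl_def)

lemma slE_sl: assumes "a < n" "b < n" shows "slE n a b \<in> sl n"
proof -
  have "(\<Sum>i<n. slE n a b $$ (i, i)) = (\<Sum>i<n. (if i = a then of_bool (a = b) else 0) - of_bool (a = b) / of_nat n)"
    by (rule sum.cong) (auto simp: slE_def)
  also have "\<dots> = 0" using assms by (simp add: sum_subtractf)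
  finally show ?thesis by (simp add: sl_def slE_def)
qed

text \<open>Multiples of the identity are central and drop out on the left. On the right they occur
  only if b = c and a = d, and then they cancel.\<close>

lemma slE_bracket:
  assumes "a < n" "b < n" "c < n" "d < n"
  shows "lie_bracket (slE n a b) (slE n c d) =
    of_bool (b = c) \<cdot>\<^sub>m slE n a d + (- of_bool (d = a)) \<cdot>\<^sub>m slE n c b"
proof -
  have prod: "(slE n a b * slE n c d) $$ (i, j) = of_bool (i = a \<and> b = c \<and> j = d)
      - of_bool (c = d) / of_nat n * of_bool (i = a \<and> j = b) - of_bool (a = b) / of_nat n * of_bool (i = c \<and> j = d)
      + of_bool (a = b) / of_nat n * (of_bool (c = d) / of_nat n) * of_bool (i = j)"
    if "i < n" "j < n" "a < n" "b < n" "c < n" "d < n" for a b c d i j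
  proof -
    define r t :: complex where "r = of_bool (a = b) / of_nat n" and "t = of_bool (c = d) / of_nat n"
    have "(slE n a b * slE n c d) $$ (i, j) = (\<Sum>k<n. slE n a b $$ (i, k) * slE n c d $$ (k, j))"
      using that by (intro mat_mult_index) (auto simp: slE_def)
    also have "\<dots> = (\<Sum>k<n. (if k = b then of_bool (i = a \<and> b = c \<and> j = d) else 0)
        - (if k = j then t * of_bool (i = a \<and> j = b) else 0) - (if k = i then r * of_bool (i = c \<and> j = d) else 0)
        + (if k = i then r * t * of_bool (i = j) else 0))"
      using that by (intro sum.cong) (auto simp: slE_def r_def[symmetric] t_def[symmetric] algebra_simps)
    also have "\<dots> = of_bool (i = a \<and> b = c \<and> j = d) - t * of_bool (i = a \<and> j = b)
        - r * of_bool (i = c \<and> j = d) + r * t * of_bool (i = j)"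
      using that by (simp add: sum.distrib sum_subtractf)
    finally show ?thesis by (simp add: r_def t_def)
  qed
  show ?thesis
  proof (rule eq_matI)
    fix i j assume "i < dim_row (of_bool (b = c) \<cdot>\<^sub>m slE n a d + (- of_bool (d = a)) \<cdot>\<^sub>m slE n c b)"
      and "j < dim_col (of_bool (b = c) \<cdot>\<^sub>m slE n a d + (- of_bool (d = a)) \<cdot>\<^sub>m slE n c b)"
    then have ij: "i < n" "j < n" by (simp_all add: slE_def)
    have "lie_bracket (slE n a b) (slE n c d) $$ (i, j) = (slE n a b * slE n c d) $$ (i, j) - (slE n c d * slE n a b) $$ (i, j)"
      using ij by (simp add: lie_bracket_def slE_def)
    also have "\<dots> = of_bool (i = a \<and> b = c \<and> j = d) - of_bool (i = c \<and> d = a \<and> j = b)"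
      unfolding prod[OF ij assms] prod[OF ij assms(3,4,1,2)] by (simp add: algebra_simps)
    finally show "lie_bracket (slE n a b) (slE n c d) $$ (i, j) =
        (of_bool (b = c) \<cdot>\<^sub>m slE n a d + (- of_bool (d = a)) \<cdot>\<^sub>m slE n c b) $$ (i, j)"
      using ij by (auto simp: slE_def)
  qed (auto simp: lie_bracket_def slE_def)
qed

text \<open>The matrix is approached through partial sums of its expansion in the \<^term>\<open>slE n a b\<close>.\<close>

lemma slE_expand_induct:
  assumes A: "A \<in> sl n"
    and zero: "P (0\<^sub>m n n)"
    and step: "\<And>a b c B. \<lbrakk>a < n; b < n; B \<in> sl n; P B\<rbrakk> \<Longrightarrow> P (c \<cdot>\<^sub>m slE n a b + B)"
  shows "P A"
proof -
  define B where "B S = mat n n (\<lambda>(i, j). \<Sum>(a, b)\<in>S. A $$ (a, b) * slE n a b $$ (i, j))" for S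
  have "P (B S) \<and> B S \<in> sl n" if "finite S" "S \<subseteq> {..<n} \<times> {..<n}" for S
    using that
  proof (induction S rule: finite_induct)
    case empty
    have "B {} = 0\<^sub>m n n" by (rule eq_matI) (auto simp: B_def)
    then show ?case using zero zero_sl by simp
  next
    case (insert x S)
    obtain a b where x: "x = (a, b)" by fastforce
    have "B (insert x S) = A $$ (a, b) \<cdot>\<^sub>m slE n a b + B S"
      by (rule eq_matI) (use insert in \<open>auto simp: B_def x slE_def\<close>)
    then show ?case using insert step[of a b "B S" "A $$ (a, b)"] by (auto simp: x intro: add_sl smult_sl slE_sl)
  qed
  then have "P (B ({..<n} \<times> {..<n}))" by simp
  also have "B ({..<n} \<times> {..<n}) = A"
  proof (rule eq_matI)
    fix i j assume "i < dim_row A" "j < dim_col A"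
    then have ij: "i < n" "j < n" using sl_carrier[OF A] by auto
    have "B ({..<n} \<times> {..<n}) $$ (i, j) = (\<Sum>a<n. \<Sum>b<n. A $$ (a, b) * slE n a b $$ (i, j))"
      using ij by (simp add: B_def sum.cartesian_product)
    also have "\<dots> = (\<Sum>a<n. (if a = i then A $$ (i, j) else 0) - A $$ (a, a) / of_nat n * of_bool (i = j))"
    proof (rule sum.cong[OF refl])
      fix a assume a: "a \<in> {..<n}"
      have "(\<Sum>b<n. A $$ (a, b) * slE n a b $$ (i, j)) =
          (\<Sum>b<n. (if b = j then if a = i then A $$ (i, j) else 0 else 0) - (if b = a then A $$ (a, a) / of_nat n * of_bool (i = j) else 0))"
        by (rule sum.cong) (use ij in \<open>auto simp: slE_def algebra_simps\<close>)
      then show "(\<Sum>b<n. A $$ (a, b) * slE n a b $$ (i, j)) =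
          (if a = i then A $$ (i, j) else 0) - A $$ (a, a) / of_nat n * of_bool (i = j)"
        using a ij by (simp add: sum_subtractf)
    qed
    also have "\<dots> = A $$ (i, j) - (\<Sum>a<n. A $$ (a, a)) / of_nat n * of_bool (i = j)"
      using ij by (simp add: sum_subtractf sum_divide_distrib sum_distrib_right)
    finally show "B ({..<n} \<times> {..<n}) $$ (i, j) = A $$ (i, j)" using A by (simp add: sl_def)
  qed (use sl_carrier[OF A] in \<open>auto simp: B_def\<close>)
  finally show ?thesis .
qed

locale sl_module_locale =
  fixes n :: nat and M :: "'v::ab_group_add sl_module"
  assumes sl_module: "is_sl_module n M"
begin

abbreviation V where "V \<equiv> vspace M"
abbreviation sc where "sc \<equiv> scal M"

lemma vs: "vector_space sc" using sl_module by (simp add: is_sl_module_def)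

sublocale vector_space "scal M" by (rule vs)

lemma V: "subspace V"
  and act_closed: "A \<in> sl n \<Longrightarrow> x \<in> V \<Longrightarrow> act M A x \<in> V"
  and act_add: "A \<in> sl n \<Longrightarrow> x \<in> V \<Longrightarrow> y \<in> V \<Longrightarrow> act M A (x + y) = act M A x + act M A y"
  and act_scale: "A \<in> sl n \<Longrightarrow> x \<in> V \<Longrightarrow> act M A (sc c x) = sc c (act M A x)"
  and act_add_mat: "A \<in> sl n \<Longrightarrow> B \<in> sl n \<Longrightarrow> x \<in> V \<Longrightarrow> act M (A + B) x = act M A x + act M B x"
  and act_smult: "A \<in> sl n \<Longrightarrow> x \<in> V \<Longrightarrow> act M (c \<cdot>\<^sub>m A) x = sc c (act M A x)"
  and act_bracket: "A \<in> sl n \<Longrightarrow> B \<in> sl n \<Longrightarrow> x \<in> V \<Longrightarrow>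
     act M (lie_bracket A B) x = act M A (act M B x) - act M B (act M A x)"
  using sl_module by (auto simp: is_sl_module_def)

lemma act_zero_mat: "x \<in> V \<Longrightarrow> act M (0\<^sub>m n n) x = 0"
proof -
  assume x: "x \<in> V"
  have "0 \<cdot>\<^sub>m 0\<^sub>m n n = (0\<^sub>m n n :: complex mat)" by (rule eq_matI) auto
  then show ?thesis using act_smult[OF zero_sl x, of 0] by simp
qed

text \<open>Extends the action to gl(n) by letting the identity matrix act as n \<kappa>; the scalar
  remains free and is fitted to the weight later.\<close>

definition gl_act :: "complex \<Rightarrow> nat \<Rightarrow> nat \<Rightarrow> 'v \<Rightarrow> 'v" where
  "gl_act \<kappa> a b x = act M (slE n a b) x + (if a = b then sc \<kappa> x else 0)"

lemma gl_act_closed: "a < n \<Longrightarrow> b < n \<Longrightarrow> x \<in> V \<Longrightarrow> gl_act \<kappa> a b x \<in> V"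
  by (simp add: gl_act_def act_closed slE_sl subspace_add[OF V] subspace_scale[OF V])

lemma gl_act_total:
  obtains e where "gl_module sc n e" "\<And>a b x. \<lbrakk>a < n; b < n; x \<in> V\<rbrakk> \<Longrightarrow> e a b x = gl_act \<kappa> a b x"
proof (rule gl_module_extend[OF vs V, where e = "gl_act \<kappa>" and n = n])
  show "gl_act \<kappa> a b (gl_act \<kappa> c d x) = gl_act \<kappa> c d (gl_act \<kappa> a b x) +
      (if b = c then gl_act \<kappa> a d x else 0) - (if d = a then gl_act \<kappa> c b x else 0)"
    if abcd: "a < n" "b < n" "c < n" "d < n" and x: "x \<in> V" for a b c d x
  proof -
    note E = slE_sl[OF abcd(1,2)] slE_sl[OF abcd(3,4)] slE_sl[OF abcd(1,4)] slE_sl[OF abcd(3,2)]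
    have "act M (lie_bracket (slE n a b) (slE n c d)) x =
        (if b = c then act M (slE n a d) x else 0) - (if d = a then act M (slE n c b) x else 0)"
      unfolding slE_bracket[OF abcd] by (simp add: act_add_mat act_smult smult_sl E x)
    then have "act M (slE n a b) (act M (slE n c d) x) = act M (slE n c d) (act M (slE n a b) x) +
        (if b = c then act M (slE n a d) x else 0) - (if d = a then act M (slE n c b) x else 0)"
      using act_bracket[OF E(1,2) x] by (simp add: algebra_simps)
    then show ?thesis using abcd x
      by (auto simp: gl_act_def act_add act_scale slE_sl act_closed subspace_scale[OF V] algebra_simps)
  qed
qed (auto simp: gl_act_def act_closed act_add act_scale slE_sl subspace_add[OF V] subspace_scale[OF V] scale_right_distrib algebra_simps)

lemma act_in_subspace:
  assumes "subspace W" "\<And>a b. \<lbrakk>a < n; b < n\<rbrakk> \<Longrightarrow> act M (slE n a b) x \<in> W" "A \<in> sl n" "x \<in> V"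
  shows "act M A x \<in> W"
  using assms(3)
proof (rule slE_expand_induct)
  show "act M (0\<^sub>m n n) x \<in> W" using act_zero_mat[OF assms(4)] subspace_0[OF assms(1)] by simp
  show "act M (c \<cdot>\<^sub>m slE n a b + B) x \<in> W" if "a < n" "b < n" "B \<in> sl n" "act M B x \<in> W" for a b c B
    using that assms by (simp add: act_add_mat smult_sl slE_sl act_smult subspace_add subspace_scale)
qed

subsection \<open>The action of the free algebra\<close>

abbreviation wact where "wact ws x \<equiv> foldr (act M) ws x"

lemma wact_closed: "set ws \<subseteq> sl n \<Longrightarrow> x \<in> V \<Longrightarrow> wact ws x \<in> V"
  by (induction ws) (auto simp: act_closed)

lemma wact_add: "set ws \<subseteq> sl n \<Longrightarrow> x \<in> V \<Longrightarrow> y \<in> V \<Longrightarrow> wact ws (x + y) = wact ws x + wact ws y"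
  by (induction ws) (auto simp: act_add wact_closed)

lemma wact_scale: "set ws \<subseteq> sl n \<Longrightarrow> x \<in> V \<Longrightarrow> wact ws (sc c x) = sc c (wact ws x)"
  by (induction ws) (auto simp: act_scale wact_closed)

lemma wact_0: "set ws \<subseteq> sl n \<Longrightarrow> wact ws 0 = 0"
  using wact_scale[of ws 0 0] subspace_0[OF V] by simp

lemma wact_sum:
  assumes "set ws \<subseteq> sl n" "\<And>i. i \<in> I \<Longrightarrow> f i \<in> V"
  shows "wact ws (\<Sum>i\<in>I. f i) = (\<Sum>i\<in>I. wact ws (f i))"
  using assms(2)
  by (induction I rule: infinite_finite_induct)
     (auto simp: wact_0 wact_add assms(1) subspace_sum[OF V])

lemma free_act_superset:
  assumes "finite S" "Poly_Mapping.keys f \<subseteq> S"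
  shows "free_act M f x = (\<Sum>w\<in>S. sc (Poly_Mapping.lookup f w) (wact (letters w) x))"
  unfolding free_act_def by (rule sum.mono_neutral_left) (use assms in \<open>auto simp: in_keys_iff\<close>)

lemma free_act_add: "free_act M (f + g) x = free_act M f x + free_act M g x"
proof -
  let ?S = "Poly_Mapping.keys f \<union> Poly_Mapping.keys g"
  show ?thesis
    using free_act_superset[of ?S f x] free_act_superset[of ?S g x] free_act_superset[of ?S "f + g" x] Poly_Mapping.keys_add[of f g]
    by (simp add: lookup_add scale_left_distrib sum.distrib)
qed

lemma free_act_0: "free_act M 0 x = 0"
  by (simp add: free_act_def)

lemma free_act_sum: "free_act M (\<Sum>i\<in>I. f i) x = (\<Sum>i\<in>I. free_act M (f i) x)"
  by (induction I rule: infinite_finite_induct) (auto simp: free_act_add free_act_0)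

lemma free_act_diff: "free_act M (f - g) x = free_act M f x - free_act M g x"
  using free_act_add[of "f - g" g x] by simp

lemma free_act_single: "free_act M (Poly_Mapping.single w c) x = sc c (wact (letters w) x)"
  by (simp add: free_act_def)

end

section \<open>The free algebra and its quotient, the enveloping algebra\<close>

lemma poly_mapping_sum_single:
  "f = (\<Sum>w\<in>Poly_Mapping.keys f. Poly_Mapping.single w (Poly_Mapping.lookup f w))"
  by (rule poly_mapping_eqI) (auto simp: lookup_sum lookup_single when_def in_keys_iff)

lemma free_carrier: "f \<in> carrier (free_ring n) \<longleftrightarrow> (\<forall>w\<in>Poly_Mapping.keys f. set (letters w) \<subseteq> sl n)"
  by (simp add: free_ring_def)

lemma free_ring_simps [simp]: "f \<otimes>\<^bsub>free_ring n\<^esub> g = f * g" "f \<oplus>\<^bsub>free_ring n\<^esub> g = f + g"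
  "\<one>\<^bsub>free_ring n\<^esub> = 1" "\<zero>\<^bsub>free_ring n\<^esub> = 0"
  by (simp_all add: free_ring_def)

lemma letters_plus: "letters (u + v) = letters u @ letters v" and letters_zero: "letters 0 = []"
  by (simp_all add: plus_free_mon_def zero_free_mon_def)

lemma free_add: "f \<in> carrier (free_ring n) \<Longrightarrow> g \<in> carrier (free_ring n) \<Longrightarrow> f + g \<in> carrier (free_ring n)"
  using Poly_Mapping.keys_add[of f g] by (auto simp: free_carrier)

lemma free_uminus: "f \<in> carrier (free_ring n) \<Longrightarrow> - f \<in> carrier (free_ring n)"
  by (simp add: free_carrier in_keys_iff)

lemma free_mult: "f \<in> carrier (free_ring n) \<Longrightarrow> g \<in> carrier (free_ring n) \<Longrightarrow> f * g \<in> carrier (free_ring n)"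
  using Poly_Mapping.keys_mult[of f g] by (fastforce simp: free_carrier letters_plus)

lemma free_single: "set (letters w) \<subseteq> sl n \<Longrightarrow> Poly_Mapping.single w c \<in> carrier (free_ring n)"
  by (simp add: free_carrier)

lemma free_scalar: "scalar c \<in> carrier (free_ring n)"
  by (simp add: scalar_def free_single letters_zero)

lemma free_gen: "A \<in> sl n \<Longrightarrow> gen A \<in> carrier (free_ring n)"
  by (simp add: gen_def free_single)

lemma free_one: "1 \<in> carrier (free_ring n)"
  using free_scalar[of 1] by (simp add: scalar_def)

lemma free_zero: "0 \<in> carrier (free_ring n)"
  by (simp add: free_carrier)

lemma ring_free_ring: "ring (free_ring n)"
proof (rule ringI)
  show "abelian_group (free_ring n)"
  proof (rule abelian_groupI)
    fix x assume x: "x \<in> carrier (free_ring n)"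
    show "\<exists>y\<in>carrier (free_ring n). y \<oplus>\<^bsub>free_ring n\<^esub> x = \<zero>\<^bsub>free_ring n\<^esub>"
      by (rule bexI[of _ "- x"]) (simp_all add: free_uminus x)
  qed (auto simp: free_add free_zero ac_simps)
  show "Group.monoid (free_ring n)"
    by (rule Group.monoidI) (auto simp: free_mult free_one mult.assoc)
qed (auto simp: algebra_simps)

lemma env_relations_carrier: "env_relations n \<subseteq> carrier (free_ring n)"
proof -
  have diff: "f - g \<in> carrier (free_ring n)" if "f \<in> carrier (free_ring n)" "g \<in> carrier (free_ring n)" for f g
    using free_add[OF that(1) free_uminus[OF that(2)]] by simp
  show ?thesis
    by (auto simp: env_relations_def intro!: diff free_gen free_mult free_scalar add_sl smult_sl lie_bracket_sl)
qed

lemma ideal_env_ideal: "ideal (env_ideal n) (free_ring n)"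
  unfolding env_ideal_def by (rule ring.genideal_ideal[OF ring_free_ring env_relations_carrier])

lemma ring_env_alg: "ring (env_alg n)"
  unfolding env_alg_def by (rule ideal.quotient_is_ring[OF ideal_env_ideal])

definition coset :: "nat \<Rightarrow> free_alg \<Rightarrow> free_alg set" where
  "coset n f = env_ideal n +>\<^bsub>free_ring n\<^esub> f"

lemma coset_hom: "coset n \<in> Ring.ring_hom (free_ring n) (env_alg n)"
  unfolding coset_def[abs_def] env_alg_def using ideal.rcos_ring_hom[OF ideal_env_ideal] by (simp add: eta_contract_eq)

lemma coset_simps:
  assumes "f \<in> carrier (free_ring n)" "g \<in> carrier (free_ring n)"
  shows "coset n (f + g) = coset n f \<oplus>\<^bsub>env_alg n\<^esub> coset n g"
    "coset n (f * g) = coset n f \<otimes>\<^bsub>env_alg n\<^esub> coset n g"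
  using Ring.ring_hom_add[OF coset_hom assms] Ring.ring_hom_mult[OF coset_hom assms] by simp_all

lemma coset_one: "coset n 1 = \<one>\<^bsub>env_alg n\<^esub>"
  using Ring.ring_hom_one[OF coset_hom] by simp

lemma coset_zero: "coset n 0 = \<zero>\<^bsub>env_alg n\<^esub>"
  using Ring.ring_hom_zero[OF coset_hom ring_free_ring ring_env_alg] by simp

lemma coset_closed: "f \<in> carrier (free_ring n) \<Longrightarrow> coset n f \<in> carrier (env_alg n)"
  using Ring.ring_hom_closed[OF coset_hom] .

lemma env_carrier: "carrier (env_alg n) = coset n ` carrier (free_ring n)"
  by (auto simp: env_alg_def FactRing_def A_RCOSETS_def' coset_def)

lemma coset_eq:
  assumes "f \<in> carrier (free_ring n)" "g \<in> carrier (free_ring n)" "f - g \<in> env_ideal n"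
  shows "coset n f = coset n g"
proof -
  interpret ideal "env_ideal n" "free_ring n" by (rule ideal_env_ideal)
  have "f - g \<in> carrier (free_ring n)" using free_add[OF assms(1) free_uminus[OF assms(2)]] by simp
  have "coset n (f - g) = \<zero>\<^bsub>env_alg n\<^esub>"
    using assms(3) a_rcos_zero[OF ideal_env_ideal] by (simp add: coset_def env_alg_def FactRing_def a_coset_join2)
  then have "coset n ((f - g) + g) = coset n g"
    using coset_simps(1)[OF \<open>f - g \<in> carrier (free_ring n)\<close> assms(2)] coset_closed[OF assms(2)]
    by (simp add: ring.ring_simprules[OF ring_env_alg])
  then show ?thesis by simp
qed

lemma scalar_mult: "scalar c * scalar d = scalar (c * d)" and scalar_one: "scalar 1 = 1"
  and scalar_add: "scalar c + scalar d = scalar (c + d)" and scalar_zero: "scalar 0 = 0"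
  by (simp_all add: scalar_def mult_single single_add)

lemma env_scalars_eq: "env_scalars n = (\<lambda>c. coset n (scalar c)) ` UNIV"
  by (simp add: env_scalars_def coset_def)

lemma env_linear_subspaceI:
  assumes "W \<subseteq> carrier (env_alg n)" "\<zero>\<^bsub>env_alg n\<^esub> \<in> W"
    and add: "\<And>x y. x \<in> W \<Longrightarrow> y \<in> W \<Longrightarrow> x \<oplus>\<^bsub>env_alg n\<^esub> y \<in> W"
    and smult: "\<And>c x. x \<in> W \<Longrightarrow> coset n (scalar c) \<otimes>\<^bsub>env_alg n\<^esub> x \<in> W"
  shows "subalgebra (env_scalars n) W (env_alg n)"
proof -
  interpret U: ring "env_alg n" by (rule ring_env_alg)
  have neg: "\<ominus>\<^bsub>env_alg n\<^esub> x \<in> W" if x: "x \<in> W" for x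
  proof -
    have xc: "x \<in> carrier (env_alg n)" using x assms(1) by auto
    let ?m = "coset n (scalar (- 1))"
    have m: "?m \<in> carrier (env_alg n)" by (simp add: coset_closed free_scalar)
    have "?m \<otimes>\<^bsub>env_alg n\<^esub> x \<oplus>\<^bsub>env_alg n\<^esub> x = (?m \<oplus>\<^bsub>env_alg n\<^esub> \<one>\<^bsub>env_alg n\<^esub>) \<otimes>\<^bsub>env_alg n\<^esub> x"
      using xc m by (simp add: U.l_distr)
    also have "?m \<oplus>\<^bsub>env_alg n\<^esub> \<one>\<^bsub>env_alg n\<^esub> = \<zero>\<^bsub>env_alg n\<^esub>"
      unfolding coset_one[symmetric] coset_zero[symmetric]
      by (simp add: coset_simps(1)[symmetric] free_scalar free_one scalar_one[symmetric] scalar_add scalar_zero)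
    finally have "?m \<otimes>\<^bsub>env_alg n\<^esub> x = \<ominus>\<^bsub>env_alg n\<^esub> x"
      using xc m by (simp add: U.minus_equality)
    then show ?thesis using smult[OF x, of "- 1"] by simp
  qed
  have "subgroup W (add_monoid (env_alg n))"
    by (rule U.add.subgroupI) (use assms(1,2) neg add in \<open>auto simp: a_inv_def\<close>)
  then show ?thesis
    unfolding subalgebra_def subalgebra_axioms_def env_scalars_eq using smult by auto
qed

lemma env_linear_subspaceD:
  assumes "subalgebra (env_scalars n) W (env_alg n)"
  shows "W \<subseteq> carrier (env_alg n)" "\<zero>\<^bsub>env_alg n\<^esub> \<in> W"
    "\<And>x y. x \<in> W \<Longrightarrow> y \<in> W \<Longrightarrow> x \<oplus>\<^bsub>env_alg n\<^esub> y \<in> W"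
    "\<And>x. x \<in> W \<Longrightarrow> \<ominus>\<^bsub>env_alg n\<^esub> x \<in> W"
    "\<And>c x. x \<in> W \<Longrightarrow> coset n (scalar c) \<otimes>\<^bsub>env_alg n\<^esub> x \<in> W"
proof -
  have sg: "subgroup W (add_monoid (env_alg n))" using assms by (simp add: subalgebra_def)
  show "W \<subseteq> carrier (env_alg n)" using subgroup.subset[OF sg] by simp
  show "\<zero>\<^bsub>env_alg n\<^esub> \<in> W" using subgroup.one_closed[OF sg] by simp
  show "\<And>x y. x \<in> W \<Longrightarrow> y \<in> W \<Longrightarrow> x \<oplus>\<^bsub>env_alg n\<^esub> y \<in> W" using subgroup.m_closed[OF sg] by simp
  show "\<And>x. x \<in> W \<Longrightarrow> \<ominus>\<^bsub>env_alg n\<^esub> x \<in> W" using subgroup.m_inv_closed[OF sg] by (simp add: a_inv_def)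
  show "\<And>c x. x \<in> W \<Longrightarrow> coset n (scalar c) \<otimes>\<^bsub>env_alg n\<^esub> x \<in> W"
    using subalgebra.smult_closed[OF assms] by (simp add: env_scalars_eq)
qed

lemma env_span_subspace:
  assumes "X \<subseteq> carrier (env_alg n)" shows "subalgebra (env_scalars n) (env_span n X) (env_alg n)"
proof -
  interpret U: ring "env_alg n" by (rule ring_env_alg)
  have "env_scalars n \<subseteq> carrier (env_alg n)"
    by (auto simp: env_scalars_eq coset_closed free_scalar)
  then have "subalgebra (env_scalars n) (carrier (env_alg n)) (env_alg n)"
    by (rule U.carrier_is_subalgebra)
  then have carrier: "env_span n X \<subseteq> carrier (env_alg n)"
    using assms by (auto simp: env_span_def)
  show ?thesis
  proof (rule env_linear_subspaceI[OF carrier])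
    show "\<zero>\<^bsub>env_alg n\<^esub> \<in> env_span n X"
      using env_linear_subspaceD(2) by (simp add: env_span_def)
    show "x \<oplus>\<^bsub>env_alg n\<^esub> y \<in> env_span n X" if "x \<in> env_span n X" "y \<in> env_span n X" for x y
      using that env_linear_subspaceD(3)[of n _ x y] by (simp add: env_span_def)
    show "coset n (scalar c) \<otimes>\<^bsub>env_alg n\<^esub> x \<in> env_span n X" if "x \<in> env_span n X" for c x
      using that env_linear_subspaceD(5)[of n _ x c] by (simp add: env_span_def)
  qed
qed

lemma env_span_superset: "X \<subseteq> env_span n X"
  by (auto simp: env_span_def)

lemma env_span_minimal: "subalgebra (env_scalars n) W (env_alg n) \<Longrightarrow> X \<subseteq> W \<Longrightarrow> env_span n X \<subseteq> W"
  by (auto simp: env_span_def)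

subsection \<open>The degree filtration of the enveloping algebra\<close>

definition free_deg :: "nat \<Rightarrow> nat \<Rightarrow> free_alg set" where
  "free_deg n d = {f \<in> carrier (free_ring n). \<forall>w\<in>Poly_Mapping.keys f. length (letters w) \<le> d}"

text \<open>Any finite-dimensional subspace of the enveloping algebra lies in one of these, which
  bounds its powers independently of how it was chosen.\<close>

definition env_deg :: "nat \<Rightarrow> nat \<Rightarrow> free_alg set set" where
  "env_deg n d = coset n ` free_deg n d"

lemma free_deg_carrier: "f \<in> free_deg n d \<Longrightarrow> f \<in> carrier (free_ring n)"
  by (simp add: free_deg_def)

lemma free_deg_mono: "d \<le> d' \<Longrightarrow> free_deg n d \<subseteq> free_deg n d'"
  by (auto simp: free_deg_def)

lemma env_deg_mono: "d \<le> d' \<Longrightarrow> env_deg n d \<subseteq> env_deg n d'"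
  unfolding env_deg_def by (intro image_mono free_deg_mono)

lemma free_deg_add: "f \<in> free_deg n d \<Longrightarrow> g \<in> free_deg n d \<Longrightarrow> f + g \<in> free_deg n d"
  using Poly_Mapping.keys_add[of f g] by (auto simp: free_deg_def free_add)

lemma free_deg_mult:
  assumes "f \<in> free_deg n d" "g \<in> free_deg n d'" shows "f * g \<in> free_deg n (d + d')"
proof -
  have "length (letters w) \<le> d + d'" if w: "w \<in> Poly_Mapping.keys (f * g)" for w
  proof -
    obtain u v where "w = u + v" "u \<in> Poly_Mapping.keys f" "v \<in> Poly_Mapping.keys g"
      using w Poly_Mapping.keys_mult[of f g] by blast
    then show ?thesis using assms by (auto simp: free_deg_def letters_plus intro: add_mono)
  qed
  then show ?thesis using assms by (simp add: free_deg_def free_mult)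
qed

lemma free_deg_scalar: "scalar c \<in> free_deg n d"
  by (simp add: free_deg_def free_scalar) (simp add: scalar_def letters_zero)

lemma env_deg_mult:
  assumes "x \<in> env_deg n d" "y \<in> env_deg n d'" shows "x \<otimes>\<^bsub>env_alg n\<^esub> y \<in> env_deg n (d + d')"
proof -
  obtain f g where "f \<in> free_deg n d" "x = coset n f" "g \<in> free_deg n d'" "y = coset n g"
    using assms by (auto simp: env_deg_def)
  then have "x \<otimes>\<^bsub>env_alg n\<^esub> y = coset n (f * g)" "f * g \<in> free_deg n (d + d')"
    by (simp_all add: coset_simps(2) free_deg_carrier free_deg_mult)
  then show ?thesis by (simp add: env_deg_def)
qed

lemma env_deg_scalar: "coset n (scalar c) \<in> env_deg n d"
  by (simp add: env_deg_def free_deg_scalar)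

lemma env_deg_subspace: "subalgebra (env_scalars n) (env_deg n d) (env_alg n)"
proof (rule env_linear_subspaceI)
  show "env_deg n d \<subseteq> carrier (env_alg n)"
    by (auto simp: env_deg_def coset_closed free_deg_carrier)
  show "\<zero>\<^bsub>env_alg n\<^esub> \<in> env_deg n d"
    using env_deg_scalar[of n 0 d] by (simp add: scalar_zero coset_zero)
  show "x \<oplus>\<^bsub>env_alg n\<^esub> y \<in> env_deg n d" if "x \<in> env_deg n d" "y \<in> env_deg n d" for x y
  proof -
    obtain f g where "f \<in> free_deg n d" "x = coset n f" "g \<in> free_deg n d" "y = coset n g"
      using \<open>x \<in> env_deg n d\<close> \<open>y \<in> env_deg n d\<close> by (auto simp: env_deg_def)
    then have "x \<oplus>\<^bsub>env_alg n\<^esub> y = coset n (f + g)" "f + g \<in> free_deg n d"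
      by (simp_all add: coset_simps(1) free_deg_carrier free_deg_add)
    then show ?thesis by (simp add: env_deg_def)
  qed
  show "coset n (scalar c) \<otimes>\<^bsub>env_alg n\<^esub> x \<in> env_deg n d" if "x \<in> env_deg n d" for c x
    using env_deg_mult[OF env_deg_scalar[of n c 0] that] by simp
qed

lemma env_deg_exhaust: assumes "x \<in> carrier (env_alg n)" shows "\<exists>d. x \<in> env_deg n d"
proof -
  obtain f where f: "f \<in> carrier (free_ring n)" "x = coset n f" using assms by (auto simp: env_carrier)
  have "f \<in> free_deg n (Max (insert 0 ((\<lambda>w. length (letters w)) ` Poly_Mapping.keys f)))"
    using f(1) by (auto simp: free_deg_def)
  then show ?thesis using f(2) by (auto simp: env_deg_def)
qed

lemma finite_dimension_env_deg:
  assumes "ring.finite_dimension (env_alg n) (env_scalars n) E" shows "\<exists>d. E \<subseteq> env_deg n d"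
proof -
  interpret U: ring "env_alg n" by (rule ring_env_alg)
  obtain k where "U.dimension k (env_scalars n) E" using assms by (auto simp: U.finite_dimension_def)
  then show ?thesis
  proof (induction k "env_scalars n" E rule: U.dimension.induct)
    case zero_dim
    then show ?case using env_linear_subspaceD(2)[OF env_deg_subspace] by auto
  next
    case (Suc_dim v E k)
    then obtain d d' where d: "v \<in> env_deg n d" "E \<subseteq> env_deg n d'" using env_deg_exhaust by blast
    let ?D = "max d d'"
    have v: "v \<in> env_deg n ?D" and E: "E \<subseteq> env_deg n ?D"
      using d env_deg_mono[of d ?D n] env_deg_mono[of d' ?D n] by auto
    note W = env_linear_subspaceD[OF env_deg_subspace[of n ?D]]
    have "U.line_extension (env_scalars n) v E \<subseteq> env_deg n ?D"
      using W(3,5) v E unfolding U.line_extension_def set_add_def' r_coset_def env_scalars_eq by auto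
    then show ?case by blast
  qed
qed

abbreviation env_prod :: "nat \<Rightarrow> free_alg set list \<Rightarrow> free_alg set" where
  "env_prod n us \<equiv> foldr (\<lambda>x y. x \<otimes>\<^bsub>env_alg n\<^esub> y) us \<one>\<^bsub>env_alg n\<^esub>"

lemma foldr_env_deg:
  assumes "V \<subseteq> env_deg n d" "set us \<subseteq> V"
  shows "env_prod n us \<in> env_deg n (d * length us)"
  using assms(2)
proof (induction us)
  case Nil
  show ?case using env_deg_scalar[of n 1 0] by (simp add: scalar_one coset_one)
next
  case (Cons x us)
  then show ?case using env_deg_mult[of x n d _ "d * length us"] assms(1) by auto
qed

lemma env_pow_deg:
  assumes "V \<subseteq> env_deg n d" shows "env_pow n V k \<subseteq> env_deg n (d * k)"
  unfolding env_pow_def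
proof (rule env_span_minimal[OF env_deg_subspace], safe)
  fix us assume us: "set us \<subseteq> V" "length us \<le> k"
  have "env_deg n (d * length us) \<subseteq> env_deg n (d * k)" using us(2) by (intro env_deg_mono) simp
  then show "env_prod n us \<in> env_deg n (d * k)"
    using foldr_env_deg[OF assms us(1)] by blast
qed

definition env_prods :: "nat \<Rightarrow> free_alg set set \<Rightarrow> nat \<Rightarrow> free_alg set set" where
  "env_prods n V k = {env_prod n us | us. set us \<subseteq> V \<and> length us \<le> k}"

lemma env_pow_eq: "env_pow n V k = env_span n (env_prods n V k)"
  by (simp add: env_pow_def env_prods_def)

lemma foldr_env_closed:
  "set us \<subseteq> carrier (env_alg n) \<Longrightarrow> env_prod n us \<in> carrier (env_alg n)"
proof -
  interpret U: ring "env_alg n" by (rule ring_env_alg)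
  show "set us \<subseteq> carrier (env_alg n) \<Longrightarrow> env_prod n us \<in> carrier (env_alg n)"
    by (induction us) auto
qed

context
  fixes n V assumes V: "V \<subseteq> carrier (env_alg n)"
begin

interpretation U: ring "env_alg n" by (rule ring_env_alg)

lemma env_prods_carrier: "env_prods n V k \<subseteq> carrier (env_alg n)"
  using V foldr_env_closed unfolding env_prods_def by blast

lemma env_pow_subspace: "subalgebra (env_scalars n) (env_pow n V k) (env_alg n)"
  unfolding env_pow_eq by (rule env_span_subspace[OF env_prods_carrier])

lemmas env_pow_carrier = env_linear_subspaceD(1)[OF env_pow_subspace]

lemma env_prods_mult:
  assumes "x \<in> env_prods n V k" "y \<in> env_prods n V l"
  shows "x \<otimes>\<^bsub>env_alg n\<^esub> y \<in> env_prods n V (k + l)"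
proof -
  obtain us where us: "x = env_prod n us" "set us \<subseteq> V" "length us \<le> k"
    using assms(1) by (auto simp: env_prods_def)
  obtain vs where vs: "y = env_prod n vs" "set vs \<subseteq> V" "length vs \<le> l"
    using assms(2) by (auto simp: env_prods_def)
  have y: "y \<in> carrier (env_alg n)" using assms(2) env_prods_carrier by auto
  have "env_prod n ws \<otimes>\<^bsub>env_alg n\<^esub> y = foldr (\<lambda>x y. x \<otimes>\<^bsub>env_alg n\<^esub> y) ws y"
    if "set ws \<subseteq> V" for ws
    using that
  proof (induction ws)
    case (Cons w ws)
    then have "w \<in> carrier (env_alg n)" "env_prod n ws \<in> carrier (env_alg n)"
      using V foldr_env_closed[of ws] by auto
    then show ?case using Cons y by (simp add: U.m_assoc)
  qed (use y in simp)
  then have "x \<otimes>\<^bsub>env_alg n\<^esub> y = env_prod n (us @ vs)"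
    using us(1,2) vs(1) by simp
  moreover have "set (us @ vs) \<subseteq> V" "length (us @ vs) \<le> k + l" using us vs by auto
  ultimately show ?thesis unfolding env_prods_def by blast
qed

text \<open>Bilinearity is used in two passes: first the right factor runs through the span while
  the left one is a product, then the left one runs through its span. The first pass needs scalars
  to commute with everything (\<open>comm\<close>).\<close>

lemma env_pow_mult:
  assumes x: "x \<in> env_pow n V k" and y: "y \<in> env_pow n V l"
  shows "x \<otimes>\<^bsub>env_alg n\<^esub> y \<in> env_pow n V (k + l)"
proof -
  note W = env_linear_subspaceD[OF env_pow_subspace[of "k + l"]]
  have 1: "x \<otimes>\<^bsub>env_alg n\<^esub> y \<in> env_pow n V (k + l)" if x: "x \<in> env_prods n V k" and y: "y \<in> env_pow n V l" for x y
  proof -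
    have xc: "x \<in> carrier (env_alg n)" using x env_prods_carrier by auto
    have comm: "x \<otimes>\<^bsub>env_alg n\<^esub> (coset n (scalar c) \<otimes>\<^bsub>env_alg n\<^esub> z) = coset n (scalar c) \<otimes>\<^bsub>env_alg n\<^esub> (x \<otimes>\<^bsub>env_alg n\<^esub> z)"
      if zc: "z \<in> carrier (env_alg n)" for c z
    proof -
      obtain f where f: "f \<in> carrier (free_ring n)" "x = coset n f" using xc by (auto simp: env_carrier)
      have "f * scalar c = scalar c * f"
      proof -
        have "f * scalar c = (\<Sum>w\<in>Poly_Mapping.keys f. Poly_Mapping.single w (Poly_Mapping.lookup f w)) * scalar c"
          using poly_mapping_sum_single[of f] by simp
        also have "\<dots> = scalar c * (\<Sum>w\<in>Poly_Mapping.keys f. Poly_Mapping.single w (Poly_Mapping.lookup f w))"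
          by (simp add: sum_distrib_left sum_distrib_right scalar_def mult_single mult.commute)
        finally show ?thesis using poly_mapping_sum_single[of f] by simp
      qed
      then have "x \<otimes>\<^bsub>env_alg n\<^esub> coset n (scalar c) = coset n (scalar c) \<otimes>\<^bsub>env_alg n\<^esub> x"
        using f by (metis coset_simps(2) free_scalar)
      then show ?thesis using xc zc by (simp add: U.m_assoc[symmetric] coset_closed free_scalar)
    qed
    have "env_pow n V l \<subseteq> {y \<in> carrier (env_alg n). x \<otimes>\<^bsub>env_alg n\<^esub> y \<in> env_pow n V (k + l)}"
      unfolding env_pow_eq[of n V l]
    proof (rule env_span_minimal[OF env_linear_subspaceI])
      show "env_prods n V l \<subseteq> {y \<in> carrier (env_alg n). x \<otimes>\<^bsub>env_alg n\<^esub> y \<in> env_pow n V (k + l)}"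
        using env_prods_mult[OF x] env_prods_carrier env_span_superset[of "env_prods n V (k + l)" n]
        by (auto simp: env_pow_eq)
    qed (use W xc comm in \<open>auto simp: U.r_distr coset_closed free_scalar\<close>)
    then show ?thesis using y by auto
  qed
  have "env_pow n V k \<subseteq> {x \<in> carrier (env_alg n). x \<otimes>\<^bsub>env_alg n\<^esub> y \<in> env_pow n V (k + l)}"
    unfolding env_pow_eq[of n V k]
  proof (rule env_span_minimal[OF env_linear_subspaceI])
    have yc: "y \<in> carrier (env_alg n)" using y env_pow_carrier by auto
    show "env_prods n V k \<subseteq> {x \<in> carrier (env_alg n). x \<otimes>\<^bsub>env_alg n\<^esub> y \<in> env_pow n V (k + l)}"
      using 1[OF _ y] env_prods_carrier by auto
    show "a \<oplus>\<^bsub>env_alg n\<^esub> b \<in> {x \<in> carrier (env_alg n). x \<otimes>\<^bsub>env_alg n\<^esub> y \<in> env_pow n V (k + l)}"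
      if "a \<in> {x \<in> carrier (env_alg n). x \<otimes>\<^bsub>env_alg n\<^esub> y \<in> env_pow n V (k + l)}"
        "b \<in> {x \<in> carrier (env_alg n). x \<otimes>\<^bsub>env_alg n\<^esub> y \<in> env_pow n V (k + l)}" for a b
      using that W yc by (auto simp: U.l_distr)
    show "coset n (scalar c) \<otimes>\<^bsub>env_alg n\<^esub> a \<in> {x \<in> carrier (env_alg n). x \<otimes>\<^bsub>env_alg n\<^esub> y \<in> env_pow n V (k + l)}"
      if "a \<in> {x \<in> carrier (env_alg n). x \<otimes>\<^bsub>env_alg n\<^esub> y \<in> env_pow n V (k + l)}" for a c
      using that W yc by (auto simp: U.m_assoc coset_closed free_scalar)
    show "\<zero>\<^bsub>env_alg n\<^esub> \<in> {x \<in> carrier (env_alg n). x \<otimes>\<^bsub>env_alg n\<^esub> y \<in> env_pow n V (k + l)}"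
      using W yc by auto
  qed auto
  then show ?thesis using x by auto
qed

lemma env_pow_mono: "k \<le> l \<Longrightarrow> env_pow n V k \<subseteq> env_pow n V l"
proof -
  assume "k \<le> l"
  then have "env_prods n V k \<subseteq> env_prods n V l"
    unfolding env_prods_def using order_trans by blast
  then have "env_prods n V k \<subseteq> env_pow n V l"
    unfolding env_pow_eq using env_span_superset by (rule order_trans)
  then show ?thesis
    unfolding env_pow_eq[of n V k] by (rule env_span_minimal[OF env_pow_subspace])
qed

lemma env_pow_base: "x \<in> V \<Longrightarrow> x \<in> env_pow n V 1"
proof -
  assume x: "x \<in> V"
  then have "x \<in> env_prods n V 1" unfolding env_prods_def using V by (auto intro!: exI[of _ "[x]"])
  then show ?thesis unfolding env_pow_eq using env_span_superset by blast
qed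

lemma env_pow_scalar: "coset n (scalar c) \<in> env_pow n V k"
proof -
  have "\<one>\<^bsub>env_alg n\<^esub> \<in> env_prods n V k" unfolding env_prods_def by (auto intro!: exI[of _ "[]"])
  then have "\<one>\<^bsub>env_alg n\<^esub> \<in> env_pow n V k" unfolding env_pow_eq using env_span_superset by blast
  then have "coset n (scalar c) \<otimes>\<^bsub>env_alg n\<^esub> \<one>\<^bsub>env_alg n\<^esub> \<in> env_pow n V k"
    by (rule env_linear_subspaceD(5)[OF env_pow_subspace])
  then show ?thesis by (simp add: coset_closed free_scalar)
qed

text \<open>The union of the powers is a subring containing the scalars and
  \<open>V\<close>.\<close>

lemma env_pow_exhaust:
  assumes gen: "\<And>S. subring S (env_alg n) \<Longrightarrow> env_scalars n \<subseteq> S \<Longrightarrow> V \<subseteq> S \<Longrightarrow> S = carrier (env_alg n)"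
    and x: "x \<in> carrier (env_alg n)"
  shows "\<exists>k. x \<in> env_pow n V k"
proof -
  let ?S = "\<Union>k. env_pow n V k"
  have "subring ?S (env_alg n)"
  proof (rule U.subringI)
    show "?S \<subseteq> carrier (env_alg n)" using env_pow_carrier by auto
    show "\<one>\<^bsub>env_alg n\<^esub> \<in> ?S" using env_pow_scalar[of 1] by (auto simp: scalar_one coset_one)
    show "\<ominus>\<^bsub>env_alg n\<^esub> h \<in> ?S" if "h \<in> ?S" for h
      using that env_linear_subspaceD(4)[OF env_pow_subspace] by blast
    show "h1 \<otimes>\<^bsub>env_alg n\<^esub> h2 \<in> ?S" if "h1 \<in> ?S" "h2 \<in> ?S" for h1 h2
      using that env_pow_mult by blast
    show "h1 \<oplus>\<^bsub>env_alg n\<^esub> h2 \<in> ?S" if h: "h1 \<in> ?S" "h2 \<in> ?S" for h1 h2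
    proof -
      obtain k l where "h1 \<in> env_pow n V k" "h2 \<in> env_pow n V l" using h by auto
      then have "h1 \<in> env_pow n V (max k l)" "h2 \<in> env_pow n V (max k l)"
        using env_pow_mono[of k "max k l"] env_pow_mono[of l "max k l"] by auto
      then show ?thesis using env_linear_subspaceD(3)[OF env_pow_subspace] by blast
    qed
  qed
  moreover have "env_scalars n \<subseteq> ?S" using env_pow_scalar by (auto simp: env_scalars_eq)
  moreover have "V \<subseteq> ?S" using env_pow_base by blast
  ultimately have "?S = carrier (env_alg n)" by (rule gen)
  then show ?thesis using x by blast
qed

end

section \<open>Growth rates\<close>

definition growth :: "(nat \<Rightarrow> nat) \<Rightarrow> ereal" where
  "growth f = limsup (\<lambda>k. ereal (ln (real (f k)) / ln (real k)))"

text \<open>The default values \<open>ln 0 = 0\<close> and \<open>x / 0 = 0\<close> take care of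
  \<open>f k = 0\<close> and of k = 0 and k = 1.\<close>

lemma growth_nonneg: "growth f \<ge> 0"
proof -
  have "ln (real (f k)) / ln (real k) \<ge> 0" for k
    by (cases "f k = 0"; cases "k = 0") (auto intro!: divide_nonneg_nonneg ln_ge_zero)
  then show ?thesis unfolding growth_def
    by (intro le_Limsup) (auto intro!: always_eventually)
qed

text \<open>The constant C contributes ln C / ln k, which tends to 0, and ln (a k + d) / ln k tends
  to 1.\<close>

lemma growth_le:
  assumes le: "\<And>k. f k \<le> C * g (a * k + d)" and a: "a \<ge> 1" and C: "C \<ge> 1"
  shows "growth f \<le> growth g"
proof (rule ereal_le_real)
  fix r assume "growth g \<le> ereal r"
  show "growth f \<le> ereal r"
  proof (rule ereal_le_epsilon2)
      fix \<epsilon> :: real assume "\<epsilon> > 0"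
      \<comment> \<open>Strictly above the growth of g, so that it bounds the quotients eventually,
        and hence positive, which makes the bound valid also where \<open>f k = 0\<close>.\<close>
      define s where "s = r + \<epsilon>"
      have gs: "growth g < ereal s" using \<open>growth g \<le> ereal r\<close> \<open>\<epsilon> > 0\<close>
        unfolding s_def by (metis ereal_less_eq(3) le_add_same_cancel1 less_add_same_cancel1 less_ereal.simps(1) order_le_less_trans)
      then have s: "s > 0" using growth_nonneg[of g] by (metis ereal_less(2) order_le_less_trans)
      have "\<forall>\<^sub>F j in sequentially. ereal (ln (real (g j)) / ln (real j)) < ereal s"
        using gs unfolding growth_def by (rule Limsup_lessD)
      moreover have "filterlim (\<lambda>k. a * k + d) sequentially sequentially"
        using a by (intro filterlim_at_top_mono[OF filterlim_ident] always_eventually) (auto simp: trans_le_add1)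
      ultimately have ev: "\<forall>\<^sub>F k in sequentially. ereal (ln (real (g (a * k + d))) / ln (real (a * k + d))) < ereal s"
        by (rule eventually_compose_filterlim)
      have "growth f \<le> limsup (\<lambda>k. ereal ((ln (real C) + s * ln (real a * real k + real d)) / ln (real k)))"
        unfolding growth_def
      proof (rule Limsup_mono)
        show "\<forall>\<^sub>F k in sequentially. ereal (ln (real (f k)) / ln (real k))
            \<le> ereal ((ln (real C) + s * ln (real a * real k + real d)) / ln (real k))"
          using ev eventually_gt_at_top[of 1]
        proof eventually_elim
          case (elim k)
          have big: "a * k + d > 1" using elim(2) a by (metis less_le_trans mult_le_mono1 nat_mult_1 trans_less_add1)
          have "ln (real (g (a * k + d))) < s * ln (real (a * k + d))"
          proof -
            have "ln (real (a * k + d)) > 0" using big by (intro ln_gt_zero) linarith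
            then show ?thesis using elim(1) by (simp only: less_ereal.simps pos_divide_less_eq)
          qed
          have "ln (real (f k)) \<le> ln (real C) + s * ln (real a * real k + real d)"
          proof (cases "f k = 0")
            case True
            then show ?thesis using C s big
              by (auto intro!: add_nonneg_nonneg mult_nonneg_nonneg ln_ge_zero simp flip: of_nat_mult of_nat_add)
          next
            case False
            then have pos: "g (a * k + d) > 0" using le[of k] by (metis mult_0_right not_gr_zero le_zero_eq)
            have "ln (real (f k)) \<le> ln (real (C * g (a * k + d)))"
              using False le[of k] pos C by (subst ln_le_cancel_iff) (auto simp del: of_nat_mult)
            also have "\<dots> = ln (real C) + ln (real (g (a * k + d)))"
              using pos C by (simp add: ln_mult)
            finally show ?thesis
              using \<open>ln (real (g (a * k + d))) < s * ln (real (a * k + d))\<close> by simp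
          qed
          then show ?case using elim(2) by (simp add: divide_right_mono)
        qed
      qed
      also have "\<dots> = ereal s"
      proof (rule lim_imp_Limsup)
        have "real a > 0" using a by simp
        then have "(\<lambda>k. (ln (real C) + s * ln (real a * real k + real d)) / ln (real k)) \<longlonglongrightarrow> s"
          by real_asymp
        then show "(\<lambda>k. ereal ((ln (real C) + s * ln (real a * real k + real d)) / ln (real k))) \<longlonglongrightarrow> ereal s"
          by simp
      qed simp
      finally show "growth f \<le> ereal r + ereal \<epsilon>" by (simp add: s_def)
  qed
qed

lemma growth_one: "growth (\<lambda>_. 1) = 0"
  by (simp add: growth_def Limsup_const zero_ereal_def)

lemma growth_power: "growth (\<lambda>k. Suc k ^ N) = ereal (real N)"
  unfolding growth_def
proof (rule lim_imp_Limsup)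
  have "(\<lambda>k. real N * ln (real k + 1) / ln (real k)) \<longlonglongrightarrow> real N"
    by real_asymp
  then show "(\<lambda>k. ereal (ln (real (Suc k ^ N)) / ln (real k))) \<longlonglongrightarrow> ereal (real N)"
    by (simp add: ln_realpow add.commute)
qed simp

section \<open>The action of the enveloping algebra on a module\<close>

context sl_module_locale
begin

lemma free_act_closed: "f \<in> carrier (free_ring n) \<Longrightarrow> x \<in> V \<Longrightarrow> free_act M f x \<in> V"
  unfolding free_act_def free_carrier
  by (intro subspace_sum[OF V] subspace_scale[OF V] wact_closed) auto

lemma free_act_mult:
  assumes f: "f \<in> carrier (free_ring n)" and g: "g \<in> carrier (free_ring n)" and x: "x \<in> V"
  shows "free_act M (f * g) x = free_act M f (free_act M g x)"
proof -
  let ?f = "Poly_Mapping.lookup f" and ?g = "Poly_Mapping.lookup g"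
  have "f * g = (\<Sum>w\<in>Poly_Mapping.keys f. Poly_Mapping.single w (?f w)) * (\<Sum>u\<in>Poly_Mapping.keys g. Poly_Mapping.single u (?g u))"
    using poly_mapping_sum_single[of f] poly_mapping_sum_single[of g] by simp
  also have "\<dots> = (\<Sum>w\<in>Poly_Mapping.keys f. \<Sum>u\<in>Poly_Mapping.keys g. Poly_Mapping.single (w + u) (?f w * ?g u))"
    by (simp add: sum_product mult_single)
  finally have "free_act M (f * g) x = (\<Sum>w\<in>Poly_Mapping.keys f. \<Sum>u\<in>Poly_Mapping.keys g.
      sc (?f w * ?g u) (wact (letters w) (wact (letters u) x)))"
    by (simp add: free_act_sum free_act_single letters_plus)
  also have "\<dots> = (\<Sum>w\<in>Poly_Mapping.keys f. sc (?f w) (wact (letters w) (free_act M g x)))"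
  proof (rule sum.cong[OF refl])
    fix w assume "w \<in> Poly_Mapping.keys f"
    then have w: "set (letters w) \<subseteq> sl n" using f by (simp add: free_carrier)
    have "wact (letters w) (free_act M g x) = (\<Sum>u\<in>Poly_Mapping.keys g. wact (letters w) (sc (?g u) (wact (letters u) x)))"
      unfolding free_act_def
      by (rule wact_sum[OF w]) (use g x in \<open>auto simp: free_carrier intro!: subspace_scale[OF V] wact_closed\<close>)
    also have "\<dots> = (\<Sum>u\<in>Poly_Mapping.keys g. sc (?g u) (wact (letters w) (wact (letters u) x)))"
      by (rule sum.cong[OF refl], rule wact_scale[OF w]) (use g x in \<open>auto simp: free_carrier intro!: wact_closed\<close>)
    finally show "(\<Sum>u\<in>Poly_Mapping.keys g. sc (?f w * ?g u) (wact (letters w) (wact (letters u) x))) =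
        sc (?f w) (wact (letters w) (free_act M g x))"
      by (simp add: scale_sum_right)
  qed
  also have "\<dots> = free_act M f (free_act M g x)" by (simp add: free_act_def)
  finally show ?thesis .
qed

lemma free_act_gen: "free_act M (gen A) x = act M A x"
  by (simp add: gen_def free_act_single)

lemma free_act_scalar: "free_act M (scalar c) x = sc c x"
  by (simp add: scalar_def free_act_single letters_zero)

lemma free_act_arg_0: "f \<in> carrier (free_ring n) \<Longrightarrow> free_act M f 0 = 0"
  by (simp add: free_act_def free_carrier wact_0)

text \<open>The elements that act as zero on the whole module form a two-sided ideal, and the module
  axioms say that it contains the defining relations.\<close>

lemma env_ideal_annihilates:
  assumes "f \<in> env_ideal n" "x \<in> V" shows "free_act M f x = 0"
proof -
  interpret R: ring "free_ring n" by (rule ring_free_ring)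
  let ?K = "{f \<in> carrier (free_ring n). \<forall>x\<in>V. free_act M f x = 0}"
  have neg: "\<ominus>\<^bsub>free_ring n\<^esub> f = - f" if "f \<in> carrier (free_ring n)" for f
    using R.minus_equality[of "- f" f] that free_uminus[OF that] by simp
  have "ideal ?K (free_ring n)"
  proof (rule idealI[OF ring_free_ring])
    show "subgroup ?K (add_monoid (free_ring n))"
    proof (rule R.add.subgroupI)
      show "?K \<noteq> {}" using free_zero free_act_0 by blast
      show "\<ominus>\<^bsub>free_ring n\<^esub> f \<in> ?K" if "f \<in> ?K" for f
      proof -
        have f: "f \<in> carrier (free_ring n)" "\<And>x. x \<in> V \<Longrightarrow> free_act M f x = 0" using that by auto
        show ?thesis unfolding neg[OF f(1)]
          using free_uminus[OF f(1)] f(2) free_act_diff[of 0 f] by (simp add: free_act_0)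
      qed
    qed (auto simp: free_add free_act_add)
  qed (auto simp: free_mult free_act_mult free_act_arg_0 free_act_closed)
  moreover have "env_relations n \<subseteq> ?K"
  proof
    fix r assume r: "r \<in> env_relations n"
    then have "r \<in> carrier (free_ring n)" using env_relations_carrier by blast
    moreover have "free_act M r x = 0" if "x \<in> V" for x
      using r that unfolding env_relations_def
      by (auto simp: free_act_diff free_act_gen free_act_mult free_gen free_scalar free_act_scalar
          act_add_mat act_smult act_bracket)
    ultimately show "r \<in> ?K" by simp
  qed
  ultimately have "env_ideal n \<subseteq> ?K"
    unfolding env_ideal_def by (rule R.genideal_minimal)
  then show ?thesis using assms by blast
qed

lemma env_act_coset:
  assumes "f \<in> carrier (free_ring n)" "x \<in> V" shows "env_act M (coset n f) x = free_act M f x"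
proof -
  interpret I: ideal "env_ideal n" "free_ring n" by (rule ideal_env_ideal)
  have "f \<in> coset n f"
    using I.a_rcos_self[OF assms(1)] by (simp add: coset_def)
  then have "(SOME g. g \<in> coset n f) \<in> coset n f" by (rule someI)
  then obtain h where "h \<in> env_ideal n" "(SOME g. g \<in> coset n f) = h + f"
    by (auto simp: coset_def a_r_coset_def')
  then show ?thesis using env_ideal_annihilates[OF _ assms(2)] by (simp add: env_act_def free_act_add)
qed

lemma env_act_mult:
  assumes "X \<in> carrier (env_alg n)" "Y \<in> carrier (env_alg n)" "x \<in> V"
  shows "env_act M (X \<otimes>\<^bsub>env_alg n\<^esub> Y) x = env_act M X (env_act M Y x)"
proof -
  obtain f g where "f \<in> carrier (free_ring n)" "X = coset n f" "g \<in> carrier (free_ring n)" "Y = coset n g"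
    using assms by (auto simp: env_carrier)
  then show ?thesis using assms(3)
    by (simp add: coset_simps(2)[symmetric] env_act_coset free_mult free_act_mult free_act_closed)
qed

lemma env_act_closed: "X \<in> carrier (env_alg n) \<Longrightarrow> x \<in> V \<Longrightarrow> env_act M X x \<in> V"
  by (auto simp: env_carrier env_act_coset free_act_closed)

lemma env_act_gen: "A \<in> sl n \<Longrightarrow> x \<in> V \<Longrightarrow> env_act M (coset n (gen A)) x = act M A x"
  by (simp add: env_act_coset free_gen free_act_gen)

lemma env_act_one: "x \<in> V \<Longrightarrow> env_act M (coset n (scalar 1)) x = x"
  by (simp add: env_act_coset free_scalar free_act_scalar)

text \<open>Makes the complex scalars a subfield of the enveloping algebra, which gives access to
  the library's dimension theory.\<close>

lemma env_alg_nontrivial: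
  assumes "x \<in> V" "x \<noteq> 0" shows "\<one>\<^bsub>env_alg n\<^esub> \<noteq> \<zero>\<^bsub>env_alg n\<^esub>"
proof
  assume "\<one>\<^bsub>env_alg n\<^esub> = \<zero>\<^bsub>env_alg n\<^esub>"
  then have "coset n (scalar 1) = coset n (scalar 0)"
    by (simp add: scalar_one scalar_zero coset_one coset_zero)
  then have "x = sc 0 x"
    using env_act_coset[OF free_scalar assms(1), of 0] env_act_one[OF assms(1)] by (simp add: free_act_scalar)
  then show False using assms(2) by simp
qed

end

lemma subfield_env_scalars:
  assumes "\<one>\<^bsub>env_alg n\<^esub> \<noteq> \<zero>\<^bsub>env_alg n\<^esub>" shows "subfield (env_scalars n) (env_alg n)"
proof -
  interpret U: ring "env_alg n" by (rule ring_env_alg)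
  let ?c = "\<lambda>c. coset n (scalar c)"
  have closed: "?c c \<in> carrier (env_alg n)" for c by (simp add: coset_closed free_scalar)
  have mult: "?c c \<otimes>\<^bsub>env_alg n\<^esub> ?c d = ?c (c * d)" for c d
    by (simp add: coset_simps(2)[symmetric] free_scalar scalar_mult)
  have add: "?c c \<oplus>\<^bsub>env_alg n\<^esub> ?c d = ?c (c + d)" for c d
    by (simp add: coset_simps(1)[symmetric] free_scalar scalar_add)
  have one: "?c 1 = \<one>\<^bsub>env_alg n\<^esub>" and zero: "?c 0 = \<zero>\<^bsub>env_alg n\<^esub>"
    by (simp_all add: scalar_one scalar_zero coset_one coset_zero)
  have neg: "\<ominus>\<^bsub>env_alg n\<^esub> ?c c = ?c (- c)" for c
    using U.minus_equality[of "?c (- c)" "?c c"] closed add zero by simp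
  show ?thesis
  proof (rule U.subfieldI)
    show "subcring (env_scalars n) (env_alg n)"
    proof (rule U.subcringI[OF U.subringI])
      show "\<one>\<^bsub>env_alg n\<^esub> \<in> env_scalars n" unfolding one[symmetric] env_scalars_eq by blast
    qed (auto simp: env_scalars_eq closed mult add neg mult.commute)
    show "Units (env_alg n\<lparr>carrier := env_scalars n\<rparr>) = env_scalars n - {\<zero>\<^bsub>env_alg n\<^esub>}"
    proof (intro equalityI subsetI)
      fix x assume "x \<in> Units (env_alg n\<lparr>carrier := env_scalars n\<rparr>)"
      then obtain y where "x \<in> env_scalars n" "y \<in> env_scalars n" "y \<otimes>\<^bsub>env_alg n\<^esub> x = \<one>\<^bsub>env_alg n\<^esub>"
        by (auto simp: Units_def)
      then show "x \<in> env_scalars n - {\<zero>\<^bsub>env_alg n\<^esub>}" using assms closed by (auto simp: env_scalars_eq)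
    next
      fix x assume "x \<in> env_scalars n - {\<zero>\<^bsub>env_alg n\<^esub>}"
      then obtain c where c: "x = ?c c" "c \<noteq> 0" by (auto simp: env_scalars_eq zero[symmetric])
      have "?c (inverse c) \<in> env_scalars n" "x \<in> env_scalars n" by (auto simp: env_scalars_eq c)
      moreover have "?c (inverse c) \<otimes>\<^bsub>env_alg n\<^esub> x = \<one>\<^bsub>env_alg n\<^esub>" "x \<otimes>\<^bsub>env_alg n\<^esub> ?c (inverse c) = \<one>\<^bsub>env_alg n\<^esub>"
        using c(2) by (simp_all add: c(1) mult one)
      ultimately show "x \<in> Units (env_alg n\<lparr>carrier := env_scalars n\<rparr>)" by (auto simp: Units_def)
    qed
  qed
qed

lemma env_generated_by_slE:
  assumes S: "subring S (env_alg n)" "env_scalars n \<subseteq> S"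
    and gens: "\<And>a b. a < n \<Longrightarrow> b < n \<Longrightarrow> coset n (gen (slE n a b)) \<in> S"
  shows "S = carrier (env_alg n)"
proof -
  interpret U: ring "env_alg n" by (rule ring_env_alg)
  note closed = subringE[OF S(1)]
  have scal: "coset n (scalar c) \<in> S" for c using S(2) by (auto simp: env_scalars_eq)
  have rel: "env_relations n \<subseteq> env_ideal n"
    unfolding env_ideal_def by (rule ring.genideal_self[OF ring_free_ring env_relations_carrier])
  have rel_add: "gen (A + B) - gen A - gen B \<in> env_ideal n" if "A \<in> sl n" "B \<in> sl n" for A B
    using rel that unfolding env_relations_def by blast
  have rel_smult: "gen (c \<cdot>\<^sub>m A) - scalar c * gen A \<in> env_ideal n" if "A \<in> sl n" for c A
    using rel that unfolding env_relations_def by blast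
  have gen: "coset n (gen A) \<in> S" if "A \<in> sl n" for A
    using that
  proof (rule slE_expand_induct)
    have "gen (0 \<cdot>\<^sub>m 0\<^sub>m n n) - scalar 0 * gen (0\<^sub>m n n) \<in> env_ideal n"
      by (rule rel_smult[OF zero_sl])
    moreover have "0 \<cdot>\<^sub>m 0\<^sub>m n n = (0\<^sub>m n n :: complex mat)" by (rule eq_matI) auto
    ultimately have "gen (0\<^sub>m n n) - 0 \<in> env_ideal n" by (simp add: scalar_zero)
    then have "coset n (gen (0\<^sub>m n n)) = coset n 0"
      by (rule coset_eq[OF free_gen[OF zero_sl] free_zero])
    then show "coset n (gen (0\<^sub>m n n)) \<in> S" using scal[of 0] by (simp add: scalar_zero)
  next
    fix a b c B assume ab: "a < n" "b < n" and B: "B \<in> sl n" "coset n (gen B) \<in> S"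
    note E = slE_sl[OF ab]
    have "gen (c \<cdot>\<^sub>m slE n a b + B) - gen (c \<cdot>\<^sub>m slE n a b) - gen B \<in> env_ideal n"
      by (rule rel_add[OF smult_sl[OF E] B(1)])
    then have "coset n (gen (c \<cdot>\<^sub>m slE n a b + B)) = coset n (gen (c \<cdot>\<^sub>m slE n a b) + gen B)"
      using E B by (intro coset_eq) (simp_all add: free_gen add_sl smult_sl free_add diff_diff_eq)
    also have "\<dots> = coset n (gen (c \<cdot>\<^sub>m slE n a b)) \<oplus>\<^bsub>env_alg n\<^esub> coset n (gen B)"
      using E B by (simp add: coset_simps free_gen smult_sl)
    also have "coset n (gen (c \<cdot>\<^sub>m slE n a b)) = coset n (scalar c * gen (slE n a b))"
    proof (rule coset_eq)
      show "gen (c \<cdot>\<^sub>m slE n a b) - scalar c * gen (slE n a b) \<in> env_ideal n"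
        by (rule rel_smult[OF E])
    qed (use E in \<open>auto simp: free_gen smult_sl free_mult free_scalar\<close>)
    also have "\<dots> = coset n (scalar c) \<otimes>\<^bsub>env_alg n\<^esub> coset n (gen (slE n a b))"
      using E by (simp add: coset_simps free_gen free_scalar)
    finally show "coset n (gen (c \<cdot>\<^sub>m slE n a b + B)) \<in> S"
      using closed(6,7) scal gens[OF ab] B by simp
  qed
  have word: "coset n (Poly_Mapping.single (FM ws) 1) \<in> S" if "set ws \<subseteq> sl n" for ws
    using that
  proof (induction ws)
    case Nil
    show ?case using scal[of 1] by (simp add: scalar_def zero_free_mon_def)
  next
    case (Cons A ws)
    have "Poly_Mapping.single (FM (A # ws)) (1::complex) = gen A * Poly_Mapping.single (FM ws) 1"
      by (simp add: gen_def mult_single plus_free_mon_def)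
    then show ?case using Cons gen[of A] closed(6)
      by (simp add: coset_simps free_gen free_single)
  qed
  have "coset n f \<in> S" if f: "f \<in> carrier (free_ring n)" for f
  proof -
    have single_in: "coset n (Poly_Mapping.single w c) \<in> S" if "set (letters w) \<subseteq> sl n" for w c
    proof -
      have "Poly_Mapping.single w c = scalar c * Poly_Mapping.single (FM (letters w)) 1"
        by (simp add: scalar_def mult_single)
      then show ?thesis using word[OF that] scal[of c] closed(6)
        by (simp add: coset_simps free_scalar free_single that)
    qed
    have "coset n (\<Sum>w\<in>W. Poly_Mapping.single w (g w)) \<in> S \<and> (\<Sum>w\<in>W. Poly_Mapping.single w (g w)) \<in> carrier (free_ring n)"
      if "finite W" "\<forall>w\<in>W. set (letters w) \<subseteq> sl n" for W g
      using that
    proof (induction W rule: finite_induct)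
      case empty
      show ?case using scal[of 0] by (simp add: scalar_zero free_zero)
    next
      case (insert w W)
      then show ?case using single_in[of w "g w"] closed(7)
        by (simp add: coset_simps free_single free_add)
    qed
    from this[of "Poly_Mapping.keys f" "Poly_Mapping.lookup f"] show ?thesis
      using f poly_mapping_sum_single[of f] by (simp add: free_carrier)
  qed
  then show ?thesis using closed(1) by (auto simp: env_carrier)
qed

section \<open>Gelfand-Kirillov dimension of a cyclic module\<close>

context sl_module_locale
begin

context
  fixes v \<kappa> e
  assumes v: "v \<in> V" "v \<noteq> 0" and gen: "generates_module n M {v}"
    and G: "gl_module sc n e"
    and e_eq: "\<And>a b x. \<lbrakk>a < n; b < n; x \<in> V\<rbrakk> \<Longrightarrow> e a b x = gl_act \<kappa> a b x"
begin

interpretation G: gl_module sc n e by (rule G)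

lemma act_slE: "a < n \<Longrightarrow> b < n \<Longrightarrow> x \<in> V \<Longrightarrow> act M (slE n a b) x = e a b x - (if a = b then sc \<kappa> x else 0)"
  by (simp add: e_eq gl_act_def)

lemma e_V: "a < n \<Longrightarrow> b < n \<Longrightarrow> x \<in> V \<Longrightarrow> e a b x \<in> V"
  by (simp add: e_eq gl_act_closed)

lemma cyc_subset_V: assumes "x \<in> V" shows "G.cyc x \<subseteq> V"
  unfolding G.cyc_def
proof (rule span_minimal[OF _ V], rule image_subsetI)
  fix w assume "w \<in> words n"
  then show "word_act e w x \<in> V" by (induction w) (auto simp: e_V assms)
qed

lemma cyc_submodule: assumes "x \<in> V" shows "is_submodule n M (G.cyc x)"
  unfolding is_submodule_def
proof (intro conjI ballI)
  fix A y assume A: "A \<in> sl n" and y: "y \<in> G.cyc x"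
  have yV: "y \<in> V" using cyc_subset_V[OF assms] y by (rule subsetD)
  show "act M A y \<in> G.cyc x"
  proof (rule act_in_subspace[OF G.subspace_cyc _ A yV])
    fix a b assume ab: "a < n" "b < n"
    show "act M (slE n a b) y \<in> G.cyc x"
      using G.e_cyc[OF ab y] subspace_diff[OF G.subspace_cyc G.e_cyc[OF ab y] subspace_scale[OF G.subspace_cyc y]]
      by (auto simp: act_slE[OF ab yV])
  qed
qed (use cyc_subset_V[OF assms] G.subspace_cyc in auto)

lemma cyc_eq_V: "G.cyc v = V"
  using gen cyc_submodule[OF v(1)] by (auto simp: generates_module_def)

lemma fil_V: "x \<in> G.fil k v \<Longrightarrow> x \<in> V"
  using G.fil_subset_cyc cyc_eq_V by blast

lemma act_fil:
  assumes "A \<in> sl n" "x \<in> G.fil k v" shows "act M A x \<in> G.fil (Suc k) v"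
proof (rule act_in_subspace[OF G.subspace_fil _ assms(1) fil_V[OF assms(2)]])
  fix a b assume "a < n" "b < n"
  then show "act M (slE n a b) x \<in> G.fil (Suc k) v"
    using assms(2) G.fil_mono[of k "Suc k" v] fil_V[OF assms(2)]
    by (auto simp: act_slE intro!: subspace_diff[OF G.subspace_fil] subspace_neg[OF G.subspace_fil] G.e_fil subspace_scale[OF G.subspace_fil])
qed

lemma wact_fil:
  assumes "set ws \<subseteq> sl n" "x \<in> G.fil k v" shows "wact ws x \<in> G.fil (length ws + k) v"
  using assms(1) by (induction ws) (auto simp: assms(2) act_fil)

lemma env_act_fil:
  assumes "X \<in> env_deg n d" "x \<in> G.fil k v" shows "env_act M X x \<in> G.fil (d + k) v"
proof -
  obtain f where f: "f \<in> free_deg n d" "X = coset n f" using assms(1) by (auto simp: env_deg_def)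
  have "free_act M f x \<in> G.fil (d + k) v" unfolding free_act_def
  proof (intro subspace_sum[OF G.subspace_fil] subspace_scale[OF G.subspace_fil])
    fix w assume "w \<in> Poly_Mapping.keys f"
    then have w: "set (letters w) \<subseteq> sl n" "length (letters w) \<le> d"
      using f(1) by (auto simp: free_deg_def free_carrier)
    show "wact (letters w) x \<in> G.fil (d + k) v"
      using wact_fil[OF w(1) assms(2)] G.fil_mono[of "length (letters w) + k" "d + k" v] w(2) by auto
  qed
  then show ?thesis using f fil_V[OF assms(2)] by (simp add: env_act_coset free_deg_carrier)
qed

lemma fil_finite_span: "G.fil k v \<subseteq> span ((\<lambda>w. word_act e w v) ` words_upto n k)"
  by (simp add: G.fil_def)

lemma finite_subset_fil: assumes "finite F" "F \<subseteq> V" shows "\<exists>j. F \<subseteq> G.fil j v"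
  using assms
proof (induction F rule: finite_induct)
  case (insert x F)
  then obtain i j where ij: "x \<in> G.fil i v" "F \<subseteq> G.fil j v" using G.cyc_in_fil[of x v] cyc_eq_V by auto
  then have "insert x F \<subseteq> G.fil (max i j) v"
    using G.fil_mono[of i "max i j" v] G.fil_mono[of j "max i j" v] by auto
  then show ?case ..
qed simp

context
  fixes W M0 assumes W: "fin_gen_subspace_env n W" and M0: "fin_gen_subspace_module n M M0"
begin

lemma W_deg: obtains d where "W \<subseteq> env_deg n d"
proof -
  have "ring.finite_dimension (env_alg n) (env_scalars n) W"
    using W unfolding fin_gen_subspace_env_def by (rule conjunct1)
  from finite_dimension_env_deg[OF this] show thesis using that by (elim exE)
qed

text \<open>Choose d with \<open>W\<close> inside \<open>env_deg n d\<close> and j with a finite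
  spanning set of \<open>M0\<close> inside \<open>G.fil j v\<close>; a k-th power then consumes at
  most d k letters.\<close>

lemma filtration_subset_fil: "\<exists>d j. \<forall>k. filtration n M W M0 k \<subseteq> G.fil (d * k + j) v"
proof -
  obtain d where d: "W \<subseteq> env_deg n d" by (rule W_deg)
  obtain F where F: "finite F" "F \<subseteq> V" "M0 = span F"
    using M0 by (auto simp: fin_gen_subspace_module_def)
  obtain j where "F \<subseteq> G.fil j v" using finite_subset_fil[OF F(1,2)] by blast
  then have M0_fil: "M0 \<subseteq> G.fil j v" unfolding F(3) by (rule span_minimal) (rule G.subspace_fil)
  have "filtration n M W M0 k \<subseteq> G.fil (d * k + j) v" for k
    unfolding filtration_def
  proof (rule span_minimal[OF _ G.subspace_fil], safe)
    fix X m assume "X \<in> env_pow n W k" "m \<in> M0"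
    then have "X \<in> env_deg n (d * k)" "m \<in> G.fil j v" using env_pow_deg[OF d] M0_fil by auto
    then show "env_act M X m \<in> G.fil (d * k + j) v" by (rule env_act_fil)
  qed
  then show ?thesis by blast
qed

lemma W_carrier: "W \<subseteq> carrier (env_alg n)"
  by (rule W_deg) (rule order_trans[OF _ env_linear_subspaceD(1)[OF env_deg_subspace]])

lemma M0_V: "M0 \<subseteq> V"
  using M0 by (auto simp: fin_gen_subspace_module_def generates_module_def)

lemma filtration_subspace: "subspace (filtration n M W M0 k)"
  by (simp add: filtration_def)

lemma filtration_mono: "k \<le> l \<Longrightarrow> filtration n M W M0 k \<subseteq> filtration n M W M0 l"
  unfolding filtration_def by (rule span_mono) (blast dest: subsetD[OF env_pow_mono[OF W_carrier]])

lemma filtration_V: "filtration n M W M0 k \<subseteq> V"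
  unfolding filtration_def
proof (rule span_minimal[OF _ V], safe)
  fix X m assume "X \<in> env_pow n W k" "m \<in> M0"
  then have "X \<in> carrier (env_alg n)" "m \<in> V" using env_pow_carrier[OF W_carrier] M0_V by auto
  then show "env_act M X m \<in> V" by (rule env_act_closed)
qed

lemma gens_in_env_pow: "\<exists>d. \<forall>a<n. \<forall>b<n. coset n (gen (slE n a b)) \<in> env_pow n W d"
proof -
  have W_gen: "S = carrier (env_alg n)" if "subring S (env_alg n)" "env_scalars n \<subseteq> S" "W \<subseteq> S" for S
    using W that unfolding fin_gen_subspace_env_def by blast
  have "\<exists>d. coset n (gen (slE n a b)) \<in> env_pow n W d" if "a < n" "b < n" for a b
    by (rule env_pow_exhaust[OF W_carrier W_gen coset_closed[OF free_gen[OF slE_sl[OF that]]]])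
  then obtain D where D: "\<And>a b. a < n \<Longrightarrow> b < n \<Longrightarrow> coset n (gen (slE n a b)) \<in> env_pow n W (D a b)"
    by metis
  define d where "d = (\<Sum>a<n. \<Sum>b<n. D a b)"
  have "D a b \<le> d" if "a < n" "b < n" for a b
  proof -
    have "D a b \<le> (\<Sum>b<n. D a b)" using that by (intro member_le_sum) auto
    also have "\<dots> \<le> d" unfolding d_def using that by (intro member_le_sum[of a "{..<n}" "\<lambda>a. \<Sum>b<n. D a b"]) auto
    finally show ?thesis .
  qed
  then have "coset n (gen (slE n a b)) \<in> env_pow n W d" if "a < n" "b < n" for a b
    using subsetD[OF env_pow_mono[OF W_carrier] D[OF that]] that by simp
  then show ?thesis by blast
qed

text \<open>All matrix units lie in one power d of \<open>W\<close>, so each letter moves the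
  filtration by d. The union of the filtration is then a submodule containing \<open>M0\<close>,
  hence everything, and so \<open>v\<close> occurs at some stage j.\<close>

lemma fil_subset_filtration: "\<exists>d j. \<forall>k. G.fil k v \<subseteq> filtration n M W M0 (d * k + j)"
proof -
  obtain d where d: "\<And>a b. a < n \<Longrightarrow> b < n \<Longrightarrow> coset n (gen (slE n a b)) \<in> env_pow n W d"
    using gens_in_env_pow by blast
  have e_filt: "e a b x \<in> filtration n M W M0 (d + j)" if ab: "a < n" "b < n" and x: "x \<in> filtration n M W M0 j" for a b x j
  proof (rule G.e_into[OF filtration_subspace _ x[unfolded filtration_def]])
    fix z assume "z \<in> {env_act M x m |x m. x \<in> env_pow n W j \<and> m \<in> M0}"
    then obtain X m where X: "X \<in> env_pow n W j" "m \<in> M0" "z = env_act M X m" by blast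
    have Xc: "X \<in> carrier (env_alg n)" and m: "m \<in> V" using X env_pow_carrier[OF W_carrier] M0_V by auto
    have z: "z \<in> V" unfolding X(3) by (rule env_act_closed[OF Xc m])
    let ?g = "coset n (gen (slE n a b))"
    have "act M (slE n a b) z = env_act M (?g \<otimes>\<^bsub>env_alg n\<^esub> X) m"
      unfolding X(3) using env_act_closed[OF Xc m]
      by (simp add: env_act_mult coset_closed free_gen slE_sl ab Xc m env_act_gen)
    also have "\<dots> \<in> filtration n M W M0 (d + j)"
      unfolding filtration_def using env_pow_mult[OF W_carrier d[OF ab] X(1)] X(2) by (intro span_base) blast
    finally have 1: "act M (slE n a b) z \<in> filtration n M W M0 (d + j)" .
    have "z \<in> filtration n M W M0 j" unfolding filtration_def X(3) using X by (intro span_base) blast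
    then have 2: "z \<in> filtration n M W M0 (d + j)" using filtration_mono[of j "d + j"] by auto
    show "e a b z \<in> filtration n M W M0 (d + j)"
      using 1 subspace_add[OF filtration_subspace 1 subspace_scale[OF filtration_subspace 2]] ab z
      by (auto simp: e_eq gl_act_def)
  qed
  let ?N = "\<Union>j. filtration n M W M0 j"
  have "is_submodule n M ?N"
    unfolding is_submodule_def
  proof (intro conjI ballI)
    show "subspace ?N"
    proof (rule subspaceI)
      fix x y assume "x \<in> ?N" "y \<in> ?N"
      then obtain i j where "x \<in> filtration n M W M0 i" "y \<in> filtration n M W M0 j" by blast
      then have "x \<in> filtration n M W M0 (max i j)" "y \<in> filtration n M W M0 (max i j)"
        using filtration_mono[of i "max i j"] filtration_mono[of j "max i j"] by auto
      then show "x + y \<in> ?N" using subspace_add[OF filtration_subspace] by blast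
    next
      fix c x assume "x \<in> ?N"
      then show "sc c x \<in> ?N" using subspace_scale[OF filtration_subspace] by blast
    qed (use subspace_0[OF filtration_subspace] in auto)
    show "?N \<subseteq> V" using filtration_V by blast
    fix A x assume A: "A \<in> sl n" and "x \<in> ?N"
    then obtain j where x: "x \<in> filtration n M W M0 j" by blast
    then have xV: "x \<in> V" using filtration_V by blast
    have "act M A x \<in> filtration n M W M0 (d + j)"
    proof (rule act_in_subspace[OF filtration_subspace _ A xV])
      fix a b assume ab: "a < n" "b < n"
      show "act M (slE n a b) x \<in> filtration n M W M0 (d + j)"
        using e_filt[OF ab x] x filtration_mono[of j "d + j"]
        by (auto simp: act_slE[OF ab xV] intro!: subspace_diff[OF filtration_subspace] subspace_scale[OF filtration_subspace])
    qed
    then show "act M A x \<in> ?N" by blast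
  qed
  moreover have "M0 \<subseteq> ?N"
  proof
    fix m assume m: "m \<in> M0"
    then have "m = env_act M (coset n (scalar 1)) m" using M0_V by (auto simp: env_act_one)
    then have "m \<in> filtration n M W M0 0"
      unfolding filtration_def using env_pow_scalar[OF W_carrier] m by (intro span_base) blast
    then show "m \<in> ?N" by blast
  qed
  ultimately have "?N = V"
    using M0 by (auto simp: fin_gen_subspace_module_def generates_module_def)
  then obtain j where j: "v \<in> filtration n M W M0 j" using v(1) by blast
  have word: "word_act e w v \<in> filtration n M W M0 (d * length w + j)" if "w \<in> words n" for w
    using that
  proof (induction w)
    case (Cons l w)
    then show ?case using e_filt[of _ _ _ "d * length w + j"] by (cases l) (auto simp: add.assoc)
  qed (use j in simp)
  have "G.fil k v \<subseteq> filtration n M W M0 (d * k + j)" for k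
    unfolding G.fil_def
  proof (rule span_minimal[OF _ filtration_subspace], rule image_subsetI)
    fix w assume w: "w \<in> words_upto n k"
    then have "d * length w + j \<le> d * k + j" by (simp add: words_upto_def)
    then show "word_act e w v \<in> filtration n M W M0 (d * k + j)"
      using word[of w] w filtration_mono[of "d * length w + j" "d * k + j"] by (auto simp: words_upto_def)
  qed
  then show ?thesis by blast
qed

lemma growth_rate_eq: "growth_rate n M W M0 = growth (\<lambda>k. dim (G.fil k v))"
proof -
  obtain d j where U: "\<And>k. filtration n M W M0 k \<subseteq> G.fil (d * k + j) v"
    using filtration_subset_fil by blast
  obtain d' j' where L: "\<And>k. G.fil k v \<subseteq> filtration n M W M0 (d' * k + j')"
    using fil_subset_filtration by blast
  let ?filt = "\<lambda>k. dim (filtration n M W M0 k)"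
  have "growth ?filt \<le> growth (\<lambda>k. dim (G.fil k v))"
  \<comment> \<open>\<open>Suc d\<close> instead of \<open>d\<close>, because
    \<open>growth_le\<close> requires a factor of at least 1 and \<open>d\<close> may be 0.\<close>
  proof (rule growth_le[of _ 1 _ "Suc d" j])
    fix k
    have "filtration n M W M0 k \<subseteq> G.fil (Suc d * k + j) v"
      using U[of k] G.fil_mono[of "d * k + j" "Suc d * k + j" v] by auto
    then show "?filt k \<le> 1 * dim (G.fil (Suc d * k + j) v)"
      using dim_le_of_span[OF _ fil_finite_span, of "filtration n M W M0 k" "Suc d * k + j"] span_superset by auto
  qed auto
  moreover have "growth (\<lambda>k. dim (G.fil k v)) \<le> growth ?filt"
  proof (rule growth_le[of _ 1 _ "Suc d'" j'])
    fix k
    have 1: "G.fil k v \<subseteq> filtration n M W M0 (Suc d' * k + j')"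
      using L[of k] filtration_mono[of "d' * k + j'" "Suc d' * k + j'"] by auto
    have 2: "filtration n M W M0 (Suc d' * k + j') \<subseteq> span ((\<lambda>w. word_act e w v) ` words_upto n (d * (Suc d' * k + j') + j))"
      by (rule order_trans[OF U fil_finite_span])
    show "dim (G.fil k v) \<le> 1 * ?filt (Suc d' * k + j')"
      using dim_le_of_span[OF order_trans[OF 1 span_superset] 2] by simp
  qed auto
  ultimately show ?thesis by (simp add: growth_rate_def growth_def)
qed

end

text \<open>Without such a pair the condition under the \<open>THE\<close> in \<open>GKdim\<close>
  would be vacuous and would not single out a value.\<close>

lemma generating_subspaces_exist: "\<exists>W M0. fin_gen_subspace_env n W \<and> fin_gen_subspace_module n M M0"
proof -
  interpret U: ring "env_alg n" by (rule ring_env_alg)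
  have K: "subfield (env_scalars n) (env_alg n)"
    by (rule subfield_env_scalars[OF env_alg_nontrivial[OF v]])
  define Us where "Us = map (\<lambda>(a, b). coset n (gen (slE n a b))) (List.product [0..<n] [0..<n])"
  have Us: "set Us \<subseteq> carrier (env_alg n)"
    by (auto simp: Us_def coset_closed free_gen slE_sl)
  let ?W = "U.Span (env_scalars n) Us"
  have "S = carrier (env_alg n)" if "subring S (env_alg n)" "env_scalars n \<subseteq> S" "?W \<subseteq> S" for S
  proof (rule env_generated_by_slE[OF that(1,2)])
    fix a b assume "a < n" "b < n"
    then have "coset n (gen (slE n a b)) \<in> set Us" by (force simp: Us_def)
    then show "coset n (gen (slE n a b)) \<in> S" using U.Span_base_incl[OF K Us] that(3) by blast
  qed
  then have "fin_gen_subspace_env n ?W"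
    unfolding fin_gen_subspace_env_def using U.Span_finite_dimension[OF K Us] by blast
  moreover have "fin_gen_subspace_module n M (span {v})"
    unfolding fin_gen_subspace_module_def generates_module_def
  proof (intro conjI allI impI exI[of _ "{v}"])
    show "span {v} \<subseteq> V" by (rule span_minimal[OF _ V]) (use v in simp)
    fix N assume "is_submodule n M N \<and> span {v} \<subseteq> N"
    then show "N = V" using gen span_base[of v "{v}"] by (auto simp: generates_module_def)
  qed (use v in auto)
  ultimately show ?thesis by blast
qed

lemma GKdim_eq_growth: "GKdim n M = growth (\<lambda>k. dim (G.fil k v))"
  unfolding GKdim_def
proof (rule the_equality)
  show "\<forall>W M0. fin_gen_subspace_env n W \<and> fin_gen_subspace_module n M M0 \<longrightarrow>
      growth_rate n M W M0 = growth (\<lambda>k. dim (G.fil k v))"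
    using growth_rate_eq by blast
  fix d assume "\<forall>W M0. fin_gen_subspace_env n W \<and> fin_gen_subspace_module n M M0 \<longrightarrow> growth_rate n M W M0 = d"
  then show "d = growth (\<lambda>k. dim (G.fil k v))"
    using generating_subspaces_exist growth_rate_eq by blast
qed

end
end

section \<open>Highest weight Harish-Chandra modules\<close>

text \<open>The usual coordinates (n - 1)/2 - i differ from -i by a constant, which contributes a
  multiple of the trace and so vanishes on \<open>cartan n\<close>.\<close>

lemma rho_coords:
  assumes "H \<in> cartan n" shows "rho n H = (\<Sum>i<n. - of_nat i * eps i H)"
proof -
  define x where "x i = eps i H" for i
  have "(\<Sum>j<k. \<Sum>i<j. x i - x j) = (\<Sum>i<k. (of_nat k - 1 - 2 * of_nat i) * x i)" for k
  proof (induction k)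
    case (Suc k)
    have "(\<Sum>i<k. (of_nat (Suc k) - 1 - 2 * of_nat i) * x i) = (\<Sum>i<k. (of_nat k - 1 - 2 * of_nat i) * x i) + (\<Sum>i<k. x i)"
      unfolding sum.distrib[symmetric] by (rule sum.cong) (auto simp: algebra_simps)
    then show ?case using Suc by (simp add: sum_subtractf algebra_simps)
  qed simp
  moreover have "(\<Sum>(i, j)\<in>{(i, j). i < j \<and> j < n}. x i - x j) = (\<Sum>j<n. \<Sum>i<j. x i - x j)"
  proof -
    have "(\<Sum>j<n. \<Sum>i<j. x i - x j) = (\<Sum>(j, i)\<in>(SIGMA j:{..<n}. {..<j}). x i - x j)"
      by (rule sum.Sigma) auto
    also have "\<dots> = (\<Sum>(i, j)\<in>{(i, j). i < j \<and> j < n}. x i - x j)"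
      by (rule sum.reindex_bij_witness[where i = prod.swap and j = prod.swap]) auto
    finally show ?thesis ..
  qed
  moreover have "(\<Sum>i<n. (of_nat n - 1 - 2 * of_nat i) * x i) = (of_nat n - 1) * (\<Sum>i<n. x i) + 2 * (\<Sum>i<n. - of_nat i * x i)"
    unfolding sum_distrib_left sum.distrib[symmetric] by (rule sum.cong) (auto simp: algebra_simps)
  moreover have "(\<Sum>i<n. x i) = 0" using assms by (simp add: x_def eps_def cartan_def sl_def)
  ultimately show ?thesis by (simp add: rho_def x_def)
qed

definition rho_shifted_coords :: "nat \<Rightarrow> weight \<Rightarrow> (nat \<Rightarrow> complex) \<Rightarrow> bool" where
  "rho_shifted_coords n lam w \<longleftrightarrow> (\<forall>H\<in>cartan n. lam H + rho n H = (\<Sum>i<n. w i * eps i H))"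

lemma is_L_gl_module:
  fixes M :: "'v::ab_group_add sl_module"
  assumes L: "is_L n lam M" and w: "rho_shifted_coords n lam w"
  obtains e v where "gl_module (scal M) n e" "gl_module.hw (scal M) n e (\<lambda>i. w i + of_nat i) v"
    "gl_module.simple_at (scal M) n e v"
    "GKdim n M = growth (\<lambda>k. fil_dim (scal M) n e v k)"
proof -
  define m where "m i = w i + of_nat i" for i
  have lam: "lam H = (\<Sum>i<n. m i * eps i H)" if "H \<in> cartan n" for H
  proof -
    have "lam H = (\<Sum>i<n. w i * eps i H) - rho n H" using w that by (simp add: rho_shifted_coords_def algebra_simps)
    then show ?thesis unfolding rho_coords[OF that] sum_subtractf[symmetric]
      by (simp add: m_def algebra_simps)
  qed
  interpret sl_module_locale n M
    using L by unfold_locales (simp add: is_L_def is_simple_module_def)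
  obtain v where v: "v \<in> V" "v \<noteq> 0" and gen: "generates_module n M {v}"
    and nil: "\<And>A. A \<in> nilradical n \<Longrightarrow> act M A v = 0"
    and car: "\<And>H. H \<in> cartan n \<Longrightarrow> act M H v = sc (lam H) v"
    using L by (auto simp: is_L_def is_highest_weight_module_def)
  \<comment> \<open>The traceless diagonal unit \<open>slE n a a\<close> acts on v by
    \<open>m a\<close> minus the mean of the \<open>m i\<close>; adding the mean makes E_aa act by
    exactly \<open>m a\<close>.\<close>
  define \<kappa> where "\<kappa> = (\<Sum>i<n. m i) / of_nat n"
  have "\<exists>e. gl_module sc n e \<and> (\<forall>a<n. \<forall>b<n. \<forall>x\<in>V. e a b x = gl_act \<kappa> a b x)"
  proof (rule gl_act_total[of \<kappa>])
    fix e assume "gl_module sc n e" "\<And>a b x. \<lbrakk>a < n; b < n; x \<in> V\<rbrakk> \<Longrightarrow> e a b x = gl_act \<kappa> a b x"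
    then show ?thesis by (intro exI[of _ e]) simp
  qed
  then obtain e where e: "gl_module sc n e" "\<And>a b x. \<lbrakk>a < n; b < n; x \<in> V\<rbrakk> \<Longrightarrow> e a b x = gl_act \<kappa> a b x"
    by auto
  interpret G: gl_module sc n e by (rule e(1))
  have cyc_V: "G.cyc v = V"
    by (rule cyc_eq_V[OF v gen e(1)]) (rule e(2))
  have "G.hw m v"
    unfolding G.hw_def
  proof (intro conjI allI impI)
    fix a b assume ab: "a < b \<and> b < n"
    then have "slE n a b \<in> nilradical n" by (auto simp: nilradical_def slE_def)
    then show "e a b v = 0" using ab e(2)[of a b v] v(1) nil by (simp add: gl_act_def)
  next
    fix a assume a: "a < n"
    have E: "slE n a a \<in> cartan n"
      using slE_sl[OF a a] by (auto simp: cartan_def diagonal_mat_def slE_def)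
    have "lam (slE n a a) = (\<Sum>i<n. (if i = a then m a else 0) - m i / of_nat n)"
      unfolding lam[OF E] by (rule sum.cong) (auto simp: eps_def slE_def algebra_simps)
    also have "\<dots> = m a - \<kappa>" using a by (simp add: sum_subtractf sum_divide_distrib \<kappa>_def)
    finally show "e a a v = sc (m a) v"
      using e(2)[OF a a v(1)] car[OF E] by (simp add: gl_act_def scale_left_diff_distrib)
  qed (rule v(2))
  moreover have "G.simple_at v"
    unfolding G.simple_at_def
  proof (intro ballI impI)
    fix y assume y: "y \<in> G.cyc v" "y \<noteq> 0"
    then have yV: "y \<in> V" using cyc_V by simp
    have "is_submodule n M (G.cyc y)"
      by (rule cyc_submodule[OF v gen e(1) _ yV]) (rule e(2))
    then have "G.cyc y = {0} \<or> G.cyc y = V"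
      using L unfolding is_L_def is_simple_module_def by blast
    moreover have "G.cyc y \<noteq> {0}" using G.self_in_cyc[of y] y(2) by fastforce
    ultimately have "G.cyc y = V" by simp
    then show "v \<in> G.cyc y" using v(1) by simp
  qed
  moreover have "GKdim n M = growth (\<lambda>k. dim (G.fil k v))"
    by (rule GKdim_eq_growth[OF v gen e(1)]) (rule e(2))
  ultimately show thesis
    using that[OF e(1), of v] unfolding m_def by simp
qed

text \<open>Raising coordinates yields some highest weight module with coordinates \<open>w'\<close>
  and controlled growth; the simple module of the same weight grows no faster.\<close>

lemma growth_le_of_reach:
  fixes r :: "nat \<Rightarrow> nat"
  assumes "gl_module s n e" "gl_module.hw s n e (\<lambda>i. w i + of_nat i) v"
    and "gl_module t n f" "gl_module.hw t n f (\<lambda>i. w' i + of_nat i) u" "gl_module.simple_at t n f u"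
    and "\<And>i. i < n \<Longrightarrow> w' i = w i + of_nat (r i)"
    and "\<And>i j t. \<lbrakk>j < i; i < n; 1 \<le> t; t \<le> r i\<rbrakk> \<Longrightarrow> w i + of_nat t \<noteq> w' j"
  shows "growth (\<lambda>k. fil_dim t n f u k) \<le>
         growth (\<lambda>k. fil_dim s n e v k)"
proof -
  have "growth_at_most n w (\<lambda>k. fil_dim s n e v k)"
    by (rule growth_at_mostI[OF assms(1,2)]) simp
  then obtain C d where C: "C \<ge> 1"
    "growth_at_most n w' (\<lambda>k. C * fil_dim s n e v (k + d))"
    by (rule growth_at_most_reach[OF _ assms(6,7)])
  show ?thesis
    by (rule growth_le[of _ C _ 1 d])
       (use growth_at_most_simple[OF C(2) assms(3,4,5)] C(1) in auto)
qed

lemma strictly_decreasing_gap: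
  fixes h :: "nat \<Rightarrow> int"
  assumes "\<And>i. k \<le> i \<Longrightarrow> Suc i < l \<Longrightarrow> h (Suc i) < h i" "k \<le> i" "i \<le> j" "j < l"
  shows "h j + int (j - i) \<le> h i"
  using assms(3,4)
proof (induction j rule: dec_induct)
  case (step j)
  then show ?case using assms(1)[of j] assms(2) by (simp add: Suc_diff_le)
qed simp


text \<open>Dominance makes the differences integral within each block, and the condition on \<beta>
  equates the first coordinate with the last. All coordinates thus lie in one coset of the integers,
  normalised to be 0 at both ends.\<close>

lemma pq_dominant_coords:
  assumes p: "p \<ge> 1" and q: "q \<ge> 1" and dom: "pq_dominant p q lam"
    and beta: "lam (beta_coroot (p + q)) + rho (p + q) (beta_coroot (p + q)) = 0"
  obtains c0 and h :: "nat \<Rightarrow> int" where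
    "rho_shifted_coords (p + q) lam (\<lambda>i. c0 + of_int (h i))"
    "\<forall>i j. i < j \<and> j < p \<longrightarrow> h j < h i"
    "\<forall>i j. p \<le> i \<and> i < j \<and> j < p + q \<longrightarrow> h j < h i"
    "h 0 = 0" "h (p + q - 1) = 0"
proof -
  obtain c where c: "\<And>H. H \<in> cartan (p + q) \<Longrightarrow> lam H + rho (p + q) H = (\<Sum>i<p+q. c i * eps i H)"
    and dom1: "\<And>i j. i < j \<Longrightarrow> j < p \<Longrightarrow> \<exists>m::nat. m > 0 \<and> c i - c j = of_nat m"
    and dom2: "\<And>i j. p \<le> i \<Longrightarrow> i < j \<Longrightarrow> j < p + q \<Longrightarrow> \<exists>m::nat. m > 0 \<and> c i - c j = of_nat m"
    using dom unfolding pq_dominant_def by blast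
  let ?n = "p + q"
  have "beta_coroot ?n \<in> cartan ?n"
  proof -
    have "(\<Sum>i<?n. beta_coroot ?n $$ (i, i)) = (\<Sum>i<?n. (if i = 0 then 1 else 0) - (if i = ?n - 1 then 1 else 0))"
      by (rule sum.cong) (auto simp: beta_coroot_def coroot_def)
    also have "\<dots> = 0" using p by (simp add: sum_subtractf)
    finally show ?thesis
      by (simp add: cartan_def sl_def diagonal_mat_def) (simp add: beta_coroot_def coroot_def)
  qed
  then have "(\<Sum>i<?n. c i * eps i (beta_coroot ?n)) = 0" using c beta by simp
  also have "(\<Sum>i<?n. c i * eps i (beta_coroot ?n)) = (\<Sum>i<?n. (if i = 0 then c 0 else 0) - (if i = ?n - 1 then c (?n - 1) else 0))"
    by (rule sum.cong) (use p q in \<open>auto simp: eps_def beta_coroot_def coroot_def\<close>)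
  also have "\<dots> = c 0 - c (?n - 1)" using p by (simp add: sum_subtractf)
  finally have c_end: "c (?n - 1) = c 0" by simp
  have "\<exists>h::int. c i = c 0 + of_int h" if i: "i < ?n" for i
  proof -
    consider "i = 0 \<or> i = ?n - 1" | "0 < i" "i < p" | "p \<le> i" "i < ?n - 1" using i by linarith
    then show ?thesis
    proof cases
      case 1
      then show ?thesis using c_end by (auto intro!: exI[of _ 0])
    next
      case 2
      then obtain m :: nat where "c 0 - c i = of_nat m" using dom1[of 0 i] by blast
      then show ?thesis by (intro exI[of _ "- int m"]) (simp add: algebra_simps)
    next
      case 3
      then obtain m :: nat where "c i - c (?n - 1) = of_nat m" using dom2[of i "?n - 1"] p by auto
      then show ?thesis using c_end by (intro exI[of _ "int m"]) (simp add: algebra_simps)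
    qed
  qed
  then have "\<forall>i\<in>{..<?n}. \<exists>h::int. c i = c 0 + of_int h" by simp
  from bchoice[OF this] obtain h :: "nat \<Rightarrow> int" where h: "\<And>i. i < ?n \<Longrightarrow> c i = c 0 + of_int (h i)"
    by auto
  have order: "h j < h i" if ij: "i < ?n" "j < ?n" "\<exists>m::nat. m > 0 \<and> c i - c j = of_nat m" for i j
  proof -
    obtain m :: nat where m: "m > 0" "c i - c j = of_nat m" using ij(3) by blast
    have "(of_int (h i - h j) :: complex) = of_int (int m)"
      using m(2) h[OF ij(1)] h[OF ij(2)] by (simp add: algebra_simps)
    then have "h i - h j = int m" by (simp only: of_int_eq_iff)
    then show ?thesis using m(1) by simp
  qed
  show thesis
  proof
    have "lam H + rho ?n H = (\<Sum>i<?n. (c 0 + of_int (h i)) * eps i H)" if "H \<in> cartan ?n" for H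
      unfolding c[OF that] by (rule sum.cong) (use h in auto)
    then show "rho_shifted_coords ?n lam (\<lambda>i. c 0 + of_int (h i))" by (simp add: rho_shifted_coords_def)
    show "h 0 = 0" using h[of 0] p by simp
    show "h (?n - 1) = 0" using h[of "?n - 1"] c_end p by simp
    show "\<forall>i j. i < j \<and> j < p \<longrightarrow> h j < h i"
      by (intro allI impI order dom1) auto
    show "\<forall>i j. p \<le> i \<and> i < j \<and> j < p + q \<longrightarrow> h j < h i"
      by (intro allI impI order dom2) auto
  qed
qed

lemma of_real_of_int_diff_Ints:
  assumes "z \<notin> \<int>" shows "complex_of_real z + of_int a \<noteq> of_int b"
proof
  assume "complex_of_real z + of_int a = of_int b"
  then have "complex_of_real z = complex_of_real (of_int (b - a))" by (simp add: algebra_simps)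
  then have "z = of_int (b - a)" by (simp only: of_real_eq_iff)
  then show False using assms by simp
qed

context scalar_module
begin

lemma hw_one_shifted: "hw (\<lambda>i. (if i < p then s - of_nat i else - of_nat i) + of_nat i) one"
  using hw_one by (simp add: if_distrib[of "\<lambda>x. x + _"] cong: if_cong)

lemma growth_one_upper: "growth (\<lambda>k. dim (fil k one)) \<le> ereal (real (p * q))"
proof -
  have "growth (\<lambda>k. dim (fil k one)) \<le> growth (\<lambda>k. Suc k ^ (p * q))"
    by (rule growth_le[of _ 1 _ 1 0]) (use dim_fil_one_upper in auto)
  then show ?thesis by (simp only: growth_power)
qed

lemma growth_one_lower:
  assumes "s \<in> \<real>" "Re s < - real q" "p * q \<ge> 1"
  shows "ereal (real (p * q)) \<le> growth (\<lambda>k. dim (fil k one))"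
proof -
  let ?N = "p * q"
  have "growth (\<lambda>k. Suc k ^ ?N) \<le> growth (\<lambda>k. dim (fil k one))"
  \<comment> \<open>The constant comes from k + 1 <= N (k div N + 1), raised to the N-th
    power.\<close>
  proof (rule growth_le[of _ "?N ^ ?N" _ 1 0])
    fix k
    have "k mod ?N < ?N" using assms(3) by (intro mod_less_divisor) simp
    then have "Suc k \<le> ?N * Suc (k div ?N)"
      using mult_div_mod_eq[of ?N k] by (simp only: mult_Suc_right)
    then have "Suc k ^ ?N \<le> (?N * Suc (k div ?N)) ^ ?N" by (rule power_mono) simp
    also have "\<dots> = ?N ^ ?N * Suc (k div ?N) ^ ?N" by (rule power_mult_distrib)
    also have "\<dots> \<le> ?N ^ ?N * dim (fil k one)"
      by (rule mult_le_mono2[OF dim_fil_one_lower[OF assms(1,2)]])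
    finally show "Suc k ^ ?N \<le> ?N ^ ?N * dim (fil (1 * k + 0) one)" by simp
  qed (use assms(3) in auto)
  then show ?thesis by (simp only: growth_power)
qed

end

context
  fixes n :: nat and lam :: weight and M :: "'v::ab_group_add sl_module" and w' :: "nat \<Rightarrow> complex" and r :: "nat \<Rightarrow> nat"
  assumes L: "is_L n lam M" and w': "rho_shifted_coords n lam w'"
begin

lemma GKdim_le_of_reach:
  fixes N :: "'u::ab_group_add sl_module"
  assumes "is_L n mu N" "rho_shifted_coords n mu w"
    and "\<And>i. i < n \<Longrightarrow> w' i = w i + of_nat (r i)"
    and "\<And>i j t. \<lbrakk>j < i; i < n; 1 \<le> t; t \<le> r i\<rbrakk> \<Longrightarrow> w i + of_nat t \<noteq> w' j"
  shows "GKdim n M \<le> GKdim n N"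
proof -
  obtain e v where e: "gl_module (scal N) n e" "gl_module.hw (scal N) n e (\<lambda>i. w i + of_nat i) v"
    "GKdim n N = growth (fil_dim (scal N) n e v)"
    by (rule is_L_gl_module[OF assms(1,2)])
  obtain f u where f: "gl_module (scal M) n f" "gl_module.hw (scal M) n f (\<lambda>i. w' i + of_nat i) u"
    "gl_module.simple_at (scal M) n f u" "GKdim n M = growth (fil_dim (scal M) n f u)"
    by (rule is_L_gl_module[OF L w'])
  show ?thesis unfolding e(3) f(4)
    by (rule growth_le_of_reach[OF e(1,2) f(1,2,3) assms(3,4)])
qed

lemma GKdim_eq_0:
  assumes H: "\<And>i. i < n \<Longrightarrow> w' i = of_int (H i)" "\<And>i. Suc i < n \<Longrightarrow> H (Suc i) < H i"
  shows "GKdim n M = 0"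
proof -
  have gap: "H j + int (j - i) \<le> H i" if "i \<le> j" "j < n" for i j
    by (rule strictly_decreasing_gap[of 0 n]) (use H(2) that in auto)
  obtain f u where f: "gl_module (scal M) n f" "gl_module.hw (scal M) n f (\<lambda>i. w' i + of_nat i) u"
    "gl_module.simple_at (scal M) n f u" "GKdim n M = growth (fil_dim (scal M) n f u)"
    by (rule is_L_gl_module[OF L w'])
  \<comment> \<open>The one-dimensional module with coordinates N - i agrees with \<open>w'\<close>
    in the last coordinate and is nowhere above it, since \<open>w'\<close> drops by at least one
    per step.\<close>
  define N where "N = H (n - 1) + int (n - 1)"
  have r_nonneg: "N \<le> H i + int i" if "i < n" for i
  proof -
    have "i \<le> n - 1" "n - 1 < n" using that by auto
    from gap[OF this] this show ?thesis by (simp add: N_def of_nat_diff)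
  qed
  obtain C d where C: "C \<ge> 1" "growth_at_most n w' (\<lambda>k. C * 1)"
  proof (rule growth_at_most_reach[OF growth_at_most_trivial[of n "of_int N"], where r = "\<lambda>i. nat (H i + int i - N)"])
    show "w' i = of_int N - of_nat i + of_nat (nat (H i + int i - N))" if "i < n" for i
      using r_nonneg[OF that] by (simp add: H(1)[OF that] of_nat_nat)
    fix i j t assume *: "j < i" "i < n" "1 \<le> t" "t \<le> nat (H i + int i - N)"
    have "H i < H j" using gap[of j i] * by simp
    moreover have "N - int i + int t \<le> H i" using * r_nonneg[OF *(2)] by linarith
    moreover have "(of_int N - of_nat i + of_nat t :: complex) = of_int (N - int i + int t)" by simp
    moreover have "w' j = of_int (H j)" using H(1) * by simp
    ultimately show "of_int N - of_nat i + of_nat t \<noteq> w' j" by (simp only: of_int_eq_iff)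
  qed
  have "growth (fil_dim (scal M) n f u) \<le> growth (\<lambda>_. 1)"
    by (rule growth_le[of _ C _ 1 0]) (use growth_at_most_simple[OF C(2) f(1,2,3)] C(1) in auto)
  then show ?thesis using growth_nonneg f(4) growth_one by (metis antisym)
qed

lemma GKdim_upper:
  assumes "n = p + q" "\<And>i. i < n \<Longrightarrow> w' i = (if i < p then s - of_nat i else - of_nat i) + of_nat (r i)"
    and "\<And>i j t. \<lbrakk>j < i; i < n; 1 \<le> t; t \<le> r i\<rbrakk> \<Longrightarrow> (if i < p then s - of_nat i else - of_nat i) + of_nat t \<noteq> w' j"
  shows "GKdim n M \<le> ereal (real (p * q))"
proof -
  interpret S: scalar_module p q s .
  obtain f u where f: "gl_module (scal M) n f" "gl_module.hw (scal M) n f (\<lambda>i. w' i + of_nat i) u"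
    "gl_module.simple_at (scal M) n f u" "GKdim n M = growth (fil_dim (scal M) n f u)"
    by (rule is_L_gl_module[OF L w'])
  note S = S.EE_gl_module S.hw_one_shifted and f' = f[unfolded assms(1)]
  have "GKdim n M \<le> growth (\<lambda>k. S.dim (S.fil k S.one))"
    unfolding assms(1) f'(4) by (rule growth_le_of_reach[OF S f'(1,2,3) assms(2,3)[unfolded assms(1)]])
  also have "\<dots> \<le> ereal (real (p * q))" by (rule S.growth_one_upper)
  finally show ?thesis .
qed

lemma GKdim_lower:
  assumes "n = p + q" "p * q \<ge> 1" "s \<in> \<real>" "Re s < - real q"
    and "\<And>i. i < n \<Longrightarrow> (if i < p then s - of_nat i else - of_nat i) = w' i + of_nat (r i)"
    and "\<And>i j t. \<lbrakk>j < i; i < n; 1 \<le> t; t \<le> r i\<rbrakk> \<Longrightarrow> w' i + of_nat t \<noteq> (if j < p then s - of_nat j else - of_nat j)"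
  shows "ereal (real (p * q)) \<le> GKdim n M"
proof -
  interpret S: scalar_module p q s .
  obtain e v where e: "gl_module (scal M) n e" "gl_module.hw (scal M) n e (\<lambda>i. w' i + of_nat i) v"
    "GKdim n M = growth (fil_dim (scal M) n e v)"
    by (rule is_L_gl_module[OF L w'])
  note S = S.EE_gl_module S.hw_one_shifted S.simple_at_one and e' = e[unfolded assms(1)]
  have "ereal (real (p * q)) \<le> growth (\<lambda>k. S.dim (S.fil k S.one))"
    by (rule S.growth_one_lower[OF assms(3,4,2)])
  also have "\<dots> \<le> GKdim n M"
    unfolding assms(1) e'(3) by (rule growth_le_of_reach[OF e'(1,2) S assms(5,6)[unfolded assms(1)]])
  finally show ?thesis .
qed

end

theorem theorem1p7:
  fixes p q n :: nat
    and lam :: weight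
    and L :: "real \<Rightarrow> 'v::ab_group_add sl_module"
  assumes "p \<ge> 1" and "q \<ge> 1" and "n = p + q"
    and "is_weight n lam"
    and "pq_dominant p q lam"
    and "lam (beta_coroot n) + rho n (beta_coroot n) = 0"
    and "\<And>z::real. is_L n (\<lambda>H. lam H + of_real z * zeta p H) (L z)"
  shows "(\<forall>z1 z2::int. z1 \<le> z2 \<longrightarrow> GKdim n (L (of_int z2)) \<le> GKdim n (L (of_int z1))) \<and>
         (\<exists>z0::int. \<forall>z\<ge>z0. GKdim n (L (of_int z)) = 0) \<and>
         (\<forall>z::real. z \<notin> \<int> \<longrightarrow> GKdim n (L z) = ereal (real (p * q)))"
proof -
  note pq = assms(1,2) and L = assms(7)[unfolded assms(3)]
  obtain c0 and h :: "nat \<Rightarrow> int" where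
    coords: "rho_shifted_coords (p + q) lam (\<lambda>i. c0 + of_int (h i))"
    and h1: "\<forall>i j. i < j \<and> j < p \<longrightarrow> h j < h i"
    and h2: "\<forall>i j. p \<le> i \<and> i < j \<and> j < p + q \<longrightarrow> h j < h i"
    and h0: "h 0 = 0" and hn: "h (p + q - 1) = 0"
    by (rule pq_dominant_coords[OF pq assms(5) assms(6)[unfolded assms(3)]])
  have gap1: "h j + int (j - i) \<le> h i" if "i \<le> j" "j < p" for i j
    by (rule strictly_decreasing_gap[of 0 p]) (use h1 that in auto)
  have gap2: "h j + int (j - i) \<le> h i" if "p \<le> i" "i \<le> j" "j < p + q" for i j
    by (rule strictly_decreasing_gap[of p "p + q"]) (use h2 that in auto)
  \<comment> \<open>Coordinates count only up to a common constant, so \<open>c0\<close> is replaced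
    by a constant \<kappa> to be chosen in each case: 0 for integral coordinates, -K to meet a
    scalar weight.\<close>
  define w where "w \<kappa> z i = \<kappa> + of_int (h i) + (if i < p then complex_of_real z else 0)" for \<kappa> z i
  have w: "rho_shifted_coords (p + q) (\<lambda>H. lam H + of_real z * zeta p H) (w \<kappa> z)" for \<kappa> z
    unfolding rho_shifted_coords_def
  proof
    fix H assume H: "H \<in> cartan (p + q)"
    have tr: "(\<Sum>i<p+q. eps i H) = 0" using H by (simp add: cartan_def sl_def eps_def)
    have z: "zeta p H = (\<Sum>i<p+q. if i < p then eps i H else 0)"
      unfolding zeta_def by (rule sum.mono_neutral_cong_left) auto
    have "(\<Sum>i<p+q. w \<kappa> z i * eps i H) = (\<Sum>i<p+q. (c0 + of_int (h i)) * eps i H)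
        + of_real z * (\<Sum>i<p+q. if i < p then eps i H else 0) + (\<kappa> - c0) * (\<Sum>i<p+q. eps i H)"
      unfolding sum_distrib_left sum.distrib[symmetric]
      by (rule sum.cong) (auto simp: w_def algebra_simps)
    then show "lam H + of_real z * zeta p H + rho (p + q) H = (\<Sum>i<p+q. w \<kappa> z i * eps i H)"
      using coords H tr z by (simp add: rho_shifted_coords_def)
  qed
  \<comment> \<open>Only the first block moves. The coordinates in front of a moving one belong to
    the same block, have reached their targets and lie strictly above all the values it
    takes.\<close>
  have mono: "GKdim (p + q) (L (of_int z2)) \<le> GKdim (p + q) (L (of_int z1))" if "z1 \<le> z2" for z1 z2 :: int
  proof (rule GKdim_le_of_reach[OF L w[of _ 0] L w[of _ 0], where r = "\<lambda>i. if i < p then nat (z2 - z1) else 0"])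
    show "w 0 (of_int z2) i = w 0 (of_int z1) i + of_nat (if i < p then nat (z2 - z1) else 0)" for i
      using that by (simp add: w_def of_nat_nat)
    fix i j t assume *: "j < i" "i < p + q" "1 \<le> t" "t \<le> (if i < p then nat (z2 - z1) else 0)"
    then have i: "i < p" by (auto split: if_splits)
    have "w 0 (of_int z1) i + of_nat t = of_int (h i + z1 + int t)" "w 0 (of_int z2) j = of_int (h j + z2)"
      using i * by (simp_all add: w_def)
    moreover have "h i + z1 + int t < h j + z2" using h1[rule_format, of j i] * i by simp
    ultimately show "w 0 (of_int z1) i + of_nat t \<noteq> w 0 (of_int z2) j" by (simp only: of_int_eq_iff)
  qed
  \<comment> \<open>From this bound on the last coordinate of the first block exceeds the first one
    of the second block, so the whole sequence decreases strictly.\<close>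
  have fin: "GKdim (p + q) (L (of_int z)) = 0" if z: "z \<ge> h p - h (p - 1) + 1" for z :: int
  proof (rule GKdim_eq_0[OF L w[of _ 0], where H = "\<lambda>i. h i + (if i < p then z else 0)"])
    fix i assume i: "Suc i < p + q"
    consider "Suc i < p" | "Suc i = p" | "p \<le> i" by linarith
    then show "h (Suc i) + (if Suc i < p then z else 0) < h i + (if i < p then z else 0)"
      using h1[rule_format, of i "Suc i"] h2[rule_format, of i "Suc i"] z i by cases auto
  qed (simp add: w_def)
  have nonint: "GKdim (p + q) (L z) = ereal (real (p * q))" if z: "z \<notin> \<int>" for z
  proof (rule antisym)
    note ne = of_real_of_int_diff_Ints[OF z]
    show "GKdim (p + q) (L z) \<le> ereal (real (p * q))"
    proof -
      \<comment> \<open>The scalar weight agrees with the target in the last coordinate p - 1 of the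
        first block. In the second block it has coordinates -i, which lie below \<open>h i\<close>
        because \<open>h\<close> decreases strictly to 0 there.\<close>
      define s where "s = complex_of_real z + of_int (h (p - 1) + int (p - 1))"
      define r where "r i = (if i < p then h i + int i - (h (p - 1) + int (p - 1)) else h i + int i)" for i
      have r: "r i \<ge> 0" if "i < p + q" for i
      proof (cases "i < p")
        case True
        then have "i \<le> p - 1" "p - 1 < p" by auto
        from gap1[OF this] this show ?thesis using True by (simp add: r_def of_nat_diff)
      next
        case False
        then have "p \<le> i" "i \<le> p + q - 1" "p + q - 1 < p + q" using that by auto
        from gap2[OF this] show ?thesis using False hn by (simp add: r_def)
      qed
      show ?thesis
      proof (rule GKdim_upper[OF L w[of _ 0] refl, where r = "\<lambda>i. nat (r i)" and s = s])
        show "w 0 z i = (if i < p then s - of_nat i else - of_nat i) + of_nat (nat (r i))" if "i < p + q" for i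
          using r[OF that] by (simp add: w_def s_def r_def of_nat_nat)
        fix i j t assume *: "j < i" "i < p + q" "1 \<le> t" "t \<le> nat (r i)"
        show "(if i < p then s - of_nat i else - of_nat i) + of_nat t \<noteq> w 0 z j"
        proof (cases "i < p")
          case True
          have "(if i < p then s - of_nat i else - of_nat i) + of_nat t = complex_of_real z + of_int (h (p - 1) + int (p - 1) - int i + int t)"
            using True by (simp add: s_def)
          moreover have "w 0 z j = complex_of_real z + of_int (h j)" using True * by (simp add: w_def)
          moreover have "h (p - 1) + int (p - 1) - int i + int t < h j"
            using h1[rule_format, of j i] * True by (simp add: r_def)
          ultimately show ?thesis by (simp only: add_left_cancel of_int_eq_iff)
        next
          case False
          have l: "(if i < p then s - of_nat i else - of_nat i) + of_nat t = (of_int (int t - int i) :: complex)"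
            using False by simp
          show ?thesis
          proof (cases "j < p")
            case True
            then show ?thesis using ne[of "h j" "int t - int i"] unfolding l by (simp add: w_def eq_commute add.commute)
          next
            case j: False
            have "int t - int i < h j" using h2[rule_format, of j i] * False j by (simp add: r_def)
            then show ?thesis unfolding l using j by (simp add: w_def) (metis of_int_diff of_int_eq_iff of_int_of_nat_eq order_less_irrefl)
          qed
        qed
      qed
    qed
    show "ereal (real (p * q)) \<le> GKdim (p + q) (L z)"
    proof -
      \<comment> \<open>Lowering all coordinates by K puts the second block below the scalar
        coordinates -i, which uses the first bound, and makes s = z - K smaller than -q, which uses
        the second. In the first block only h i <= -i is needed, and this follows from h 0 =
        0.\<close>
      define K where "K = max (h p + int (p + q)) (\<lceil>z\<rceil> + int q + 1)"
      define s where "s = complex_of_real z - of_int K"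
      define r where "r i = (if i < p then - h i - int i else K - h i - int i)" for i
      have r: "r i \<ge> 0" if "i < p + q" for i
      proof (cases "i < p")
        case True
        then show ?thesis using gap1[of 0 i] h0 by (simp add: r_def)
      next
        case False
        then have "h i \<le> h p" using gap2[of p i] that by simp
        then show ?thesis using False that by (simp add: r_def K_def max_def)
      qed
      have s: "s \<in> \<real>" "Re s < - real q"
      proof -
        show "s \<in> \<real>" by (simp add: s_def)
        have "real_of_int K \<ge> z + real q + 1" unfolding K_def using le_of_int_ceiling[of z] by linarith
        then show "Re s < - real q" by (simp add: s_def)
      qed
      show ?thesis
      proof (rule GKdim_lower[OF L w[of _ "- of_int K"] refl _ s, where r = "\<lambda>i. nat (r i)"])
        show "1 \<le> p * q" using pq by simp
        show "(if i < p then s - of_nat i else - of_nat i) = w (- of_int K) z i + of_nat (nat (r i))" if "i < p + q" for i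
          using r[OF that] by (simp add: w_def s_def r_def of_nat_nat)
        fix i j t assume *: "j < i" "i < p + q" "1 \<le> t" "t \<le> nat (r i)"
        show "w (- of_int K) z i + of_nat t \<noteq> (if j < p then s - of_nat j else - of_nat j)"
        proof (cases "i < p")
          case True
          have "w (- of_int K) z i + of_nat t = complex_of_real z + of_int (h i - K + int t)"
            using True by (simp add: w_def)
          moreover have "(if j < p then s - of_nat j else - of_nat j) = complex_of_real z + of_int (- K - int j)"
            using True * by (simp add: s_def)
          moreover have "h i - K + int t < - K - int j" using * True by (simp add: r_def)
          ultimately show ?thesis by (simp only: add_left_cancel of_int_eq_iff)
        next
          case False
          have l: "w (- of_int K) z i + of_nat t = of_int (h i - K + int t)" using False by (simp add: w_def)
          show ?thesis
          proof (cases "j < p")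
            case True
            then show ?thesis using ne[of "- K - int j" "h i - K + int t"] unfolding l by (simp add: s_def algebra_simps)
          next
            case j: False
            have "h i - K + int t < - int j" using * False by (simp add: r_def)
            moreover have "(if j < p then s - of_nat j else - of_nat j) = of_int (- int j)" using j by simp
            ultimately show ?thesis unfolding l by (simp only: of_int_eq_iff)
          qed
        qed
      qed
    qed
  qed
  show ?thesis unfolding assms(3) using mono fin nonint by blast
qed

end
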